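(* Let $a>-\frac14$. Then $\mathcal{K}_a\subseteq\mathcal{K}_0$.
   Context: For $a>-\frac14$, $\mathcal{L}_a=-\Delta+a|x|^{-2}$ on $\mathbb{R}^3$ (Friedrichs extension from $C_c^\infty(\mathbb{R}^3\setminus\{0\})$) and $\|f\|_{\dot H^1_a}^2:=\|\sqrt{\mathcal{L}_a}f\|_{L^2}^2=\int_{\mathbb{R}^3}|\nabla f|^2+\frac{a}{|x|^2}|f|^2\,dx$. Notation: $a\wedge b=\min\{a,b\}$, and $$M(f)=\int_{\mathbb{R}^3}|f|^2dx,\quad E_a(f)=\int_{\mathbb{R}^3}\tfrac12|\nabla f|^2+\tfrac{a}{2|x|^2}|f|^2-\tfrac14|f|^4+\tfrac16|f|^6\,dx,\quad V_a(f)=\|f\|_{\dot H^1_a}^2+\|f\|_{L^6}^6-\tfrac34\|f\|_{L^4}^4.$$ For $m>0$, $$\mathcal{E}_a(m):=\inf\{E_{a\wedge0}(f): f\in H^1(\mathbb{R}^3),\ M(f)=m,\ V_{a\wedge 0}(f)=0\}$$ (with value $\infty$ if the constraint set is empty). Let $C_{1,b}$ denote the sharp constant in $\|f\|_{L^4}^4\le C_{1,b}\|f\|_{L^2}\|f\|_{\dot H^1_b}^{3/2}\|f\|_{L^6}^{3/2}$, and let $Q_{1,a\wedge0}$ be an optimizer of this inequality with $b=a\wedge0$, normalized so that it is a non-negative radial solution of $\mathcal{L}_{a\wedge 0}Q+Q^5-Q^3+\omega Q=0$ for some $\omega>0$ with $\|Q\|_{L^6}^6=\|Q\|_{\dot H^1_{a\wedge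 0}}^2$; its mass is $M(Q_{1,a\wedge0})=(8/3)^2C_{1,a\wedge0}^{-2}$. Then $$\mathcal{K}_a:=\{(m,e)\in\mathbb{R}^2: 0<m<M(Q_{1,a\wedge0}),\ 0<e<\mathcal{E}_a(m)\}.$$ *)

theory Defs
  imports "HOL-Analysis.Analysis"
begin

definition partial_deriv :: "3 \<Rightarrow> (real^3 \<Rightarrow> real) \<Rightarrow> real^3 \<Rightarrow> real" where
  "partial_deriv i \<phi> x = frechet_derivative \<phi> (at x) (axis i 1)"

text \<open>Differentiability of all iterated partial derivatives makes each of them continuous,
  so this is the class of infinitely differentiable functions.\<close>

definition smooth :: "(real^3 \<Rightarrow> real) \<Rightarrow> bool" where
  "smooth \<phi> \<longleftrightarrow> (\<forall>is. fold partial_deriv is \<phi> differentiable_on UNIV)"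

definition test_functions :: "(real^3) set \<Rightarrow> (real^3 \<Rightarrow> real) set" where
  "test_functions \<Omega> =
     {\<phi>. smooth \<phi> \<and> compact (closure {x. \<phi> x \<noteq> 0}) \<and> closure {x. \<phi> x \<noteq> 0} \<subseteq> \<Omega>}"

definition locally_integrable :: "(real^3 \<Rightarrow> 'b::euclidean_space) \<Rightarrow> bool" where
  "locally_integrable g \<longleftrightarrow>
     g \<in> borel_measurable lborel \<and> (\<forall>K. compact K \<longrightarrow> set_integrable lborel K g)"

definition square_integrable :: "(real^3 \<Rightarrow> 'b::euclidean_space) \<Rightarrow> bool" where
  "square_integrable g \<longleftrightarrow>
     g \<in> borel_measurable lborel \<and> integrable lborel (\<lambda>x. (norm (g x))\<^sup>2)"

definition is_weak_gradient :: "(real^3 \<Rightarrow> complex) \<Rightarrow> (real^3 \<Rightarrow> complex^3) \<Rightarrow> bool" where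
  "is_weak_gradient f g \<longleftrightarrow>
     locally_integrable g \<and>
     (\<forall>\<phi>\<in>test_functions UNIV. \<forall>i.
        (\<integral>x. f x * of_real (partial_deriv i \<phi> x) \<partial>lborel) =
        - (\<integral>x. g x $ i * of_real (\<phi> x) \<partial>lborel))"

text \<open>A weak gradient is unique up to null sets, so the choice does not affect integrals.\<close>

definition weak_grad :: "(real^3 \<Rightarrow> complex) \<Rightarrow> real^3 \<Rightarrow> complex^3" where
  "weak_grad f = (SOME g. is_weak_gradient f g)"

text \<open>Elements are Borel representatives, not classes modulo equality almost everywhere.\<close>

definition H1 :: "(real^3 \<Rightarrow> complex) set" where
  "H1 = {f. square_integrable f \<and> (\<exists>g. is_weak_gradient f g \<and> square_integrable g)}"

definition Lp_norm :: "real \<Rightarrow> (real^3 \<Rightarrow> complex) \<Rightarrow> real" where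
  "Lp_norm p f = (\<integral>x. norm (f x) powr p \<partial>lborel) powr (1 / p)"

text \<open>By Hardy's inequality the integral is finite and nonnegative
  for \<open>f \<in> H1\<close> and \<open>a > - 1/4\<close>.\<close>

definition Hdot_norm :: "real \<Rightarrow> (real^3 \<Rightarrow> complex) \<Rightarrow> real" where
  "Hdot_norm a f =
     sqrt (\<integral>x. (norm (weak_grad f x))\<^sup>2 + a / (norm x)\<^sup>2 * (norm (f x))\<^sup>2 \<partial>lborel)"

definition mass :: "(real^3 \<Rightarrow> complex) \<Rightarrow> real" where
  "mass f = (\<integral>x. (norm (f x))\<^sup>2 \<partial>lborel)"

definition energy :: "real \<Rightarrow> (real^3 \<Rightarrow> complex) \<Rightarrow> real" where
  "energy a f =
     (\<integral>x. 1 / 2 * (norm (weak_grad f x))\<^sup>2 + a / (2 * (norm x)\<^sup>2) * (norm (f x))\<^sup>2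
          - 1 / 4 * norm (f x) ^ 4 + 1 / 6 * norm (f x) ^ 6 \<partial>lborel)"

definition virial :: "real \<Rightarrow> (real^3 \<Rightarrow> complex) \<Rightarrow> real" where
  "virial a f = (Hdot_norm a f)\<^sup>2 + Lp_norm 6 f ^ 6 - 3 / 4 * Lp_norm 4 f ^ 4"

text \<open>The value is \<open>\<infinity>\<close> when the constraint set is empty.\<close>

definition min_energy :: "real \<Rightarrow> real \<Rightarrow> ereal" where
  "min_energy a m =
     (INF f\<in>{f \<in> H1. mass f = m \<and> virial (min a 0) f = 0}. ereal (energy (min a 0) f))"

definition GNH_bound :: "real \<Rightarrow> (real^3 \<Rightarrow> complex) \<Rightarrow> real" where
  "GNH_bound b f =
     Lp_norm 2 f * Hdot_norm b f powr (3 / 2) * Lp_norm 6 f powr (3 / 2)"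

definition sharp_const :: "real \<Rightarrow> real" where
  "sharp_const b = Inf {C. 0 \<le> C \<and> (\<forall>f\<in>H1. Lp_norm 4 f ^ 4 \<le> C * GNH_bound b f)}"

text \<open>The equation \<open>L_b Q + Q^5 - Q^3 + \<omega> Q = 0\<close>, where \<open>L_b = - \<Delta> + b / |x|^2\<close>
  acts through its quadratic form. Since \<open>L_b\<close> is the Friedrichs extension from the smooth
  functions compactly supported away from the origin, it is tested against those.\<close>

definition solves_elliptic :: "real \<Rightarrow> real \<Rightarrow> (real^3 \<Rightarrow> complex) \<Rightarrow> bool" where
  "solves_elliptic b \<omega> Q \<longleftrightarrow>
     (\<forall>\<phi>\<in>test_functions (- {0}).
        (\<integral>x. (\<Sum>i\<in>UNIV. weak_grad Q x $ i * of_real (partial_deriv i \<phi> x))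
             + (of_real (b / (norm x)\<^sup>2) * Q x + Q x ^ 5 - Q x ^ 3 + of_real \<omega> * Q x)
               * of_real (\<phi> x) \<partial>lborel) = 0)"

definition normalized_optimizer :: "real \<Rightarrow> (real^3 \<Rightarrow> complex) \<Rightarrow> bool" where
  "normalized_optimizer b Q \<longleftrightarrow>
     Q \<in> H1 \<and> mass Q \<noteq> 0 \<and>
     Lp_norm 4 Q ^ 4 = sharp_const b * GNH_bound b Q \<and>
     (\<forall>x. Q x \<in> \<real>\<^sub>\<ge>\<^sub>0) \<and>
     (\<forall>x y. norm x = norm y \<longrightarrow> Q x = Q y) \<and>
     (\<exists>\<omega>>0. solves_elliptic b \<omega> Q) \<and>
     Lp_norm 6 Q ^ 6 = (Hdot_norm b Q)\<^sup>2"

text \<open>\<open>Q\<close> is meant to be a normalized optimizer for the parameter \<open>min a 0\<close>; all of these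
  have the same mass.\<close>

definition K_region :: "real \<Rightarrow> (real^3 \<Rightarrow> complex) \<Rightarrow> (real \<times> real) set" where
  "K_region a Q = {(m, e). 0 < m \<and> m < mass Q \<and> 0 < e \<and> ereal e < min_energy a m}"

end

theory Submission
  imports Defs
begin

text \<open>
  Put \<open>b = min a 0 \<le> 0\<close> and let \<open>(m, e)\<close> lie in the region for \<open>a\<close>, so that
  \<open>0 < e < min_energy a m\<close>. Both requirements of the region for \<open>0\<close> follow from the
  positivity of \<open>min_energy a m\<close> and two facts about minimal energies.

  The first is \<open>min_energy a m \<le> min_energy 0 m\<close> (\<open>min_energy_le_min_energy_0\<close>). Let \<open>f\<close> have mass
  \<open>m\<close> and vanishing virial for the parameter \<open>0\<close>. Since \<open>b \<le> 0\<close>, its virial for \<open>b\<close> is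
  nonpositive. Along the mass-preserving dilations \<open>\<mu> powr (3 / 2) * f (\<mu> x)\<close>, \<open>\<mu> \<ge> 1\<close>, the virial
  is \<open>\<mu>\<close> times the derivative of the energy and tends to infinity because of the sextic term. It
  therefore reaches zero, and up to its first zero the energy decreases; the function found there
  competes for \<open>min_energy a m\<close> and has energy at most \<open>energy 0 f\<close>. The argument needs a nonnegative
  quadratic form \<open>\<integral> |grad f|^2 + b / |x|^2 |f|^2\<close>. Positivity of \<open>min_energy a m\<close> provides it: if the
  form vanished at \<open>f\<close>, then some dilate of \<open>f\<close> would have zero virial and nonpositive energy,
  and if the form were negative, then it would vanish at \<open>exp (i t x_1) f\<close> for a suitable \<open>t\<close>, a
  function with the same modulus as \<open>f\<close>.

  The second is \<open>min_energy 0 m \<le> 0\<close> for \<open>m\<close> at least the mass of an optimizer \<open>Q\<close>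
  (\<open>min_energy_0_nonpos\<close>), so that \<open>m\<close> is smaller than this mass. By the normalization
  \<open>\<integral> |Q|^6 = \<integral> |grad Q|^2\<close>, stretching \<open>Q\<close> in space produces functions of nonpositive virial and
  energy as soon as \<open>\<integral> |Q|^4 = 8 / 3 * \<integral> |grad Q|^2\<close>, which says that the virial of \<open>Q\<close>
  vanishes. To see this, compare two equations for \<open>Q\<close>: the Euler--Lagrange equation of the
  interpolation inequality, in which \<open>Q^3\<close> has the coefficient
  \<open>k = 8 (\<integral> |grad Q|^2) / (3 \<integral> |Q|^4)\<close>, and the elliptic equation, in which it has the
  coefficient \<open>1\<close>. If \<open>k \<noteq> 1\<close>, subtracting them shows that \<open>Q\<close> takes only the values \<open>0\<close> and
  \<open>sqrt s\<close> for some \<open>s > 0\<close>; then \<open>- \<Delta> Q = s^2 Q\<close>, and a nonnegative eigenfunction on the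
  whole space must vanish (\<open>no_nonneg_eigenfunction\<close>).

  The Euler--Lagrange equation presupposes that the sharp constant is an honest infimum, which is the
  Sobolev embedding of \<open>H1\<close> into \<open>L^6\<close>. It is derived by mollification from the
  Gagliardo--Nirenberg argument: the fundamental theorem of calculus on lines combined with the
  Loomis--Whitney inequality. The fundamental lemma of the calculus of variations, which also comes
  from mollification, makes weak gradients unique and yields the pointwise comparison of the two
  equations.
\<close>

section \<open>Smooth functions and a bump\<close>

lemma partial_deriv_eqI:
  "(\<phi> has_derivative D) (at x) \<Longrightarrow> partial_deriv i \<phi> x = D (axis i 1)"
  unfolding partial_deriv_def using frechet_derivative_at by metis

text \<open>Smoothness is a statement about lists of derivatives; the recursion by orders is the form in which
  the Leibniz rule can be used inductively.\<close>

fun k_smooth :: "nat \<Rightarrow> (real^3 \<Rightarrow> real) \<Rightarrow> bool" where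
  "k_smooth 0 \<phi> \<longleftrightarrow> \<phi> differentiable_on UNIV"
| "k_smooth (Suc n) \<phi> \<longleftrightarrow> \<phi> differentiable_on UNIV \<and> (\<forall>i. k_smooth n (partial_deriv i \<phi>))"

lemma k_smooth_iff_fold:
  "k_smooth n \<phi> \<longleftrightarrow> (\<forall>is. length is \<le> n \<longrightarrow> fold partial_deriv is \<phi> differentiable_on UNIV)"
proof (induction n arbitrary: \<phi>)
  case 0
  show ?case by simp
next
  case (Suc n)
  have "(\<forall>is. length is \<le> Suc n \<longrightarrow> fold partial_deriv is \<phi> differentiable_on UNIV) \<longleftrightarrow>
     \<phi> differentiable_on UNIV \<and>
     (\<forall>i is. length is \<le> n \<longrightarrow> fold partial_deriv is (partial_deriv i \<phi>) differentiable_on UNIV)"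
    (is "?L \<longleftrightarrow> ?R")
  proof
    assume L: ?L
    have "\<phi> differentiable_on UNIV" using L[rule_format, of "[]"] by simp
    moreover have "fold partial_deriv is (partial_deriv i \<phi>) differentiable_on UNIV"
      if "length is \<le> n" for i "is"
      using L[rule_format, of "i # is"] that by simp
    ultimately show ?R by blast
  next
    assume R: ?R
    show ?L
    proof (intro allI impI)
      fix "is" :: "3 list" assume "length is \<le> Suc n"
      then show "fold partial_deriv is \<phi> differentiable_on UNIV"
        using R by (cases "is") auto
    qed
  qed
  then show ?case using Suc.IH by simp
qed

lemma smooth_iff_k_smooth: "smooth \<phi> \<longleftrightarrow> (\<forall>n. k_smooth n \<phi>)"
  unfolding smooth_def k_smooth_iff_fold by blast

lemma k_smooth_differentiable: "k_smooth n \<phi> \<Longrightarrow> \<phi> differentiable (at x)"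
  by (cases n) (auto simp: differentiable_on_def)

lemma k_smooth_Suc_imp: "k_smooth (Suc n) \<phi> \<Longrightarrow> k_smooth n \<phi>"
  by (induction n arbitrary: \<phi>) auto

lemma smooth_differentiable: "smooth \<phi> \<Longrightarrow> \<phi> differentiable (at x)"
  using smooth_iff_k_smooth k_smooth_differentiable by blast

lemma smooth_partial_deriv: "smooth \<phi> \<Longrightarrow> smooth (partial_deriv i \<phi>)"
  by (meson k_smooth.simps(2) smooth_iff_k_smooth)

lemma smooth_continuous: "smooth \<phi> \<Longrightarrow> continuous_on UNIV \<phi>"
  by (meson smooth_differentiable continuous_at_imp_continuous_on differentiable_imp_continuous_within)

lemma partial_deriv_add:
  assumes "\<phi> differentiable (at x)" "\<psi> differentiable (at x)"
  shows "partial_deriv i (\<lambda>x. \<phi> x + \<psi> x) x = partial_deriv i \<phi> x + partial_deriv i \<psi> x"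
proof -
  have "((\<lambda>x. \<phi> x + \<psi> x) has_derivative
      (\<lambda>h. frechet_derivative \<phi> (at x) h + frechet_derivative \<psi> (at x) h)) (at x)"
    using assms by (intro has_derivative_add) (simp_all add: frechet_derivative_works[THEN iffD1])
  from partial_deriv_eqI[OF this] show ?thesis unfolding partial_deriv_def by simp
qed

lemma partial_deriv_mult:
  assumes "\<phi> differentiable (at x)" "\<psi> differentiable (at x)"
  shows "partial_deriv i (\<lambda>x. \<phi> x * \<psi> x) x
     = partial_deriv i \<phi> x * \<psi> x + \<phi> x * partial_deriv i \<psi> x"
proof -
  have "((\<lambda>x. \<phi> x * \<psi> x) has_derivative
      (\<lambda>h. \<phi> x * frechet_derivative \<psi> (at x) h + frechet_derivative \<phi> (at x) h * \<psi> x)) (at x)"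
    using assms by (intro has_derivative_mult) (simp_all add: frechet_derivative_works[THEN iffD1])
  from partial_deriv_eqI[OF this] show ?thesis unfolding partial_deriv_def by simp
qed

lemma k_smooth_add: "k_smooth n \<phi> \<Longrightarrow> k_smooth n \<psi> \<Longrightarrow> k_smooth n (\<lambda>x. \<phi> x + \<psi> x)"
proof (induction n arbitrary: \<phi> \<psi>)
  case (Suc n)
  have "partial_deriv i (\<lambda>x. \<phi> x + \<psi> x) = (\<lambda>x. partial_deriv i \<phi> x + partial_deriv i \<psi> x)" for i
    using Suc.prems by (intro ext partial_deriv_add) (auto intro: k_smooth_differentiable simp del: k_smooth.simps)
  with Suc show ?case by (auto intro: differentiable_on_add)
qed (auto intro: differentiable_on_add)

lemma k_smooth_mult: "k_smooth n \<phi> \<Longrightarrow> k_smooth n \<psi> \<Longrightarrow> k_smooth n (\<lambda>x. \<phi> x * \<psi> x)"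
proof (induction n arbitrary: \<phi> \<psi>)
  case (Suc n)
  have "partial_deriv i (\<lambda>x. \<phi> x * \<psi> x)
      = (\<lambda>x. partial_deriv i \<phi> x * \<psi> x + \<phi> x * partial_deriv i \<psi> x)" for i
    using Suc.prems by (intro ext partial_deriv_mult) (auto intro: k_smooth_differentiable simp del: k_smooth.simps)
  moreover have "k_smooth n (\<lambda>x. partial_deriv i \<phi> x * \<psi> x + \<phi> x * partial_deriv i \<psi> x)" for i
    using Suc.prems k_smooth_Suc_imp[OF Suc.prems(1)] k_smooth_Suc_imp[OF Suc.prems(2)]
    by (intro k_smooth_add Suc.IH) auto
  ultimately show ?case using Suc.prems by (auto intro: differentiable_on_mult)
qed (auto intro: differentiable_on_mult)

lemma smooth_mult: "smooth \<phi> \<Longrightarrow> smooth \<psi> \<Longrightarrow> smooth (\<lambda>x. \<phi> x * \<psi> x)"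
  by (simp add: smooth_iff_k_smooth k_smooth_mult)

text \<open>A family of differentiable functions that contains its own partial derivatives consists of smooth
  functions. This covers functions of one coordinate and affine substitutions without computing
  iterated derivatives.\<close>

lemma smooth_coinduct:
  assumes "\<phi> \<in> S" and "\<And>\<phi>. \<phi> \<in> S \<Longrightarrow> \<phi> differentiable_on UNIV"
    and "\<And>\<phi> i. \<phi> \<in> S \<Longrightarrow> partial_deriv i \<phi> \<in> S"
  shows "smooth \<phi>"
proof -
  have "\<phi> \<in> S \<Longrightarrow> k_smooth n \<phi>" for n
    by (induction n arbitrary: \<phi>) (use assms in auto)
  then show ?thesis using assms(1) smooth_iff_k_smooth by blast
qed

lemma partial_deriv_const: "partial_deriv i (\<lambda>x. c) = (\<lambda>x. 0)"
  unfolding partial_deriv_def by (simp add: fun_eq_iff)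

lemma smooth_const: "smooth (\<lambda>x. c)"
  by (rule smooth_coinduct[of _ "range (\<lambda>c x. c)"]) (auto simp: partial_deriv_const)

lemma has_derivative_coordinate:
  fixes x :: "real^3"
  assumes "\<forall>t. (p has_real_derivative p' t) (at t)"
  shows "((\<lambda>x. p (x $ j)) has_derivative (\<lambda>h. p' (x $ j) * (h $ j))) (at x)"
proof -
  have "((\<lambda>x::real^3. x $ j) has_derivative (\<lambda>h. h $ j)) (at x)"
    by (rule bounded_linear_imp_has_derivative[OF bounded_linear_vec_nth])
  moreover have "(p has_derivative (*) (p' (x $ j))) (at (x $ j))"
    using assms by (simp add: has_field_derivative_def)
  ultimately show ?thesis using has_derivative_compose by blast
qed

lemma smooth_coordinate:
  assumes F: "p \<in> F" "\<And>p. p \<in> F \<Longrightarrow> \<exists>p'\<in>F. \<forall>t. (p has_real_derivative p' t) (at t)"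
    and zero: "(\<lambda>t. 0) \<in> F"
  shows "smooth (\<lambda>x. p (x $ j))"
proof (rule smooth_coinduct[of _ "(\<lambda>p x. p (x $ j)) ` F"])
  have hd: "((\<lambda>x. p (x $ j)) has_derivative (\<lambda>h. p' (x $ j) * (h $ j))) (at x)"
    if "\<forall>t. (p has_real_derivative p' t) (at t)" for p p' and x :: "real^3"
    using that has_derivative_coordinate by blast
  fix \<phi> :: "real^3 \<Rightarrow> real" assume "\<phi> \<in> (\<lambda>p x. p (x $ j)) ` F"
  then obtain p p' where p: "\<phi> = (\<lambda>x. p (x $ j))" "p' \<in> F" "\<forall>t. (p has_real_derivative p' t) (at t)"
    using F(2) by blast
  show "\<phi> differentiable_on UNIV"
    unfolding differentiable_on_def p(1) using hd[OF p(3)] differentiableI by blast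
  show "partial_deriv i \<phi> \<in> (\<lambda>p x. p (x $ j)) ` F" for i
  proof (cases "i = j")
    case True
    have "partial_deriv i \<phi> = (\<lambda>x. p' (x $ j))"
      unfolding p(1) using True by (auto simp: partial_deriv_eqI[OF hd[OF p(3)]])
    then show ?thesis using p(2) by blast
  next
    case False
    have "partial_deriv i \<phi> = (\<lambda>x. 0)"
      unfolding p(1) using False by (auto simp: partial_deriv_eqI[OF hd[OF p(3)]] axis_def)
    then show ?thesis using zero by force
  qed
qed (use F in blast)

lemma partial_deriv_coordinate:
  assumes "\<forall>t. (p has_real_derivative p' t) (at t)"
  shows "partial_deriv i (\<lambda>x. p (x $ j)) = (\<lambda>x. if i = j then p' (x $ j) else 0)"
  using partial_deriv_eqI[OF has_derivative_coordinate[OF assms]] by (auto simp: axis_def)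

lemma partial_deriv_affine:
  assumes "\<And>x. \<phi> differentiable (at x)"
  shows "partial_deriv i (\<lambda>x. \<phi> (c *\<^sub>R x + d)) x = c * partial_deriv i \<phi> (c *\<^sub>R x + d)"
proof -
  have "((\<lambda>x. c *\<^sub>R x + d) has_derivative (\<lambda>h. c *\<^sub>R h)) (at x)"
    by (auto intro!: derivative_eq_intros)
  moreover have "(\<phi> has_derivative frechet_derivative \<phi> (at (c *\<^sub>R x + d))) (at (c *\<^sub>R x + d))"
    using assms by (simp add: frechet_derivative_works[THEN iffD1])
  ultimately have *: "((\<lambda>x. \<phi> (c *\<^sub>R x + d)) has_derivative
      (\<lambda>h. frechet_derivative \<phi> (at (c *\<^sub>R x + d)) (c *\<^sub>R h))) (at x)"
    using has_derivative_compose by blast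
  have "linear (frechet_derivative \<phi> (at (c *\<^sub>R x + d)))"
    using assms linear_frechet_derivative by blast
  then show ?thesis
    using partial_deriv_eqI[OF *] by (simp add: partial_deriv_def linear_cmul)
qed

lemma smooth_affine: 
  assumes "smooth \<phi>" shows "smooth (\<lambda>x. \<phi> (c *\<^sub>R x + d))"
proof (rule smooth_coinduct[of _ "{\<lambda>x. b * \<phi> (c *\<^sub>R x + d) |b \<phi>. smooth \<phi>}"])
  show "(\<lambda>x. \<phi> (c *\<^sub>R x + d)) \<in> {\<lambda>x. b * \<phi> (c *\<^sub>R x + d) |b \<phi>. smooth \<phi>}"
    using assms by (intro CollectI exI[of _ 1] exI[of _ \<phi>]) simp
next
  fix \<zeta> assume "\<zeta> \<in> {\<lambda>x. b * \<phi> (c *\<^sub>R x + d) |b \<phi>. smooth \<phi>}"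
  then obtain b \<phi> where \<zeta>: "\<zeta> = (\<lambda>x. b * \<phi> (c *\<^sub>R x + d))" and s: "smooth \<phi>" by blast
  have d0: "(\<lambda>x. \<phi> (c *\<^sub>R x + d)) differentiable (at x)" for x
    by (rule differentiable_compose[of \<phi>, OF smooth_differentiable[OF s]]) simp
  show "\<zeta> differentiable_on UNIV"
    unfolding differentiable_on_def \<zeta> using d0 by auto
  show "partial_deriv i \<zeta> \<in> {\<lambda>x. b * \<phi> (c *\<^sub>R x + d) |b \<phi>. smooth \<phi>}" for i
  proof -
    have "partial_deriv i \<zeta> x = (b * c) * partial_deriv i \<phi> (c *\<^sub>R x + d)" for x
      unfolding \<zeta> partial_deriv_mult[OF differentiable_const d0] partial_deriv_const
        partial_deriv_affine[OF smooth_differentiable[OF s]] by simp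
    then have "partial_deriv i \<zeta> = (\<lambda>x. (b * c) * partial_deriv i \<phi> (c *\<^sub>R x + d))" by (rule ext)
    then show ?thesis using smooth_partial_deriv[OF s] by blast
  qed
qed

text \<open>The functions \<open>P (1 / t) * exp (- 1 / t)\<close>, continued by zero to \<open>t \<le> 0\<close>, are closed under
  differentiation: the derivative replaces \<open>P\<close> by \<open>X^2 (P - P')\<close>. At the origin this holds because the
  exponential beats every power of \<open>1 / t\<close>.\<close>

definition exp_germ :: "real poly \<Rightarrow> real \<Rightarrow> real" where
  "exp_germ P t = (if 0 < t then poly P (1 / t) * exp (- (1 / t)) else 0)"

lemma poly_exp_tendsto_0:
  fixes P :: "real poly"
  shows "((\<lambda>x. poly P x * exp (- x)) \<longlongrightarrow> 0) at_top"
proof (induction P rule: pCons_induct)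
  case 0
  show ?case by simp
next
  case (pCons a P)
  have *: "((\<lambda>x. x * (poly P x * exp (- x))) \<longlongrightarrow> 0) at_top"
  proof -
    have "((\<lambda>x. (\<Sum>i\<le>degree P. coeff P i * (x ^ (Suc i) / exp x))) \<longlongrightarrow> (\<Sum>i\<le>degree P. coeff P i * 0)) at_top"
      by (intro tendsto_intros tendsto_power_div_exp_0)
    moreover have "(\<lambda>x. (\<Sum>i\<le>degree P. coeff P i * (x ^ (Suc i) / exp x))) = (\<lambda>x. x * (poly P x * exp (- x)))"
      by (simp add: poly_altdef sum_distrib_left sum_distrib_right exp_minus field_simps)
    ultimately show ?thesis by simp
  qed
  have "((\<lambda>x::real. x ^ 0 / exp x) \<longlongrightarrow> 0) at_top" by (rule tendsto_power_div_exp_0)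
  then have "((\<lambda>x. a * exp (- x)) \<longlongrightarrow> a * 0) at_top"
    by (intro tendsto_intros) (simp add: exp_minus divide_inverse)
  from tendsto_add[OF this *] show ?case by (simp add: algebra_simps)
qed

lemma exp_germ_has_derivative:
  "(exp_germ P has_real_derivative exp_germ ([:0, 0, 1:] * (P - pderiv P)) t) (at t)"
proof -
  consider "t > 0" | "t < 0" | "t = 0" by linarith
  then show ?thesis
  proof cases
    case 1
    have "((\<lambda>t. poly P (1 / t) * exp (- (1 / t))) has_real_derivative
       (poly (pderiv P) (1 / t) * (- (1 / t\<^sup>2)) * exp (- (1 / t)) + (exp (- (1 / t)) * (1 / t\<^sup>2)) * poly P (1 / t))) (at t)"
      using 1 by (auto intro!: derivative_eq_intros DERIV_chain2[OF poly_DERIV] simp: power2_eq_square field_simps)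
    moreover have "poly (pderiv P) (1 / t) * (- (1 / t\<^sup>2)) * exp (- (1 / t)) + (exp (- (1 / t)) * (1 / t\<^sup>2)) * poly P (1 / t)
       = exp_germ ([:0, 0, 1:] * (P - pderiv P)) t"
      using 1 by (simp add: exp_germ_def power2_eq_square field_simps)
    ultimately have "((\<lambda>t. poly P (1 / t) * exp (- (1 / t))) has_real_derivative
       exp_germ ([:0, 0, 1:] * (P - pderiv P)) t) (at t)" by simp
    then show ?thesis
      by (rule has_field_derivative_transform_within_open[of _ _ _ "{0<..}"])
         (use 1 in \<open>auto simp: exp_germ_def\<close>)
  next
    case 2
    have "((\<lambda>t. 0) has_real_derivative 0) (at t)" by simp
    then have "(exp_germ P has_real_derivative 0) (at t)"
      by (rule has_field_derivative_transform_within_open[of _ _ _ "{..<0}"])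
         (use 2 in \<open>auto simp: exp_germ_def\<close>)
    then show ?thesis using 2 by (simp add: exp_germ_def)
  next
    case 3
    have r: "((\<lambda>h. exp_germ P h / h) \<longlongrightarrow> 0) (at_right 0)"
    proof -
      have "((\<lambda>h. poly (pCons 0 P) (inverse h) * exp (- (inverse h))) \<longlongrightarrow> 0) (at_right (0::real))"
        using poly_exp_tendsto_0 filterlim_inverse_at_top_right by (rule filterlim_compose)
      then show ?thesis
        by (rule Lim_transform_eventually)
          (auto simp: eventually_at_right_less exp_germ_def field_simps
             intro!: eventually_at_rightI[of 0 1])
    qed
    have l: "((\<lambda>h. exp_germ P h / h) \<longlongrightarrow> 0) (at_left 0)"
      by (rule Lim_transform_eventually[of "\<lambda>_. 0"])
        (auto simp: exp_germ_def intro!: eventually_at_leftI[of "-1"])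
    have "((\<lambda>h. exp_germ P h / h) \<longlongrightarrow> 0) (at 0)"
      using l r by (rule filterlim_split_at)
    then show ?thesis using 3 by (simp add: DERIV_def exp_germ_def)
  qed
qed

text \<open>The standard bump \<open>exp (- 2 / (1 - t^2))\<close> on \<open>(-1, 1)\<close>.\<close>

definition bump1 :: "real \<Rightarrow> real" where
  "bump1 t = exp_germ 1 (1 + t) * exp_germ 1 (1 - t)"

definition bump :: "real^3 \<Rightarrow> real" where
  "bump x = bump1 (x $ 1) * bump1 (x $ 2) * bump1 (x $ 3)"

lemma smooth_exp_germ_coordinate: "smooth (\<lambda>x. exp_germ P (b + c * x $ j))"
proof (rule smooth_coordinate[of "\<lambda>t. exp_germ P (b + c * t)" "{\<lambda>t. k * exp_germ P (b + c * t) |k P. True}"])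
  show "(\<lambda>t. exp_germ P (b + c * t)) \<in> {\<lambda>t. k * exp_germ P (b + c * t) |k P. True}"
    by (rule CollectI, intro exI[of _ 1] exI[of _ P]) simp
  show "(\<lambda>t. 0) \<in> {\<lambda>t. k * exp_germ P (b + c * t) |k P. True}"
    by (rule CollectI, rule exI[of _ 0]) simp
  fix p assume "p \<in> {\<lambda>t. k * exp_germ P (b + c * t) |k P. True}"
  then obtain k P where p: "p = (\<lambda>t. k * exp_germ P (b + c * t))" by blast
  have "(p has_real_derivative (k * c) * exp_germ ([:0, 0, 1:] * (P - pderiv P)) (b + c * t)) (at t)" for t
    unfolding p
    by (rule derivative_eq_intros DERIV_chain2[OF exp_germ_has_derivative] refl | simp)+
  then show "\<exists>p'\<in>{\<lambda>t. k * exp_germ P (b + c * t) |k P. True}. \<forall>t. (p has_real_derivative p' t) (at t)"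
    by (intro bexI[of _ "\<lambda>t. (k * c) * exp_germ ([:0, 0, 1:] * (P - pderiv P)) (b + c * t)"]) blast+
qed

lemma smooth_bump: "smooth bump"
proof -
  have "smooth (\<lambda>x. bump1 (x $ j))" for j
    unfolding bump1_def using smooth_exp_germ_coordinate[of 1 1 1 j] smooth_exp_germ_coordinate[of 1 1 "-1" j]
    by (auto intro!: smooth_mult)
  then show ?thesis unfolding bump_def[abs_def] by (intro smooth_mult)
qed

lemma bump1_nonneg: "0 \<le> bump1 t"
  by (simp add: bump1_def exp_germ_def)

lemma bump1_pos_iff: "0 < bump1 t \<longleftrightarrow> \<bar>t\<bar> < 1"
  by (auto simp: bump1_def exp_germ_def)

lemma bump1_eq_0_iff: "bump1 t = 0 \<longleftrightarrow> 1 \<le> \<bar>t\<bar>"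
  using bump1_pos_iff[of t] bump1_nonneg[of t] by linarith

lemma bump_nonneg: "0 \<le> bump x"
  by (simp add: bump_def bump1_nonneg)

lemma bump_nonzero_iff: "bump x \<noteq> 0 \<longleftrightarrow> (\<forall>i. \<bar>x $ i\<bar> < 1)"
  by (auto simp: bump_def bump1_eq_0_iff forall_3)

lemma bump_nonzero_norm: "bump x \<noteq> 0 \<Longrightarrow> norm x < 2"
proof -
  assume "bump x \<noteq> 0"
  then have "(x $ i)\<^sup>2 < 1" for i
    by (simp add: bump_nonzero_iff abs_square_less_1)
  then have "(norm x)\<^sup>2 < 2\<^sup>2"
    using less_trans[of "(norm x)\<^sup>2" 3 4]
    unfolding norm_vec_def L2_set_def by (simp add: sum_3 sum_nonneg) (smt (verit))
  then show ?thesis using power_less_imp_less_base by fastforce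
qed

text \<open>A lower bound for \<open>p'' / p\<close> is what turns wide bumps into approximate subsolutions of
  \<open>p'' + \<kappa> p = 0\<close>. With \<open>s = 1 / (1 - t^2) \<ge> 1\<close> the quotient is
  \<open>16 s^4 - 32 s^3 + 12 s^2\<close>, which is negative only for \<open>s < 3 / 2\<close>.\<close>

lemma bump1_second_derivative:
  obtains p1 p2 where "\<forall>t. (bump1 has_real_derivative p1 t) (at t)" "\<forall>t. (p1 has_real_derivative p2 t) (at t)"
    "\<And>t. p2 t \<ge> - 9 * bump1 t"
proof -
  define P1 P2 where "P1 = ([:0, 0, 1:] :: real poly)" and "P2 = [:0, 0, 1:] * (P1 - pderiv P1)"
  have d1: "(exp_germ 1 has_real_derivative exp_germ P1 t) (at t)" for t
    using exp_germ_has_derivative[of 1 t] by (simp add: P1_def)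
  have d2: "(exp_germ P1 has_real_derivative exp_germ P2 t) (at t)" for t
    using exp_germ_has_derivative[of P1 t] by (simp add: P2_def)
  define p1 where "p1 t = exp_germ P1 (1 + t) * exp_germ 1 (1 - t) - exp_germ 1 (1 + t) * exp_germ P1 (1 - t)" for t
  define p2 where "p2 t = exp_germ P2 (1 + t) * exp_germ 1 (1 - t) - 2 * (exp_germ P1 (1 + t) * exp_germ P1 (1 - t))
     + exp_germ 1 (1 + t) * exp_germ P2 (1 - t)" for t
  have D1: "((\<lambda>t. exp_germ 1 (1 + t)) has_real_derivative exp_germ P1 (1 + t)) (at t)"
    "((\<lambda>t. exp_germ 1 (1 - t)) has_real_derivative - exp_germ P1 (1 - t)) (at t)"
    "((\<lambda>t. exp_germ P1 (1 + t)) has_real_derivative exp_germ P2 (1 + t)) (at t)"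
    "((\<lambda>t. exp_germ P1 (1 - t)) has_real_derivative - exp_germ P2 (1 - t)) (at t)" for t
  proof -
    have a: "((\<lambda>t. 1 + t) has_real_derivative 1) (at t)" "((\<lambda>t. 1 - t) has_real_derivative -1) (at t)"
      by (auto intro!: derivative_eq_intros)
    show "((\<lambda>t. exp_germ 1 (1 + t)) has_real_derivative exp_germ P1 (1 + t)) (at t)"
      using DERIV_chain2[OF d1 a(1)] by simp
    show "((\<lambda>t. exp_germ 1 (1 - t)) has_real_derivative - exp_germ P1 (1 - t)) (at t)"
      using DERIV_chain2[OF d1 a(2)] by simp
    show "((\<lambda>t. exp_germ P1 (1 + t)) has_real_derivative exp_germ P2 (1 + t)) (at t)"
      using DERIV_chain2[OF d2 a(1)] by simp
    show "((\<lambda>t. exp_germ P1 (1 - t)) has_real_derivative - exp_germ P2 (1 - t)) (at t)"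
      using DERIV_chain2[OF d2 a(2)] by simp
  qed
  have "(bump1 has_real_derivative p1 t) (at t)" for t
    unfolding bump1_def[abs_def] p1_def by (rule derivative_eq_intros D1 refl | simp)+
  moreover have "(p1 has_real_derivative p2 t) (at t)" for t
    unfolding p1_def[abs_def] p2_def by (rule derivative_eq_intros D1 refl | simp)+
  moreover have "p2 t \<ge> - 9 * bump1 t" for t
  proof (cases "\<bar>t\<bar> < 1")
    case False
    then show ?thesis unfolding p2_def bump1_def exp_germ_def by auto
  next
    case True
    define A B where "A = 1 / (1 + t)" and "B = 1 / (1 - t)"
    have pos: "1 + t > 0" "1 - t > 0" using True by auto
    have AB: "A + B = 2 * (A * B)" using pos by (simp add: A_def B_def field_simps)
    have "(1 + t) * (1 - t) \<le> 1" "(1 + t) * (1 - t) > 0"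
      using pos by (simp add: algebra_simps, intro mult_pos_pos)
    then have P: "A * B \<ge> 1" by (simp add: A_def B_def)
    have pp: "poly P2 y = y ^ 4 - 2 * y ^ 3" "poly P1 y = y\<^sup>2" for y
      by (simp_all add: P2_def P1_def pderiv_pCons algebra_simps power2_eq_square power3_eq_cube power4_eq_xxxx)
    have "p2 t = ((A ^ 4 - 2 * A ^ 3) - 2 * (A\<^sup>2 * B\<^sup>2) + (B ^ 4 - 2 * B ^ 3)) * bump1 t"
      using pos unfolding p2_def bump1_def exp_germ_def A_def B_def pp by (simp add: pp algebra_simps)
    moreover have "(A ^ 4 - 2 * A ^ 3) - 2 * (A\<^sup>2 * B\<^sup>2) + (B ^ 4 - 2 * B ^ 3) \<ge> - 9"
    proof -
      define s where "s = A * B"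
      have s: "s \<ge> 1" "A + B = 2 * s" using P AB by (auto simp: s_def)
      have "(A ^ 4 - 2 * A ^ 3) - 2 * (A\<^sup>2 * B\<^sup>2) + (B ^ 4 - 2 * B ^ 3)
        = (A + B)\<^sup>2 * ((A + B)\<^sup>2 - 4 * (A * B)) - 2 * ((A + B) ^ 3 - 3 * (A * B) * (A + B))"
        by algebra
      also have "\<dots> = 16 * s ^ 4 - 32 * s ^ 3 + 12 * s\<^sup>2"
        unfolding s(2) s_def[symmetric] by algebra
      also have "\<dots> = - 9 + (3 + 12 * (s - 1 - 1 / 3)\<^sup>2 + 2 / 3 + 32 * (s - 1) ^ 3 + 16 * (s - 1) ^ 4)"
        by (simp add: field_simps power2_eq_square power3_eq_cube power4_eq_xxxx)
      also have "\<dots> \<ge> - 9"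
      proof -
        have "0 \<le> (s - 1 - 1 / 3)\<^sup>2" "0 \<le> (s - 1) ^ 3" "0 \<le> (s - 1) ^ 4" using s(1) by auto
        then show ?thesis by linarith
      qed
      finally show ?thesis .
    qed
    ultimately show ?thesis
      using bump1_nonneg[of t] mult_right_mono by metis
  qed
  ultimately show ?thesis using that by blast
qed

section \<open>Integration on three-space and test functions\<close>

lemma nn_integral_affine3:
  fixes f :: "real^3 \<Rightarrow> ennreal"
  assumes [measurable]: "f \<in> borel_measurable borel" and c: "c \<noteq> 0"
  shows "(\<integral>\<^sup>+x. f x \<partial>lborel) = ennreal (\<bar>c\<bar> ^ 3) * (\<integral>\<^sup>+x. f (t + c *\<^sub>R x) \<partial>lborel)"
  by (subst lborel_affine[OF c, of t])
     (simp add: nn_integral_density nn_integral_distr nn_integral_cmult)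

lemma integrable_affine3:
  fixes f :: "real^3 \<Rightarrow> 'b::{banach, second_countable_topology}"
  assumes f: "integrable lborel f" and c: "c \<noteq> 0"
  shows "integrable lborel (\<lambda>x. f (t + c *\<^sub>R x))"
proof -
  have [measurable]: "f \<in> borel_measurable borel" using f by auto
  have "(\<integral>\<^sup>+x. norm (f x) \<partial>lborel) < \<infinity>" using f by (simp add: integrable_iff_bounded)
  then have "ennreal (\<bar>c\<bar> ^ 3) * (\<integral>\<^sup>+x. norm (f (t + c *\<^sub>R x)) \<partial>lborel) < \<infinity>"
    by (subst (asm) nn_integral_affine3[OF _ c, of _ t]) auto
  then show ?thesis using c by (auto simp: integrable_iff_bounded ennreal_mult_less_top)
qed

lemma integrable_affine3_iff:
  fixes f :: "real^3 \<Rightarrow> 'b::{banach, second_countable_topology}"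
  assumes "c \<noteq> 0"
  shows "integrable lborel (\<lambda>x. f (t + c *\<^sub>R x)) \<longleftrightarrow> integrable lborel f"
  using integrable_affine3[of f c t] integrable_affine3[of "\<lambda>x. f (t + c *\<^sub>R x)" "1 / c" "- (1 / c) *\<^sub>R t"] assms
  by (auto simp: algebra_simps)

lemma integral_affine3:
  fixes f :: "real^3 \<Rightarrow> 'b::{banach, second_countable_topology}"
  assumes c: "c \<noteq> 0"
  shows "(LBINT x. f (t + c *\<^sub>R x)) = (LBINT x. f x) /\<^sub>R \<bar>c\<bar> ^ 3"
proof (cases "integrable lborel f")
  case True
  have [measurable]: "f \<in> borel_measurable borel" using True by auto
  have "(LBINT x. f x) = \<bar>c\<bar> ^ 3 *\<^sub>R (LBINT x. f (t + c *\<^sub>R x))"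
    by (subst lborel_affine[OF c, of t]) (simp add: integral_density integral_distr)
  then show ?thesis using c by simp
next
  case False
  then show ?thesis using integrable_affine3_iff[OF c, of f t] by (simp add: not_integrable_integral_eq)
qed

lemma integral_reflect3:
  fixes f :: "real^3 \<Rightarrow> 'b::{banach, second_countable_topology}"
  shows "(LBINT y. f (x - y)) = (LBINT y. f y)"
  using integral_affine3[of "-1" f x] by simp

lemma test_functions_UNIV_iff:
  "\<phi> \<in> test_functions UNIV \<longleftrightarrow> smooth \<phi> \<and> (\<exists>R. \<forall>x. norm x > R \<longrightarrow> \<phi> x = 0)"
proof -
  have "compact (closure {x. \<phi> x \<noteq> 0}) \<longleftrightarrow> (\<exists>R. \<forall>x. norm x > R \<longrightarrow> \<phi> x = 0)"
    unfolding compact_closure bounded_iff using not_less by auto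
  then show ?thesis by (auto simp: test_functions_def)
qed

lemma test_functions_mono: "\<phi> \<in> test_functions \<Omega> \<Longrightarrow> \<phi> \<in> test_functions UNIV"
  by (auto simp: test_functions_def)

lemma test_functions_partial_deriv:
  assumes "\<phi> \<in> test_functions \<Omega>" shows "partial_deriv i \<phi> \<in> test_functions \<Omega>"
proof -
  let ?K = "closure {x. \<phi> x \<noteq> 0}"
  have "partial_deriv i \<phi> x = 0" if x: "x \<notin> ?K" for x
  proof -
    have z: "\<phi> y = 0" if "y \<in> - ?K" for y using that closure_subset[of "{x. \<phi> x \<noteq> 0}"] by blast
    have o: "open (- ?K)" "x \<in> - ?K" using x by (simp_all add: open_Compl)
    have "((\<lambda>x. 0::real) has_derivative (\<lambda>h. 0)) (at x)" by simp
    from has_derivative_transform_within_open[OF this o z[symmetric]]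
    have "(\<phi> has_derivative (\<lambda>h. 0)) (at x)" .
    from partial_deriv_eqI[OF this] show ?thesis .
  qed
  then have "{x. partial_deriv i \<phi> x \<noteq> 0} \<subseteq> ?K" by blast
  then have "closure {x. partial_deriv i \<phi> x \<noteq> 0} \<subseteq> ?K" by (simp add: closure_minimal)
  then show ?thesis using assms
    using compact_Int_closed[of ?K "closure {x. partial_deriv i \<phi> x \<noteq> 0}"]
    by (auto simp: test_functions_def smooth_partial_deriv Int_absorb1)
qed

lemma test_function_bounds:
  assumes "\<phi> \<in> test_functions UNIV"
  obtains B R where "0 \<le> B" "0 \<le> R" "\<And>x. \<bar>\<phi> x\<bar> \<le> B" "\<And>x. norm x > R \<Longrightarrow> \<phi> x = 0"
proof -
  obtain R where R: "\<And>x. norm x > R \<Longrightarrow> \<phi> x = 0" using assms test_functions_UNIV_iff by blast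
  have c: "continuous_on UNIV \<phi>" using assms test_functions_UNIV_iff smooth_continuous by blast
  have "compact (\<phi> ` cball 0 R)"
    by (intro compact_continuous_image continuous_on_subset[OF c]) auto
  then obtain B where B: "\<And>x. x \<in> cball 0 R \<Longrightarrow> \<bar>\<phi> x\<bar> \<le> B"
    using compact_imp_bounded bounded_iff by (metis image_eqI real_norm_def)
  show ?thesis
  proof (rule that[of "max B 0" "max R 0"])
    show "\<bar>\<phi> x\<bar> \<le> max B 0" for x
      using B[of x] R[of x] by (cases "norm x \<le> R") auto
  qed (use R in auto)
qed

lemma test_function_borel: "\<phi> \<in> test_functions UNIV \<Longrightarrow> \<phi> \<in> borel_measurable borel"
  using test_functions_UNIV_iff smooth_continuous borel_measurable_continuous_onI by blast

lemma test_functions_mult: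
  assumes "smooth \<phi>" "\<psi> \<in> test_functions \<Omega>"
  shows "(\<lambda>x. \<phi> x * \<psi> x) \<in> test_functions \<Omega>"
proof -
  have "closure {x. \<phi> x * \<psi> x \<noteq> 0} \<subseteq> closure {x. \<psi> x \<noteq> 0}"
    by (intro closure_mono) auto
  then show ?thesis using assms
    using compact_Int_closed[of "closure {x. \<psi> x \<noteq> 0}" "closure {x. \<phi> x * \<psi> x \<noteq> 0}"]
    by (auto simp: test_functions_def smooth_mult Int_absorb1)
qed

lemma test_functions_affine:
  assumes "\<phi> \<in> test_functions UNIV" "c \<noteq> 0"
  shows "(\<lambda>x. \<phi> (c *\<^sub>R x + d)) \<in> test_functions UNIV"
proof -
  obtain R where R: "\<And>x. norm x > R \<Longrightarrow> \<phi> x = 0" using assms(1) test_functions_UNIV_iff by blast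
  have "\<phi> (c *\<^sub>R x + d) = 0" if "norm x > (R + norm d) / \<bar>c\<bar>" for x
  proof (rule R)
    have "R + norm d < \<bar>c\<bar> * norm x" using that assms(2) by (simp add: field_simps)
    also have "\<dots> \<le> norm (c *\<^sub>R x + d) + norm d"
      using norm_triangle_ineq4[of "c *\<^sub>R x + d" d] by simp
    finally show "norm (c *\<^sub>R x + d) > R" by simp
  qed
  then show ?thesis using assms(1) smooth_affine test_functions_UNIV_iff by blast
qed

lemma integrable_bounded_times:
  fixes w :: "real^3 \<Rightarrow> 'b::euclidean_space"
  assumes "locally_integrable w" and [measurable]: "\<phi> \<in> borel_measurable borel"
    and "\<And>x. \<bar>\<phi> x\<bar> \<le> B" "\<And>x. norm x > R \<Longrightarrow> \<phi> x = 0"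
  shows "integrable lborel (\<lambda>x. \<phi> x *\<^sub>R w x)"
proof (rule Bochner_Integration.integrable_bound)
  have [measurable]: "w \<in> borel_measurable borel" using assms by (simp add: locally_integrable_def)
  show "(\<lambda>x. \<phi> x *\<^sub>R w x) \<in> borel_measurable lborel" by measurable
  have "set_integrable lborel (cball 0 R) w" using assms by (simp add: locally_integrable_def)
  then show "integrable lborel (\<lambda>x. B *\<^sub>R (indicator (cball 0 R) x *\<^sub>R w x))"
    unfolding set_integrable_def by (rule integrable_scaleR_right)
  have "0 \<le> B" using assms(3)[of 0] by simp
  then show "AE x in lborel. norm (\<phi> x *\<^sub>R w x) \<le> norm (B *\<^sub>R (indicator (cball 0 R) x *\<^sub>R w x))"
    using assms(3,4) by (auto simp: indicator_def mult_right_mono)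
qed

lemma integrable_test_times:
  fixes w :: "real^3 \<Rightarrow> 'b::euclidean_space"
  assumes "locally_integrable w" "\<phi> \<in> test_functions UNIV"
  shows "integrable lborel (\<lambda>x. \<phi> x *\<^sub>R w x)"
  using test_function_bounds[OF assms(2)] integrable_bounded_times[OF assms(1) test_function_borel[OF assms(2)]]
  by metis

lemma continuous_locally_integrable:
  fixes w :: "real^3 \<Rightarrow> 'b::euclidean_space"
  assumes "continuous_on UNIV w" shows "locally_integrable w"
  unfolding locally_integrable_def set_integrable_def
  using assms by (auto intro!: borel_integrable_compact continuous_on_subset[OF assms] borel_measurable_continuous_onI)

lemma square_integrable_locally_integrable:
  fixes w :: "real^3 \<Rightarrow> 'b::euclidean_space"
  assumes "square_integrable w" shows "locally_integrable w"
  unfolding locally_integrable_def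
proof (intro conjI allI impI)
  show [measurable]: "w \<in> borel_measurable lborel" using assms by (simp add: square_integrable_def)
  fix K :: "(real^3) set" assume K: "compact K"
  have [measurable]: "K \<in> sets borel" using K by (simp add: borel_compact)
  show "set_integrable lborel K w" unfolding set_integrable_def
  proof (rule Bochner_Integration.integrable_bound)
    show "integrable lborel (\<lambda>x. indicator K x + (norm (w x))\<^sup>2)"
      using assms emeasure_bounded_finite[OF compact_imp_bounded[OF K]]
      by (auto simp: square_integrable_def)
    have "t \<le> 1 + t\<^sup>2" for t :: real using zero_le_power2[of "t - 1/2"] by (simp add: power2_eq_square algebra_simps)
    then show "AE x in lborel. norm (indicator K x *\<^sub>R w x) \<le> norm (indicator K x + (norm (w x))\<^sup>2)"
      by (auto simp: indicator_def)
  qed measurable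
qed

lemma line_has_derivative:
  assumes "smooth \<phi>"
  shows "((\<lambda>s. \<phi> (x + s *\<^sub>R axis i 1)) has_real_derivative partial_deriv i \<phi> (x + s *\<^sub>R axis i 1)) (at s)"
proof -
  let ?y = "x + s *\<^sub>R axis i 1"
  have "(\<phi> has_derivative frechet_derivative \<phi> (at ?y)) (at ?y)"
    using smooth_differentiable[OF assms] frechet_derivative_works by blast
  moreover have "((\<lambda>s. x + s *\<^sub>R axis i 1) has_derivative (\<lambda>h. h *\<^sub>R axis i 1)) (at s)"
    by (auto intro!: derivative_eq_intros)
  ultimately have "((\<lambda>s. \<phi> (x + s *\<^sub>R axis i 1)) has_derivative
      (\<lambda>h. frechet_derivative \<phi> (at ?y) (h *\<^sub>R axis i 1))) (at s)"
    using has_derivative_compose by blast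
  moreover have "linear (frechet_derivative \<phi> (at ?y))"
    using smooth_differentiable[OF assms] linear_frechet_derivative by blast
  ultimately show ?thesis
    by (simp add: has_field_derivative_def partial_deriv_def linear_cmul mult_commute_abs)
qed

text \<open>This bound dominates the difference quotients when a convolution is differentiated.\<close>

lemma line_difference_bound:
  assumes "smooth \<phi>" "\<And>x. \<bar>partial_deriv i \<phi> x\<bar> \<le> L"
  shows "\<bar>\<phi> (x + s *\<^sub>R axis i 1) - \<phi> x\<bar> \<le> L * \<bar>s\<bar>"
proof -
  have "norm (\<phi> (x + s *\<^sub>R axis i 1) - \<phi> (x + 0 *\<^sub>R axis i 1)) \<le> L * norm (s - 0)"
    by (rule field_differentiable_bound[OF convex_UNIV, where f' = "\<lambda>s. partial_deriv i \<phi> (x + s *\<^sub>R axis i 1)"])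
       (use assms line_has_derivative[OF assms(1)] in auto)
  then show ?thesis by simp
qed

definition convolve :: "(real^3 \<Rightarrow> real) \<Rightarrow> (real^3 \<Rightarrow> real) \<Rightarrow> real^3 \<Rightarrow> real" where
  "convolve \<phi> w x = (LBINT y. \<phi> (x - y) * w y)"

lemma test_functions_reflect:
  "\<phi> \<in> test_functions UNIV \<Longrightarrow> (\<lambda>y. \<phi> (x - y)) \<in> test_functions UNIV"
  using test_functions_affine[of \<phi> "-1" x] by (simp add: algebra_simps)

lemma integrable_convolve:
  assumes "locally_integrable w" "\<phi> \<in> test_functions UNIV"
  shows "integrable lborel (\<lambda>y. \<phi> (x - y) * w y)"
  using integrable_test_times[OF assms(1) test_functions_reflect[OF assms(2)]] by simp

lemma continuous_convolve:
  assumes w: "locally_integrable w" and \<phi>: "\<phi> \<in> test_functions UNIV"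
  shows "continuous_on UNIV (convolve \<phi> w)"
proof -
  obtain B R where BR: "0 \<le> B" "0 \<le> R" "\<And>x. \<bar>\<phi> x\<bar> \<le> B" "\<And>x. norm x > R \<Longrightarrow> \<phi> x = 0"
    using test_function_bounds[OF \<phi>] by metis
  have [measurable]: "\<phi> \<in> borel_measurable borel" "w \<in> borel_measurable borel"
    using test_function_borel[OF \<phi>] w by (auto simp: locally_integrable_def)
  have c: "isCont \<phi> z" for z
    using \<phi> smooth_continuous test_functions_UNIV_iff continuous_on_eq_continuous_at by blast
  show ?thesis
  proof (subst continuous_on_sequentially, intro allI ballI impI)
    fix X :: "nat \<Rightarrow> real^3" and x assume "(\<forall>n. X n \<in> UNIV) \<and> X \<longlonglongrightarrow> x"
    then have X: "X \<longlonglongrightarrow> x" by simp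
    then obtain K where K: "\<And>n. norm (X n) \<le> K"
      by (metis Bseq_def convergentI convergent_imp_Bseq)
    have nz: "norm (X n - y) > R" if "y \<notin> cball 0 (K + R)" for n y
      using norm_triangle_ineq4[of "X n" "X n - y"] K[of n] that by auto
    have "(\<lambda>n. convolve \<phi> w (X n)) \<longlonglongrightarrow> convolve \<phi> w x"
      unfolding convolve_def
    proof (rule integral_dominated_convergence)
      have "set_integrable lborel (cball 0 (K + R)) w" using w by (simp add: locally_integrable_def)
      then show "integrable lborel (\<lambda>y. B * norm (indicator (cball 0 (K + R)) y *\<^sub>R w y))"
        unfolding set_integrable_def by (intro integrable_mult_right integrable_norm)
      show "AE y in lborel. norm (\<phi> (X n - y) * w y) \<le> B * norm (indicator (cball 0 (K + R)) y *\<^sub>R w y)" for n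
        using BR nz[of _ n] by (auto simp: indicator_def abs_mult intro!: mult_right_mono)
      show "AE y in lborel. (\<lambda>n. \<phi> (X n - y) * w y) \<longlonglongrightarrow> \<phi> (x - y) * w y"
        by (intro AE_I2 tendsto_intros isCont_tendsto_compose[OF c] X)
    qed measurable
    then show "(convolve \<phi> w \<circ> X) \<longlonglongrightarrow> convolve \<phi> w x" by (simp add: o_def)
  qed
qed

text \<open>The difference quotients of \<open>\<phi>\<close> are bounded and vanish outside a fixed ball as long as the
  increments stay bounded, so dominated convergence applies to any locally integrable weight.\<close>

lemma convolve_has_derivative:
  assumes w: "locally_integrable w" and \<phi>: "\<phi> \<in> test_functions UNIV"
  shows "((\<lambda>s. convolve \<phi> w (x + s *\<^sub>R axis i 1)) has_real_derivative
           convolve (partial_deriv i \<phi>) w (x + s *\<^sub>R axis i 1)) (at s)"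
proof -
  let ?e = "axis i 1 :: real^3"
  have s: "smooth \<phi>" using \<phi> test_functions_UNIV_iff by blast
  have \<phi>': "partial_deriv i \<phi> \<in> test_functions UNIV" by (rule test_functions_partial_deriv[OF \<phi>])
  obtain R where R: "0 \<le> R" "\<And>x. norm x > R \<Longrightarrow> \<phi> x = 0"
    using test_function_bounds[OF \<phi>] by metis
  obtain L where L: "0 \<le> L" "\<And>x. \<bar>partial_deriv i \<phi> x\<bar> \<le> L"
    using test_function_bounds[OF \<phi>'] by metis
  have [measurable]: "\<phi> \<in> borel_measurable borel" "w \<in> borel_measurable borel" "partial_deriv i \<phi> \<in> borel_measurable borel"
    using test_function_borel[OF \<phi>] test_function_borel[OF \<phi>'] w by (auto simp: locally_integrable_def)
  define z where "z = x + s *\<^sub>R ?e"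
  have "((\<lambda>h. (convolve \<phi> w (z + h *\<^sub>R ?e) - convolve \<phi> w z) / h) \<longlongrightarrow> convolve (partial_deriv i \<phi>) w z) (at 0)"
    unfolding tendsto_at_iff_sequentially
  proof (intro allI impI)
    fix X :: "nat \<Rightarrow> real" assume X0: "\<forall>i. X i \<in> UNIV - {0}" and X: "X \<longlonglongrightarrow> 0"
    then obtain K where K: "\<And>n. norm (X n) \<le> K"
      by (metis Bseq_def convergentI convergent_imp_Bseq)
    have K0: "K \<ge> 0" using K[of 0] norm_ge_zero order_trans by blast
    let ?q = "\<lambda>n y. (\<phi> (z - y + X n *\<^sub>R ?e) - \<phi> (z - y)) / X n"
    let ?C = "cball 0 (norm z + K + R)"
    have nz: "norm (z - y + X n *\<^sub>R ?e) > R" "norm (z - y) > R" if "y \<notin> ?C" for n y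
    proof -
      have "norm y \<le> norm (z - y + X n *\<^sub>R ?e) + norm z + norm (X n *\<^sub>R ?e)"
        using norm_triangle_ineq4[of "z + X n *\<^sub>R ?e" "z - y + X n *\<^sub>R ?e"] norm_triangle_ineq[of z "X n *\<^sub>R ?e"]
        by (simp add: algebra_simps)
      then show "norm (z - y + X n *\<^sub>R ?e) > R" using K[of n] that by auto
      show "norm (z - y) > R" using norm_triangle_ineq4[of z "z - y"] that K0 by auto
    qed
    have eq: "(convolve \<phi> w (z + X n *\<^sub>R ?e) - convolve \<phi> w z) / X n = (LBINT y. ?q n y * w y)" for n
    proof -
      have "convolve \<phi> w (z + X n *\<^sub>R ?e) - convolve \<phi> w z
        = (LBINT y. \<phi> (z + X n *\<^sub>R ?e - y) * w y - \<phi> (z - y) * w y)"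
        unfolding convolve_def using integrable_convolve[OF w \<phi>] by (intro Bochner_Integration.integral_diff[symmetric]) auto
      then show ?thesis
        by (simp add: algebra_simps diff_divide_distrib flip: integral_divide_zero)
    qed
    have "(\<lambda>n. (LBINT y. ?q n y * w y)) \<longlonglongrightarrow> (LBINT y. partial_deriv i \<phi> (z - y) * w y)"
    proof (rule integral_dominated_convergence)
      have "set_integrable lborel ?C w" using w by (simp add: locally_integrable_def)
      then show "integrable lborel (\<lambda>y. L * norm (indicator ?C y *\<^sub>R w y))"
        unfolding set_integrable_def by (intro integrable_mult_right integrable_norm)
      show "AE y in lborel. norm (?q n y * w y) \<le> L * norm (indicator ?C y *\<^sub>R w y)" for n
      proof (rule AE_I2)
        fix y
        show "norm (?q n y * w y) \<le> L * norm (indicator ?C y *\<^sub>R w y)"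
        proof (cases "y \<in> ?C")
          case True
          have "\<bar>?q n y\<bar> \<le> L"
            using line_difference_bound[OF s L(2), of "z - y" "X n"] X0 by (simp add: field_simps)
          then show ?thesis
            using True mult_right_mono[of "\<bar>?q n y\<bar>" L "\<bar>w y\<bar>"] by (simp add: abs_mult)
        qed (use nz R in auto)
      qed
      show "AE y in lborel. (\<lambda>n. ?q n y * w y) \<longlonglongrightarrow> partial_deriv i \<phi> (z - y) * w y"
      proof (intro AE_I2 tendsto_intros)
        fix y
        have "((\<lambda>h. (\<phi> (z - y + (0 + h) *\<^sub>R ?e) - \<phi> (z - y + 0 *\<^sub>R ?e)) / h) \<longlongrightarrow> partial_deriv i \<phi> (z - y)) (at 0)"
          using line_has_derivative[OF s, of "z - y" i 0] by (simp add: DERIV_def)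
        from this[unfolded tendsto_at_iff_sequentially, rule_format, of X]
        show "(\<lambda>n. ?q n y) \<longlonglongrightarrow> partial_deriv i \<phi> (z - y)"
          using X0 X by (simp add: o_def)
      qed
    qed measurable
    then show "((\<lambda>h. (convolve \<phi> w (z + h *\<^sub>R ?e) - convolve \<phi> w z) / h) \<circ> X)
        \<longlonglongrightarrow> convolve (partial_deriv i \<phi>) w z"
      by (simp add: o_def eq) (simp add: convolve_def)
  qed
  then show ?thesis by (simp add: DERIV_def z_def algebra_simps)
qed

text \<open>Applied to the constant weight \<open>1\<close>, differentiation of convolutions already contains
  the divergence theorem for test functions.\<close>

lemma integral_partial_deriv_0:
  assumes \<phi>: "\<phi> \<in> test_functions UNIV"
  shows "(LBINT x. partial_deriv i \<phi> x) = 0"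
proof -
  \<comment> \<open>The convolution with the constant 1 is the constant function \<open>\<integral>\<phi>\<close>.\<close>
  have 1: "locally_integrable (\<lambda>_::real^3. 1::real)" by (rule continuous_locally_integrable) simp
  have "convolve \<psi> (\<lambda>_. 1) x = (LBINT y. \<psi> y)" for \<psi> x
    using integral_reflect3[of \<psi> x] by (simp add: convolve_def)
  then have "((\<lambda>s. (LBINT y. \<phi> y)) has_real_derivative (LBINT y. partial_deriv i \<phi> y)) (at 0)"
    using convolve_has_derivative[OF 1 \<phi>, of 0 i 0] by simp
  then show ?thesis using DERIV_unique DERIV_const by blast
qed

lemma integration_by_parts:
  assumes "smooth \<phi>" "\<psi> \<in> test_functions UNIV"
  shows "(LBINT x. \<phi> x * partial_deriv i \<psi> x) = - (LBINT x. partial_deriv i \<phi> x * \<psi> x)"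
proof -
  have s: "smooth \<psi>" using assms(2) test_functions_UNIV_iff by blast
  have "integrable lborel (\<lambda>x. \<phi> x * partial_deriv i \<psi> x)" "integrable lborel (\<lambda>x. partial_deriv i \<phi> x * \<psi> x)"
    using integrable_test_times[of \<phi> "partial_deriv i \<psi>"] integrable_test_times[of "partial_deriv i \<phi>" \<psi>]
      test_functions_partial_deriv[OF assms(2)] assms(2)
      continuous_locally_integrable[OF smooth_continuous[OF assms(1)]]
      continuous_locally_integrable[OF smooth_continuous[OF smooth_partial_deriv[OF assms(1)]]]
    by (auto simp: mult.commute)
  moreover have "(LBINT x. partial_deriv i (\<lambda>x. \<phi> x * \<psi> x) x) = 0"
    by (rule integral_partial_deriv_0[OF test_functions_mult[OF assms]])
  ultimately show ?thesis
    by (simp add: partial_deriv_mult[OF smooth_differentiable[OF assms(1)] smooth_differentiable[OF s]])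
qed

section \<open>Mollification\<close>

lemma test_bump: "bump \<in> test_functions UNIV"
  unfolding test_functions_UNIV_iff using smooth_bump bump_nonzero_norm by (meson not_less_iff_gr_or_eq)

lemma integrable_test: "\<phi> \<in> test_functions UNIV \<Longrightarrow> integrable lborel \<phi>"
  using integrable_test_times[of "\<lambda>_. 1::real" \<phi>] continuous_locally_integrable[of "\<lambda>_. 1::real"] by simp

lemma integral_bump_pos: "0 < (LBINT x. bump x)"
proof -
  have "\<not> (AE x in lborel. bump x = 0)"
  proof
    assume "AE x in lborel. bump x = 0"
    then have "{x. bump x \<noteq> 0} \<in> null_sets lborel"
      using test_function_borel[OF test_bump] by (subst (asm) AE_iff_null) auto
    then have "negligible {x. bump x \<noteq> 0}"
      by (simp add: negligible_iff_null_sets null_sets_completionI)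
    moreover have "open {x. bump x \<noteq> 0}"
      using smooth_continuous[OF smooth_bump] by (intro open_Collect_neq) (auto simp: continuous_on_const)
    moreover have "0 \<in> {x. bump x \<noteq> 0}" by (simp add: bump_nonzero_iff)
    ultimately show False using open_not_negligible by blast
  qed
  then show ?thesis
    using integral_nonneg_eq_0_iff_AE[OF integrable_test[OF test_bump]] bump_nonneg
      Bochner_Integration.integral_nonneg[of lborel bump] by (simp add: order_less_le)
qed

text \<open>The successor avoids a degenerate dilation at index \<open>0\<close>.\<close>

definition mollifier :: "nat \<Rightarrow> real^3 \<Rightarrow> real" where
  "mollifier n z = real (Suc n) ^ 3 / (LBINT x. bump x) * bump (real (Suc n) *\<^sub>R z)"

lemma test_mollifier: "mollifier n \<in> test_functions UNIV"
  using test_functions_mult[OF smooth_const test_functions_affine[OF test_bump, of "real (Suc n)" 0],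
      of "real (Suc n) ^ 3 / (LBINT x. bump x)"]
  unfolding mollifier_def[abs_def] by simp

lemma borel_mollifier [measurable]: "mollifier n \<in> borel_measurable borel"
  by (rule test_function_borel[OF test_mollifier])

lemma mollifier_nonneg: "0 \<le> mollifier n z"
  unfolding mollifier_def using integral_bump_pos bump_nonneg by (simp add: less_imp_le)

lemma integral_mollifier: "(LBINT z. mollifier n z) = 1"
  unfolding mollifier_def using integral_affine3[of "real (Suc n)" bump 0] integral_bump_pos
  by (simp add: field_simps)

lemma nn_integral_mollifier: "(\<integral>\<^sup>+z. ennreal (mollifier n z) \<partial>lborel) = 1"
  using nn_integral_eq_integral[OF integrable_test[OF test_mollifier]] mollifier_nonneg integral_mollifier by simp

lemma mollifier_nonzero: "mollifier n z \<noteq> 0 \<Longrightarrow> norm z < 2 / real (Suc n)"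
  unfolding mollifier_def using bump_nonzero_norm[of "real (Suc n) *\<^sub>R z"]
  by (auto simp: field_simps simp del: of_nat_Suc)

lemma nn_integral_reflect3:
  assumes [measurable]: "F \<in> borel_measurable borel"
  shows "(\<integral>\<^sup>+y. F (x - y) \<partial>lborel) = (\<integral>\<^sup>+y. F (y::real^3) \<partial>lborel)"
  using nn_integral_affine3[of F "-1" x] by simp

text \<open>Tonelli together with translation invariance; it reduces the contraction properties of mollification to
  pointwise inequalities under the integral.\<close>

lemma nn_integral_mollify:
  assumes [measurable]: "F \<in> borel_measurable borel"
  shows "(\<integral>\<^sup>+x. \<integral>\<^sup>+y. ennreal (mollifier n (x - y)) * F y \<partial>lborel \<partial>lborel) = (\<integral>\<^sup>+y. F y \<partial>lborel)"
proof -
  have "(\<integral>\<^sup>+x. \<integral>\<^sup>+y. ennreal (mollifier n (x - y)) * F y \<partial>lborel \<partial>lborel)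
      = (\<integral>\<^sup>+y. \<integral>\<^sup>+x. ennreal (mollifier n (x - y)) * F y \<partial>lborel \<partial>lborel)"
    by (rule lborel_pair.Fubini') simp
  also have "\<dots> = (\<integral>\<^sup>+y. (\<integral>\<^sup>+x. ennreal (mollifier n (x - y)) \<partial>lborel) * F y \<partial>lborel)"
    by (intro nn_integral_cong nn_integral_multc) simp
  also have "\<dots> = (\<integral>\<^sup>+y. F y \<partial>lborel)"
    using nn_integral_affine3[of "\<lambda>x. ennreal (mollifier n x)" 1 "- y" for y] nn_integral_mollifier[of n]
    by (intro nn_integral_cong) simp
  finally show ?thesis .
qed

lemma convolve_mollifier_abs:
  assumes [measurable]: "w \<in> borel_measurable borel"
  shows "ennreal \<bar>convolve (mollifier n) w x\<bar> \<le> (\<integral>\<^sup>+y. ennreal (mollifier n (x - y)) * ennreal \<bar>w y\<bar> \<partial>lborel)"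
proof -
  have "ennreal \<bar>convolve (mollifier n) w x\<bar> \<le> (\<integral>\<^sup>+y. norm (mollifier n (x - y) * w y) \<partial>lborel)"
    using integral_norm_bound_ennreal[of lborel "\<lambda>y. mollifier n (x - y) * w y"]
    by (cases "integrable lborel (\<lambda>y. mollifier n (x - y) * w y)")
       (auto simp: convolve_def not_integrable_integral_eq)
  then show ?thesis by (simp add: abs_mult mollifier_nonneg ennreal_mult)
qed

lemma nn_integral_convolve_abs:
  assumes [measurable]: "w \<in> borel_measurable borel"
  shows "(\<integral>\<^sup>+x. ennreal \<bar>convolve (mollifier n) w x\<bar> \<partial>lborel) \<le> (\<integral>\<^sup>+y. ennreal \<bar>w y\<bar> \<partial>lborel)"
proof -
  have "(\<integral>\<^sup>+x. ennreal \<bar>convolve (mollifier n) w x\<bar> \<partial>lborel)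
      \<le> (\<integral>\<^sup>+x. \<integral>\<^sup>+y. ennreal (mollifier n (x - y)) * ennreal \<bar>w y\<bar> \<partial>lborel \<partial>lborel)"
    by (intro nn_integral_mono convolve_mollifier_abs assms)
  also have "\<dots> = (\<integral>\<^sup>+y. ennreal \<bar>w y\<bar> \<partial>lborel)" by (rule nn_integral_mollify) simp
  finally show ?thesis .
qed

text \<open>Jensen's inequality for the probability density \<open>y \<mapsto> mollifier n (x - y)\<close>, in the form of the
  Cauchy--Schwarz inequality with the density split into two square roots.\<close>

lemma convolve_mollifier_square:
  assumes [measurable]: "w \<in> borel_measurable borel"
  shows "ennreal ((convolve (mollifier n) w x)\<^sup>2)
    \<le> (\<integral>\<^sup>+y. ennreal (mollifier n (x - y)) * ennreal ((w y)\<^sup>2) \<partial>lborel)"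
proof -
  let ?r = "\<lambda>y. ennreal (sqrt (mollifier n (x - y)))"
  have r: "?r y * ?r y = ennreal (mollifier n (x - y))" for y
    by (simp add: mollifier_nonneg flip: ennreal_mult)
  have "ennreal ((convolve (mollifier n) w x)\<^sup>2) = (ennreal \<bar>convolve (mollifier n) w x\<bar>)\<^sup>2"
    by (simp add: ennreal_power)
  also have "\<dots> \<le> (\<integral>\<^sup>+y. ennreal (mollifier n (x - y)) * ennreal \<bar>w y\<bar> \<partial>lborel)\<^sup>2"
    by (intro power_mono convolve_mollifier_abs) auto
  also have "\<dots> = (\<integral>\<^sup>+y. ?r y * (?r y * ennreal \<bar>w y\<bar>) \<partial>lborel)\<^sup>2"
    by (simp add: r flip: mult.assoc)
  also have "\<dots> \<le> (\<integral>\<^sup>+y. (?r y)\<^sup>2 \<partial>lborel) * (\<integral>\<^sup>+y. (?r y * ennreal \<bar>w y\<bar>)\<^sup>2 \<partial>lborel)"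
    by (rule Cauchy_Schwarz_nn_integral) auto
  also have "(\<integral>\<^sup>+y. (?r y)\<^sup>2 \<partial>lborel) = 1"
    using nn_integral_reflect3[of "\<lambda>y. ennreal (mollifier n y)" x] nn_integral_mollifier[of n]
    by (simp add: power2_eq_square r)
  also have "(\<integral>\<^sup>+y. (?r y * ennreal \<bar>w y\<bar>)\<^sup>2 \<partial>lborel) = (\<integral>\<^sup>+y. ennreal (mollifier n (x - y)) * ennreal ((w y)\<^sup>2) \<partial>lborel)"
    by (simp add: power_mult_distrib power2_eq_square[of "?r _"] r ennreal_power)
  finally show ?thesis by simp
qed

lemma nn_integral_convolve_square:
  assumes [measurable]: "w \<in> borel_measurable borel"
  shows "(\<integral>\<^sup>+x. ennreal ((convolve (mollifier n) w x)\<^sup>2) \<partial>lborel) \<le> (\<integral>\<^sup>+y. ennreal ((w y)\<^sup>2) \<partial>lborel)"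
proof -
  have "(\<integral>\<^sup>+x. ennreal ((convolve (mollifier n) w x)\<^sup>2) \<partial>lborel)
      \<le> (\<integral>\<^sup>+x. \<integral>\<^sup>+y. ennreal (mollifier n (x - y)) * ennreal ((w y)\<^sup>2) \<partial>lborel \<partial>lborel)"
    by (intro nn_integral_mono convolve_mollifier_square assms)
  also have "\<dots> = (\<integral>\<^sup>+y. ennreal ((w y)\<^sup>2) \<partial>lborel)" by (rule nn_integral_mollify) simp
  finally show ?thesis .
qed

text \<open>A measurable function is an almost everywhere limit of continuous ones. Clamping the values and
  cutting off at infinity, both by continuous operations, turns this into convergence in mean.\<close>

lemma L1_approximation_continuous:
  fixes w :: "real^3 \<Rightarrow> real"
  assumes w: "integrable lborel w" and e: "0 < e"
  shows "\<exists>v. continuous_on UNIV v \<and> integrable lborel v \<and> (LBINT x. \<bar>w x - v x\<bar>) < e"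
proof -
  have [measurable]: "w \<in> borel_measurable borel" using w by auto
  have "w measurable_on UNIV" by (intro lebesgue_measurable_imp_measurable_on measurable_completion) auto
  then obtain N g where N: "negligible N" and g: "\<forall>n. continuous_on UNIV (g n)"
    "\<forall>x. x \<notin> N \<longrightarrow> (\<lambda>n. g n x) \<longlonglongrightarrow> (if x \<in> UNIV then w x else 0)"
    unfolding measurable_on_def by blast
  have "AE x in lebesgue. (\<lambda>n. g n x) \<longlonglongrightarrow> w x"
    by (rule AE_I'[of N]) (use N g(2) in \<open>auto simp: negligible_iff_null_sets\<close>)
  then have gw: "AE x in lborel. (\<lambda>n. g n x) \<longlonglongrightarrow> w x" by (simp add: AE_completion_iff)
  \<comment> \<open>Values are clamped to \<open>[-k, k]\<close> and cut off continuously outside the ball of radius \<open>k\<close>.\<close>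
  define T where "T k x t = max 0 (min 1 (real k + 1 - norm x)) * max (- real k) (min (real k) t)"
    for k and x :: "real^3" and t
  have T1: "\<bar>T k x t\<bar> \<le> \<bar>t\<bar>" for k x t
  proof -
    have "\<bar>T k x t\<bar> \<le> 1 * \<bar>max (- real k) (min (real k) t)\<bar>"
      unfolding T_def abs_mult by (intro mult_right_mono) auto
    then show ?thesis by auto
  qed
  have T2: "\<bar>T k x t\<bar> \<le> real k * indicator (cball 0 (real k + 1)) x" for k x t
  proof (cases "norm x \<le> real k + 1")
    case True
    have "\<bar>T k x t\<bar> \<le> 1 * real k" unfolding T_def abs_mult by (intro mult_mono) auto
    then show ?thesis using True by simp
  qed (simp add: T_def)
  have [measurable]: "g n \<in> borel_measurable borel" for n by (rule borel_measurable_continuous_onI[OF g(1)[rule_format]])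
  have cT: "continuous_on UNIV (\<lambda>x. T k x (g n x))" for k n
    unfolding T_def by (intro continuous_intros g(1)[rule_format])
  have ball: "integrable lborel (\<lambda>x::real^3. real k * indicator (cball 0 (real k + 1)) x)" for k
    by (intro integrable_mult_right integrable_real_indicator emeasure_bounded_finite) auto
  have "(\<lambda>k. LBINT x. \<bar>w x - T k x (w x)\<bar>) \<longlonglongrightarrow> (\<integral>x. 0 \<partial>(lborel :: (real^3) measure))"
  proof (rule integral_dominated_convergence[where w = "\<lambda>x. 2 * \<bar>w x\<bar>"])
    show "AE x in lborel. (\<lambda>k. \<bar>w x - T k x (w x)\<bar>) \<longlonglongrightarrow> 0"
    proof (rule AE_I2)
      fix x
      obtain m :: nat where m: "norm x + \<bar>w x\<bar> < real m" using reals_Archimedean2 by blast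
      have "\<bar>w x - T k x (w x)\<bar> = 0" if "k \<ge> m" for k
      proof -
        have "norm x + \<bar>w x\<bar> < real k" using m that by linarith
        then have "norm x \<le> real k" "\<bar>w x\<bar> \<le> real k" using norm_ge_zero[of x] by linarith+
        then show ?thesis unfolding T_def by simp
      qed
      then show "(\<lambda>k. \<bar>w x - T k x (w x)\<bar>) \<longlonglongrightarrow> 0"
        by (intro tendsto_eventually) (auto simp: eventually_sequentially)
    qed
    show "AE x in lborel. norm \<bar>w x - T k x (w x)\<bar> \<le> 2 * \<bar>w x\<bar>" for k
    proof (rule AE_I2)
      fix x show "norm \<bar>w x - T k x (w x)\<bar> \<le> 2 * \<bar>w x\<bar>" using T1[of k x "w x"] by simp
    qed
    show "(\<lambda>x. \<bar>w x - T k x (w x)\<bar>) \<in> borel_measurable lborel" for k unfolding T_def by measurable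
  qed (use w in auto)
  then have "(\<lambda>k. LBINT x. \<bar>w x - T k x (w x)\<bar>) \<longlonglongrightarrow> 0" by simp
  from order_tendstoD(2)[OF this, of "e / 2"]
  obtain k where k: "(LBINT x. \<bar>w x - T k x (w x)\<bar>) < e / 2" using e by (auto simp: eventually_sequentially)
  have "(\<lambda>n. LBINT x. \<bar>T k x (w x) - T k x (g n x)\<bar>) \<longlonglongrightarrow> (\<integral>x. 0 \<partial>(lborel :: (real^3) measure))"
  proof (rule integral_dominated_convergence[where w = "\<lambda>x. 2 * (real k * indicator (cball 0 (real k + 1)) x)"])
    show "AE x in lborel. (\<lambda>n. \<bar>T k x (w x) - T k x (g n x)\<bar>) \<longlonglongrightarrow> 0"
      using gw
    proof eventually_elim
      case (elim x)
      have "(\<lambda>n. \<bar>T k x (w x) - T k x (g n x)\<bar>) \<longlonglongrightarrow> \<bar>T k x (w x) - T k x (w x)\<bar>"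
        unfolding T_def by (intro tendsto_intros elim)
      then show ?case by simp
    qed
    show "AE x in lborel. norm \<bar>T k x (w x) - T k x (g n x)\<bar> \<le> 2 * (real k * indicator (cball 0 (real k + 1)) x)" for n
    proof (rule AE_I2)
      fix x show "norm \<bar>T k x (w x) - T k x (g n x)\<bar> \<le> 2 * (real k * indicator (cball 0 (real k + 1)) x)"
        using T2[of k x "w x"] T2[of k x "g n x"] by simp
    qed
    show "integrable lborel (\<lambda>x::real^3. 2 * (real k * indicator (cball 0 (real k + 1)) x))"
      using ball by (rule integrable_mult_right)
    show "(\<lambda>x. \<bar>T k x (w x) - T k x (g n x)\<bar>) \<in> borel_measurable lborel" for n unfolding T_def by measurable
  qed simp
  then have "(\<lambda>n. LBINT x. \<bar>T k x (w x) - T k x (g n x)\<bar>) \<longlonglongrightarrow> 0" by simp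
  from order_tendstoD(2)[OF this, of "e / 2"]
  obtain n where n: "(LBINT x. \<bar>T k x (w x) - T k x (g n x)\<bar>) < e / 2" using e by (auto simp: eventually_sequentially)
  have i: "integrable lborel (\<lambda>x. T k x (w x))"
    by (rule Bochner_Integration.integrable_bound[OF w]) (use T1 in \<open>auto simp: T_def\<close>)
  have iv: "integrable lborel (\<lambda>x. T k x (g n x))"
    by (rule Bochner_Integration.integrable_bound[OF ball[of k]])
      (use T2 borel_measurable_continuous_onI[OF cT] in auto)
  have "(LBINT x. \<bar>w x - T k x (g n x)\<bar>) \<le> (LBINT x. \<bar>w x - T k x (w x)\<bar> + \<bar>T k x (w x) - T k x (g n x)\<bar>)"
    using w i iv by (intro integral_mono) auto
  also have "\<dots> = (LBINT x. \<bar>w x - T k x (w x)\<bar>) + (LBINT x. \<bar>T k x (w x) - T k x (g n x)\<bar>)"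
    using w i iv by (intro Bochner_Integration.integral_add) auto
  finally show ?thesis using cT iv k n by (intro exI[of _ "\<lambda>x. T k x (g n x)"]) auto
qed

lemma integrable_locally_integrable:
  fixes w :: "real^3 \<Rightarrow> 'b::euclidean_space"
  assumes "integrable lborel w" shows "locally_integrable w"
  using assms borel_compact unfolding locally_integrable_def set_integrable_def
  by (auto intro!: integrable_mult_indicator)

lemma convolve_mollifier_near:
  assumes v: "locally_integrable v" and near: "\<And>y. norm (x - y) < 2 / real (Suc n) \<Longrightarrow> \<bar>v y - c\<bar> \<le> \<eta>"
  shows "\<bar>convolve (mollifier n) v x - c\<bar> \<le> \<eta>"
proof -
  have im: "integrable lborel (\<lambda>y. mollifier n (x - y))"
    using integrable_test[OF test_functions_reflect[OF test_mollifier]] .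
  have iv: "integrable lborel (\<lambda>y. mollifier n (x - y) * v y)"
    by (rule integrable_convolve[OF v test_mollifier])
  have m1: "(LBINT y. mollifier n (x - y)) = 1"
    using integral_reflect3[of "mollifier n" x] integral_mollifier by simp
  have "\<bar>convolve (mollifier n) v x - c\<bar> = \<bar>(LBINT y. mollifier n (x - y) * v y - mollifier n (x - y) * c)\<bar>"
    using im iv m1 by (simp add: convolve_def)
  also have "\<dots> \<le> (LBINT y. \<bar>mollifier n (x - y) * v y - mollifier n (x - y) * c\<bar>)"
    by (rule integral_abs_bound)
  also have "\<dots> \<le> (LBINT y. mollifier n (x - y) * \<eta>)"
  proof (rule integral_mono)
    show "\<bar>mollifier n (x - y) * v y - mollifier n (x - y) * c\<bar> \<le> mollifier n (x - y) * \<eta>" for y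
    proof (cases "mollifier n (x - y) = 0")
      case False
      then have "\<bar>v y - c\<bar> \<le> \<eta>" using near mollifier_nonzero by blast
      then have "mollifier n (x - y) * \<bar>v y - c\<bar> \<le> mollifier n (x - y) * \<eta>"
        by (intro mult_left_mono mollifier_nonneg)
      then show ?thesis by (simp add: abs_mult mollifier_nonneg flip: right_diff_distrib)
    qed simp
  qed (use im iv in auto)
  also have "\<dots> = \<eta>" using m1 by simp
  finally show ?thesis .
qed

text \<open>For a continuous function the convergence is uniform on balls. The error of a continuous approximation
  in mean is not increased by mollification, which gives the general case.\<close>

lemma convolve_mollifier_L1:
  assumes w: "integrable lborel w"
  shows "(\<lambda>n. (LBINT x. \<bar>indicator (ball 0 R) x * (convolve (mollifier n) w x - w x)\<bar>)) \<longlonglongrightarrow> 0"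
proof (rule LIMSEQ_I)
  fix e :: real assume e: "e > 0"
  obtain v where v: "continuous_on UNIV v" "integrable lborel v" "(LBINT x. \<bar>w x - v x\<bar>) < e / 3"
    using L1_approximation_continuous[OF w, of "e / 3"] e by auto
  let ?B = "ball 0 R :: (real^3) set"
  have cint: "integrable lborel (convolve (mollifier n) u)"
    and cbound: "(LBINT x. \<bar>convolve (mollifier n) u x\<bar>) \<le> (LBINT x. \<bar>u x\<bar>)"
    if u: "integrable lborel u" for n u
  proof -
    have [measurable]: "convolve (mollifier n) u \<in> borel_measurable borel"
      by (rule borel_measurable_continuous_onI[OF continuous_convolve[OF integrable_locally_integrable[OF u] test_mollifier]])
    have [measurable]: "u \<in> borel_measurable borel" using u by auto
    have *: "(\<integral>\<^sup>+x. ennreal \<bar>convolve (mollifier n) u x\<bar> \<partial>lborel) \<le> ennreal (LBINT x. \<bar>u x\<bar>)"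
      using nn_integral_convolve_abs[of u n] nn_integral_eq_integral[of lborel "\<lambda>x. \<bar>u x\<bar>"] u by simp
    then show i: "integrable lborel (convolve (mollifier n) u)"
      by (auto simp: integrable_iff_bounded le_less_trans)
    show "(LBINT x. \<bar>convolve (mollifier n) u x\<bar>) \<le> (LBINT x. \<bar>u x\<bar>)"
      using * nn_integral_eq_integral[of lborel "\<lambda>x. \<bar>convolve (mollifier n) u x\<bar>"] i by (simp add: ennreal_le_iff)
  qed
  \<comment> \<open>The summand \<open>1\<close> covers a ball of measure zero.\<close>
  define \<eta> where "\<eta> = e / (3 * (measure lborel ?B + 1))"
  have \<eta>: "\<eta> > 0" using e by (simp add: \<eta>_def add_nonneg_pos)
  have "uniformly_continuous_on (cball 0 (R + 2)) v"
    by (intro compact_uniformly_continuous continuous_on_subset[OF v(1)]) auto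
  then obtain d where d: "d > 0" "\<And>x y. x \<in> cball 0 (R + 2) \<Longrightarrow> y \<in> cball 0 (R + 2) \<Longrightarrow> dist y x < d \<Longrightarrow> dist (v y) (v x) < \<eta>"
    unfolding uniformly_continuous_on_def using \<eta> by metis
  obtain N where N: "2 / d < real N" using reals_Archimedean2 by blast
  have near: "\<bar>convolve (mollifier n) v x - v x\<bar> \<le> \<eta>" if "n \<ge> N" "x \<in> ?B" for n x
  proof (rule convolve_mollifier_near[OF integrable_locally_integrable[OF v(2)]])
    fix y assume y: "norm (x - y) < 2 / real (Suc n)"
    have "2 / d < real (Suc n)" using N that(1) by linarith
    then have "2 / real (Suc n) < d" using d(1) by (simp add: field_simps)
    then have 1: "dist y x < d" using y by (simp add: dist_norm norm_minus_commute)
    have "2 / real (Suc n) \<le> 2" by (simp add: field_simps)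
    then have "norm y \<le> R + 2"
      using y that(2) norm_triangle_ineq4[of x "x - y"] by simp
    then have "dist (v y) (v x) < \<eta>" using that(2) 1 by (intro d) auto
    then show "\<bar>v y - v x\<bar> \<le> \<eta>" by (simp add: dist_real_def)
  qed
  have "norm ((LBINT x. \<bar>indicator ?B x * (convolve (mollifier n) w x - w x)\<bar>) - 0) < e" if n: "n \<ge> N" for n
  proof -
    have wv: "integrable lborel (\<lambda>x. w x - v x)" using w v by auto
    have lin: "convolve (mollifier n) (\<lambda>x. w x - v x) x = convolve (mollifier n) w x - convolve (mollifier n) v x" for x
      using integrable_convolve[OF integrable_locally_integrable test_mollifier] w v(2)
      by (simp add: convolve_def right_diff_distrib)
    have Bint: "integrable lborel (\<lambda>x. \<eta> * indicator ?B x)" using emeasure_bounded_finite[of ?B] by simp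
    have "(LBINT x. \<bar>indicator ?B x * (convolve (mollifier n) w x - w x)\<bar>)
      \<le> (LBINT x. \<bar>convolve (mollifier n) (\<lambda>x. w x - v x) x\<bar> + \<bar>w x - v x\<bar> + \<eta> * indicator ?B x)"
    proof (rule integral_mono)
      show "integrable lborel (\<lambda>x. \<bar>indicator ?B x * (convolve (mollifier n) w x - w x)\<bar>)"
        using integrable_mult_indicator[of ?B lborel "\<lambda>x. convolve (mollifier n) w x - w x"] cint[OF w, of n] w by auto
      show "integrable lborel (\<lambda>x. \<bar>convolve (mollifier n) (\<lambda>x. w x - v x) x\<bar> + \<bar>w x - v x\<bar> + \<eta> * indicator ?B x)"
        using cint[OF wv, of n] wv Bint by (intro Bochner_Integration.integrable_add integrable_abs)
      fix x
      show "\<bar>indicator ?B x * (convolve (mollifier n) w x - w x)\<bar>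
         \<le> \<bar>convolve (mollifier n) (\<lambda>x. w x - v x) x\<bar> + \<bar>w x - v x\<bar> + \<eta> * indicator ?B x"
        using near[OF n, of x] unfolding lin by (auto simp: indicator_def simp del: mem_ball)
    qed
    also have "\<dots> = (LBINT x. \<bar>convolve (mollifier n) (\<lambda>x. w x - v x) x\<bar>) + (LBINT x. \<bar>w x - v x\<bar>) + \<eta> * measure lborel ?B"
      using cint[OF wv, of n] wv Bint by simp
    also have "\<dots> < e / 3 + e / 3 + e / 3"
    proof -
      have "\<eta> * measure lborel ?B \<le> \<eta> * (measure lborel ?B + 1)" using \<eta> by simp
      also have "\<dots> = e / 3"
      proof -
        have "measure lborel ?B + 1 > 0" using measure_nonneg[of lborel ?B] by linarith
        moreover have "e / (3 * t) * t = e / 3" if "t > 0" for t using that by simp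
        ultimately show ?thesis unfolding \<eta>_def by blast
      qed
      finally show ?thesis using cbound[OF wv, of n] v(3) by linarith
    qed
    finally show ?thesis by simp
  qed
  then show "\<exists>N. \<forall>n\<ge>N. norm ((LBINT x. \<bar>indicator ?B x * (convolve (mollifier n) w x - w x)\<bar>) - 0) < e"
    by blast
qed

text \<open>Convergence in mean on a ball only yields a subsequence, and the subsequence may depend on the ball.
  For points of the ball the convolution sees only the values of \<open>w\<close> on a ball with radius larger by \<open>2\<close>.\<close>

lemma convolve_mollifier_AE:
  assumes w: "locally_integrable w"
  obtains r where "strict_mono r"
    "AE x in lborel. norm x < R \<longrightarrow> (\<lambda>n. convolve (mollifier (r n)) w x) \<longlonglongrightarrow> w x"
proof -
  define u where "u x = indicator (cball 0 (R + 2)) x * w x" for x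
  have u: "integrable lborel u"
    using w unfolding locally_integrable_def set_integrable_def u_def by auto
  have same: "convolve (mollifier n) u x = convolve (mollifier n) w x" "u x = w x" if "norm x < R" for n x
  proof -
    have "norm y \<le> R + 2" if "mollifier n (x - y) \<noteq> 0" for y
    proof -
      have "norm (x - y) < 2 / real (Suc n)" using mollifier_nonzero[OF that] .
      also have "\<dots> \<le> 2" by (simp add: field_simps)
      finally show ?thesis using \<open>norm x < R\<close> norm_triangle_ineq4[of x "x - y"] by simp
    qed
    then have "mollifier n (x - y) = 0 \<or> u y = w y" for y
      unfolding u_def by (cases "norm y \<le> R + 2") auto
    then have "(\<lambda>y. mollifier n (x - y) * u y) = (\<lambda>y. mollifier n (x - y) * w y)"
      by (intro ext) (metis mult_zero_left)
    then show "convolve (mollifier n) u x = convolve (mollifier n) w x" by (simp only: convolve_def)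
    show "u x = w x" using that by (simp add: u_def)
  qed
  let ?h = "\<lambda>n x. indicator (ball 0 R) x * (convolve (mollifier n) u x - u x)"
  have [measurable]: "convolve (mollifier n) u \<in> borel_measurable borel" for n
    by (rule borel_measurable_continuous_onI[OF continuous_convolve[OF integrable_locally_integrable[OF u] test_mollifier]])
  have [measurable]: "u \<in> borel_measurable borel" using u by auto
  have hint: "integrable lborel (?h n)" for n
  proof -
    have "(\<integral>\<^sup>+x. ennreal \<bar>convolve (mollifier n) u x\<bar> \<partial>lborel) < \<infinity>"
      using nn_integral_convolve_abs[of u n] u by (auto simp: integrable_iff_bounded le_less_trans)
    then have "integrable lborel (convolve (mollifier n) u)" by (auto simp: integrable_iff_bounded)
    then show ?thesis
      using integrable_mult_indicator[of "ball 0 R" lborel "\<lambda>x. convolve (mollifier n) u x - u x"] u by auto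
  qed
  obtain r where r: "strict_mono r" "AE x in lborel. (\<lambda>n. ?h (r n) x) \<longlonglongrightarrow> 0"
    using tendsto_L1_AE_subseq[of lborel ?h] hint convolve_mollifier_L1[OF u, of R] by auto
  have "AE x in lborel. norm x < R \<longrightarrow> (\<lambda>n. convolve (mollifier (r n)) w x) \<longlonglongrightarrow> w x"
    using r(2)
  proof eventually_elim
    case (elim x)
    show ?case
    proof
      assume x: "norm x < R"
      have "(\<lambda>n. convolve (mollifier (r n)) w x - w x) \<longlonglongrightarrow> 0"
        using elim x same[OF x] by simp
      then show "(\<lambda>n. convolve (mollifier (r n)) w x) \<longlonglongrightarrow> w x" by (simp add: LIM_zero_iff)
    qed
  qed
  with r(1) show ?thesis by (rule that)
qed

text \<open>Near a point of \<open>\<Omega>\<close> the reflected mollifier is a test function in \<open>\<Omega>\<close> once its support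
  is small, so the mollifications of \<open>w\<close> vanish there eventually.\<close>

lemma AE_eq_0_if_orthogonal_to_test_functions:
  fixes w :: "real^3 \<Rightarrow> real"
  assumes w: "locally_integrable w" and "open \<Omega>"
    and orth: "\<And>\<phi>. \<phi> \<in> test_functions \<Omega> \<Longrightarrow> (LBINT x. \<phi> x * w x) = 0"
  shows "AE x in lborel. x \<in> \<Omega> \<longrightarrow> w x = 0"
proof -
  have "AE x in lborel. norm x < real R \<longrightarrow> x \<in> \<Omega> \<longrightarrow> w x = 0" for R :: nat
  proof -
    obtain r where r: "strict_mono r"
      "AE x in lborel. norm x < real R \<longrightarrow> (\<lambda>n. convolve (mollifier (r n)) w x) \<longlonglongrightarrow> w x"
      using convolve_mollifier_AE[OF w] by blast
    show ?thesis using r(2)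
    proof eventually_elim
      case (elim x)
      show ?case
      proof (intro impI)
        assume x: "norm x < real R" "x \<in> \<Omega>"
        obtain d where d: "d > 0" "cball x d \<subseteq> \<Omega>" using \<open>open \<Omega>\<close> x(2) open_contains_cball by blast
        obtain N where N: "2 / d < real N" using reals_Archimedean2 by blast
        have "convolve (mollifier (r n)) w x = 0" if "n \<ge> N" for n
        proof -
          have "real n \<le> real (r n)" using seq_suble[OF r(1), of n] by simp
          then have "2 / d < real (Suc (r n))" using N that by linarith
          then have "2 / real (Suc (r n)) < d" using d(1) by (simp add: field_simps)
          then have "{y. mollifier (r n) (x - y) \<noteq> 0} \<subseteq> cball x d"
            using mollifier_nonzero[of "r n"] by (force simp: dist_norm)
          then have "closure {y. mollifier (r n) (x - y) \<noteq> 0} \<subseteq> cball x d" by (simp add: closure_minimal)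
          then have "(\<lambda>y. mollifier (r n) (x - y)) \<in> test_functions \<Omega>"
            using test_functions_reflect[OF test_mollifier, of "r n" x] d(2)
            unfolding test_functions_def by auto
          from orth[OF this] show ?thesis by (simp add: convolve_def)
        qed
        then have "(\<lambda>n. convolve (mollifier (r n)) w x) \<longlonglongrightarrow> 0"
          by (intro tendsto_eventually) (auto simp: eventually_sequentially)
        then show "w x = 0" using elim x(1) LIMSEQ_unique by blast
      qed
    qed
  qed
  then have "AE x in lborel. \<forall>R::nat. norm x < real R \<longrightarrow> x \<in> \<Omega> \<longrightarrow> w x = 0"
    by (subst AE_all_countable) blast
  then show ?thesis
    by eventually_elim (use reals_Archimedean2 in blast)
qed

section \<open>The Sobolev inequality\<close>

text \<open>Coordinates are written as a linear combination of basis vectors, so that moving one of them is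
  visibly a translation along a line.\<close>

definition point3 :: "real \<Rightarrow> real \<Rightarrow> real \<Rightarrow> real^3" where
  "point3 a b c = a *\<^sub>R axis 1 1 + b *\<^sub>R axis 2 1 + c *\<^sub>R axis 3 1"

lemma point3_nth: "point3 a b c $ 1 = a" "point3 a b c $ 2 = b" "point3 a b c $ 3 = c"
  by (simp_all add: point3_def axis_def)

lemma borel_point3 [measurable]:
  assumes [measurable]: "f \<in> borel_measurable M" "g \<in> borel_measurable M" "h \<in> borel_measurable M"
  shows "(\<lambda>x. point3 (f x) (g x) (h x)) \<in> borel_measurable M"
  unfolding point3_def by measurable

lemma lborel_eq_distr_point3:
  "(lborel :: (real^3) measure)
     = distr (lborel \<Otimes>\<^sub>M (lborel \<Otimes>\<^sub>M lborel)) borel (\<lambda>p. point3 (fst p) (fst (snd p)) (snd (snd p)))"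
proof (rule lborel_eqI)
  let ?V = "\<lambda>p. point3 (fst p) (fst (snd p)) (snd (snd p))"
  let ?M = "lborel \<Otimes>\<^sub>M (lborel \<Otimes>\<^sub>M lborel) :: (real \<times> real \<times> real) measure"
  have [measurable]: "?V \<in> borel_measurable ?M" by measurable
  fix l u :: "real^3" assume le: "\<And>b. b \<in> Basis \<Longrightarrow> l \<bullet> b \<le> u \<bullet> b"
  have le': "l $ i \<le> u $ i" for i using le[of "axis i 1"] by (simp add: inner_axis)
  have B: "(Basis :: (real^3) set) = (\<lambda>i. axis i 1) ` UNIV" by (auto simp: Basis_vec_def)
  have "(\<Prod>b\<in>Basis. (u - l) \<bullet> b) = (\<Prod>i\<in>UNIV. (u - l) $ i)"
    unfolding B by (subst prod.reindex) (auto simp: inj_on_def axis_eq_axis inner_axis)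
  also have "\<dots> = (u $ 1 - l $ 1) * ((u $ 2 - l $ 2) * (u $ 3 - l $ 3))"
    unfolding UNIV_3 by simp
  finally have P: "(\<Prod>b\<in>Basis. (u - l) \<bullet> b) = (u $ 1 - l $ 1) * ((u $ 2 - l $ 2) * (u $ 3 - l $ 3))" .
  have "?V -` box l u \<inter> space ?M
      = {l $ 1<..<u $ 1} \<times> ({l $ 2<..<u $ 2} \<times> {l $ 3<..<u $ 3})"
    by (auto simp: mem_box_cart forall_3 point3_nth space_pair_measure)
  then have "emeasure (distr ?M borel ?V) (box l u)
      = emeasure ?M ({l $ 1<..<u $ 1} \<times> ({l $ 2<..<u $ 2} \<times> {l $ 3<..<u $ 3}))"
    by (simp add: emeasure_distr)
  also have "\<dots> = ennreal (u $ 1 - l $ 1) * (ennreal (u $ 2 - l $ 2) * ennreal (u $ 3 - l $ 3))"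
    using le' by (simp add: lborel.emeasure_pair_measure_Times lborel_pair.emeasure_pair_measure_Times
        sigma_finite_measure.emeasure_pair_measure_Times[OF lborel_pair.sigma_finite])
  finally show "emeasure (distr ?M borel ?V) (box l u) = (\<Prod>b\<in>Basis. (u - l) \<bullet> b)"
    unfolding P using le' by (simp add: ennreal_mult)
qed simp

lemma nn_integral_point3:
  assumes [measurable]: "F \<in> borel_measurable borel"
  shows "(\<integral>\<^sup>+x. F x \<partial>lborel) = (\<integral>\<^sup>+a. \<integral>\<^sup>+b. \<integral>\<^sup>+c. F (point3 a b c) \<partial>lborel \<partial>lborel \<partial>lborel)"
proof -
  have "(\<integral>\<^sup>+x. F x \<partial>lborel)
     = (\<integral>\<^sup>+p. F (point3 (fst p) (fst (snd p)) (snd (snd p))) \<partial>(lborel \<Otimes>\<^sub>M (lborel \<Otimes>\<^sub>M lborel)))"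
    by (subst lborel_eq_distr_point3, subst nn_integral_distr) auto
  also have "\<dots> = (\<integral>\<^sup>+a. \<integral>\<^sup>+q. F (point3 a (fst q) (snd q)) \<partial>(lborel \<Otimes>\<^sub>M lborel) \<partial>lborel)"
    using sigma_finite_measure.nn_integral_fst[OF lborel_pair.sigma_finite_measure_axioms, of "\<lambda>p. F (point3 (fst p) (fst (snd p)) (snd (snd p)))" lborel] by simp
  also have "\<dots> = (\<integral>\<^sup>+a. \<integral>\<^sup>+b. \<integral>\<^sup>+c. F (point3 a b c) \<partial>lborel \<partial>lborel \<partial>lborel)"
    using lborel.nn_integral_fst[of "\<lambda>q. F (point3 a (fst q) (snd q))" lborel for a] by simp
  finally show ?thesis .
qed

lemma ennreal_square_le_imp_le:
  fixes x y :: ennreal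
  assumes "x\<^sup>2 \<le> y\<^sup>2" shows "x \<le> y"
proof (cases x; cases y)
  fix r s assume "0 \<le> r" "x = ennreal r" "0 \<le> s" "y = ennreal s"
  moreover from this have "r\<^sup>2 \<le> s\<^sup>2" using assms by (simp add: ennreal_power)
  ultimately show ?thesis using power2_le_imp_le by auto
next
  fix s assume "x = top" "0 \<le> s" "y = ennreal s" then show ?thesis using assms by (simp add: ennreal_power top_power_ennreal top_unique)
qed auto

definition esqrt :: "ennreal \<Rightarrow> ennreal" where
  "esqrt x = (if x = top then top else ennreal (sqrt (enn2real x)))"

lemma esqrt_square: "(esqrt x)\<^sup>2 = x"
  by (cases x) (auto simp: esqrt_def ennreal_power)

lemma borel_esqrt [measurable]: "f \<in> borel_measurable M \<Longrightarrow> (\<lambda>x. esqrt (f x)) \<in> borel_measurable M"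
proof -
  assume [measurable]: "f \<in> borel_measurable M"
  have "f -` {top} \<inter> space M \<in> sets M" by (rule measurable_sets[of _ _ borel]) auto
  then have [measurable]: "{x \<in> space M. f x = top} \<in> sets M"
    by (simp add: vimage_def Int_def conj_commute)
  show ?thesis unfolding esqrt_def by measurable
qed

lemma Cauchy_Schwarz_esqrt:
  assumes "f \<in> borel_measurable M" "g \<in> borel_measurable M"
  shows "(\<integral>\<^sup>+x. f x * g x \<partial>M) \<le> esqrt (\<integral>\<^sup>+x. (f x)\<^sup>2 \<partial>M) * esqrt (\<integral>\<^sup>+x. (g x)\<^sup>2 \<partial>M)"
  by (rule ennreal_square_le_imp_le)
     (simp add: power_mult_distrib esqrt_square Cauchy_Schwarz_nn_integral[OF assms])

text \<open>Integrate one variable at a time. Each of the three steps is a Cauchy--Schwarz inequality between the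
  two factors that depend on the variable.\<close>

lemma Loomis_Whitney:
  fixes f g h :: "real \<Rightarrow> real \<Rightarrow> ennreal"
  assumes [measurable]: "case_prod f \<in> borel_measurable borel" "case_prod g \<in> borel_measurable borel"
    "case_prod h \<in> borel_measurable borel"
  shows "(\<integral>\<^sup>+a. \<integral>\<^sup>+b. \<integral>\<^sup>+c. f b c * g a c * h a b \<partial>lborel \<partial>lborel \<partial>lborel)\<^sup>2
    \<le> (\<integral>\<^sup>+b. \<integral>\<^sup>+c. (f b c)\<^sup>2 \<partial>lborel \<partial>lborel) * (\<integral>\<^sup>+a. \<integral>\<^sup>+c. (g a c)\<^sup>2 \<partial>lborel \<partial>lborel)
      * (\<integral>\<^sup>+a. \<integral>\<^sup>+b. (h a b)\<^sup>2 \<partial>lborel \<partial>lborel)"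
proof -
  have [measurable]: "case_prod f \<in> borel_measurable (lborel \<Otimes>\<^sub>M lborel)"
    "case_prod g \<in> borel_measurable (lborel \<Otimes>\<^sub>M lborel)" "case_prod h \<in> borel_measurable (lborel \<Otimes>\<^sub>M lborel)"
    using assms by (simp_all add: lborel_prod)
  have sec: "F x \<in> borel_measurable borel" if [measurable]: "case_prod F \<in> borel_measurable (lborel \<Otimes>\<^sub>M lborel)"
    for F :: "real \<Rightarrow> real \<Rightarrow> ennreal" and x
  proof -
    have "(\<lambda>c. case_prod F (x, c)) \<in> borel_measurable lborel" by measurable
    then show ?thesis by simp
  qed
  have [measurable]: "f x \<in> borel_measurable borel" "g x \<in> borel_measurable borel" "h x \<in> borel_measurable borel" for x
    by (simp_all add: sec)
  define A1 A2 A3 where "A1 b = (\<integral>\<^sup>+c. (f b c)\<^sup>2 \<partial>lborel)" and "A2 a = (\<integral>\<^sup>+c. (g a c)\<^sup>2 \<partial>lborel)"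
    and "A3 a = (\<integral>\<^sup>+b. (h a b)\<^sup>2 \<partial>lborel)" for a b
  have [measurable]: "A1 \<in> borel_measurable borel" "A2 \<in> borel_measurable borel" "A3 \<in> borel_measurable borel"
    unfolding A1_def[abs_def] A2_def[abs_def] A3_def[abs_def] by measurable
  have "(\<integral>\<^sup>+a. \<integral>\<^sup>+b. \<integral>\<^sup>+c. f b c * g a c * h a b \<partial>lborel \<partial>lborel \<partial>lborel)
     \<le> (\<integral>\<^sup>+a. \<integral>\<^sup>+b. esqrt (A2 a) * (esqrt (A1 b) * h a b) \<partial>lborel \<partial>lborel)"
  proof (intro nn_integral_mono)
    fix a b
    have "(\<integral>\<^sup>+c. f b c * g a c * h a b \<partial>lborel) = (\<integral>\<^sup>+c. f b c * g a c \<partial>lborel) * h a b"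
      by (rule nn_integral_multc) measurable
    also have "\<dots> \<le> (esqrt (A1 b) * esqrt (A2 a)) * h a b"
      unfolding A1_def A2_def by (intro mult_right_mono Cauchy_Schwarz_esqrt) simp_all
    finally show "(\<integral>\<^sup>+c. f b c * g a c * h a b \<partial>lborel) \<le> esqrt (A2 a) * (esqrt (A1 b) * h a b)"
      by (simp add: ac_simps)
  qed
  also have "\<dots> \<le> (\<integral>\<^sup>+a. esqrt (A2 a) * (esqrt (\<integral>\<^sup>+b. A1 b \<partial>lborel) * esqrt (A3 a)) \<partial>lborel)"
  proof (intro nn_integral_mono)
    fix a
    have "(\<integral>\<^sup>+b. esqrt (A2 a) * (esqrt (A1 b) * h a b) \<partial>lborel) = esqrt (A2 a) * (\<integral>\<^sup>+b. esqrt (A1 b) * h a b \<partial>lborel)"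
      by (rule nn_integral_cmult) measurable
    also have "(\<integral>\<^sup>+b. esqrt (A1 b) * h a b \<partial>lborel) \<le> esqrt (\<integral>\<^sup>+b. A1 b \<partial>lborel) * esqrt (A3 a)"
      using Cauchy_Schwarz_esqrt[of "\<lambda>b. esqrt (A1 b)" lborel "h a"] by (simp add: esqrt_square A3_def)
    finally show "(\<integral>\<^sup>+b. esqrt (A2 a) * (esqrt (A1 b) * h a b) \<partial>lborel)
        \<le> esqrt (A2 a) * (esqrt (\<integral>\<^sup>+b. A1 b \<partial>lborel) * esqrt (A3 a))" by (simp add: mult_left_mono)
  qed
  also have "\<dots> = (\<integral>\<^sup>+a. esqrt (\<integral>\<^sup>+b. A1 b \<partial>lborel) * (esqrt (A2 a) * esqrt (A3 a)) \<partial>lborel)"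
    by (simp add: ac_simps)
  also have "\<dots> = esqrt (\<integral>\<^sup>+b. A1 b \<partial>lborel) * (\<integral>\<^sup>+a. esqrt (A2 a) * esqrt (A3 a) \<partial>lborel)"
    by (rule nn_integral_cmult) measurable
  also have "\<dots> \<le> esqrt (\<integral>\<^sup>+b. A1 b \<partial>lborel) * (esqrt (\<integral>\<^sup>+a. A2 a \<partial>lborel) * esqrt (\<integral>\<^sup>+a. A3 a \<partial>lborel))"
    using Cauchy_Schwarz_esqrt[of "\<lambda>a. esqrt (A2 a)" lborel "\<lambda>a. esqrt (A3 a)"]
    by (intro mult_left_mono) (simp_all add: esqrt_square)
  finally have "(\<integral>\<^sup>+a. \<integral>\<^sup>+b. \<integral>\<^sup>+c. f b c * g a c * h a b \<partial>lborel \<partial>lborel \<partial>lborel)\<^sup>2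
    \<le> (esqrt (\<integral>\<^sup>+b. A1 b \<partial>lborel) * (esqrt (\<integral>\<^sup>+a. A2 a \<partial>lborel) * esqrt (\<integral>\<^sup>+a. A3 a \<partial>lborel)))\<^sup>2"
    by (intro power_mono) auto
  then show ?thesis
    by (simp add: power_mult_distrib esqrt_square A1_def A2_def A3_def mult.assoc)
qed

text \<open>The fourth power is chosen so that its derivative, \<open>4 u^3 u'\<close>, pairs \<open>u\<close> in \<open>L^6\<close> with the gradient in
  \<open>L^2\<close>.\<close>

lemma power4_le_line_integral:
  fixes u d :: "real \<Rightarrow> real"
  assumes du: "\<And>s. (u has_real_derivative d s) (at s)" and cd: "continuous_on UNIV d"
    and decay: "(\<lambda>n::nat. u (a + real n)) \<longlonglongrightarrow> 0"
  shows "ennreal (u a ^ 4) \<le> (\<integral>\<^sup>+s. ennreal (4 * \<bar>u s\<bar> ^ 3 * \<bar>d s\<bar>) \<partial>lborel)"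
proof -
  let ?K = "\<integral>\<^sup>+s. ennreal (4 * \<bar>u s\<bar> ^ 3 * \<bar>d s\<bar>) \<partial>lborel"
  have cu: "continuous_on UNIV u" using du DERIV_isCont continuous_at_imp_continuous_on by blast
  have [measurable]: "u \<in> borel_measurable borel" "d \<in> borel_measurable borel"
    using cu cd by (simp_all add: borel_measurable_continuous_onI)
  have "ennreal (u a ^ 4) \<le> ennreal (u (a + real n) ^ 4) + ?K" for n :: nat
  proof -
    let ?f = "\<lambda>s. (4 * u s ^ 3 * d s) * indicator {a..a + real n} s"
    have "isCont d s" for s using cd continuous_on_eq_continuous_at by blast
    moreover have "isCont u s" for s using du DERIV_isCont by blast
    ultimately have "has_bochner_integral lborel ?f (u (a + real n) ^ 4 - u a ^ 4)"
      using has_bochner_integral_FTC_Icc_real[of a "a + real n" "\<lambda>s. u s ^ 4" "\<lambda>s. 4 * u s ^ 3 * d s"]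
        DERIV_power[OF du, of 4] by (simp add: ac_simps)
    then have i: "integrable lborel ?f" "(LBINT s. ?f s) = u (a + real n) ^ 4 - u a ^ 4"
      by (auto simp: has_bochner_integral_iff)
    have "ennreal (norm (u (a + real n) ^ 4 - u a ^ 4)) \<le> (\<integral>\<^sup>+s. norm (?f s) \<partial>lborel)"
      using integral_norm_bound_ennreal[OF i(1)] unfolding i(2) .
    also have "\<dots> \<le> ?K"
      by (intro nn_integral_mono) (auto simp: indicator_def abs_mult power_abs)
    finally have b: "ennreal \<bar>u (a + real n) ^ 4 - u a ^ 4\<bar> \<le> ?K" by simp
    have "u a ^ 4 \<le> u (a + real n) ^ 4 + \<bar>u (a + real n) ^ 4 - u a ^ 4\<bar>" by simp
    then have "ennreal (u a ^ 4) \<le> ennreal (u (a + real n) ^ 4 + \<bar>u (a + real n) ^ 4 - u a ^ 4\<bar>)"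
      by (rule ennreal_leI)
    also have "\<dots> = ennreal (u (a + real n) ^ 4) + ennreal \<bar>u (a + real n) ^ 4 - u a ^ 4\<bar>"
      by (simp add: ennreal_plus)
    finally show ?thesis using b by (meson add_left_mono order_trans)
  qed
  moreover have "(\<lambda>n. ennreal (u (a + real n) ^ 4) + ?K) \<longlonglongrightarrow> ennreal (0 ^ 4) + ?K"
    by (intro tendsto_add tendsto_const tendsto_ennrealI tendsto_power decay)
  ultimately show ?thesis using LIMSEQ_le_const[of _ "0 + ?K" "ennreal (u a ^ 4)"] by (simp add: zero_power)
qed

text \<open>The fourth power at a point is bounded by a line integral in each of the three directions. Hence the
  sixth power is at most the product of the square roots of three functions of two variables, to which
  the Loomis--Whitney inequality applies. Each of these functions has total integral at most
  \<open>4 sqrt (J D_i)\<close>, where \<open>J\<close> and \<open>D_i\<close> are the integrals of \<open>u^6\<close> and \<open>(d i)^2\<close>; finiteness of \<open>J\<close> allows the powers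
  of \<open>J\<close> on the right to be cancelled.\<close>

lemma Sobolev_C1:
  fixes u :: "real^3 \<Rightarrow> real" and d :: "3 \<Rightarrow> real^3 \<Rightarrow> real"
  assumes du: "\<And>x i s. ((\<lambda>s. u (x + s *\<^sub>R axis i 1)) has_real_derivative d i (x + s *\<^sub>R axis i 1)) (at s)"
    and cu: "continuous_on UNIV u" and cd: "\<And>i. continuous_on UNIV (d i)"
    and decay: "\<And>x i. (\<lambda>n::nat. u (x + real n *\<^sub>R axis i 1)) \<longlonglongrightarrow> 0"
    and fin: "(\<integral>\<^sup>+x. ennreal (u x ^ 6) \<partial>lborel) < \<infinity>"
  shows "(\<integral>\<^sup>+x. ennreal (u x ^ 6) \<partial>lborel) \<le> 4096 * (\<Prod>i\<in>UNIV. \<integral>\<^sup>+x. ennreal ((d i x)\<^sup>2) \<partial>lborel)"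
proof -
  have [measurable]: "u \<in> borel_measurable borel" "d i \<in> borel_measurable borel" for i
    using cu cd by (simp_all add: borel_measurable_continuous_onI)
  define h where "h i x = ennreal (4 * \<bar>u x\<bar> ^ 3 * \<bar>d i x\<bar>)" for i x
  have [measurable]: "h i \<in> borel_measurable borel" for i unfolding h_def[abs_def] by measurable
  define J where "J = (\<integral>\<^sup>+x. ennreal (u x ^ 6) \<partial>lborel)"
  define D where "D i = (\<integral>\<^sup>+x. ennreal ((d i x)\<^sup>2) \<partial>lborel)" for i
  have h2: "(\<integral>\<^sup>+x. h i x \<partial>lborel)\<^sup>2 \<le> 16 * (J * D i)" for i
  proof -
    have "(\<integral>\<^sup>+x. h i x \<partial>lborel)\<^sup>2 = (\<integral>\<^sup>+x. ennreal (4 * \<bar>u x\<bar> ^ 3) * ennreal \<bar>d i x\<bar> \<partial>lborel)\<^sup>2"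
      by (simp add: h_def ennreal_mult)
    also have "\<dots> \<le> (\<integral>\<^sup>+x. (ennreal (4 * \<bar>u x\<bar> ^ 3))\<^sup>2 \<partial>lborel) * (\<integral>\<^sup>+x. (ennreal \<bar>d i x\<bar>)\<^sup>2 \<partial>lborel)"
      by (rule Cauchy_Schwarz_nn_integral) measurable
    also have "(\<integral>\<^sup>+x. (ennreal (4 * \<bar>u x\<bar> ^ 3))\<^sup>2 \<partial>lborel) = (\<integral>\<^sup>+x. 16 * ennreal (u x ^ 6) \<partial>lborel)"
      by (intro nn_integral_cong)
        (simp add: ennreal_power power_mult_distrib ennreal_mult flip: power_mult power_abs)
    also have "\<dots> = 16 * J" unfolding J_def by (rule nn_integral_cmult) measurable
    also have "(\<integral>\<^sup>+x. (ennreal \<bar>d i x\<bar>)\<^sup>2 \<partial>lborel) = D i" by (simp add: ennreal_power D_def)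
    finally show ?thesis by (simp add: mult.assoc)
  qed
  define F1 where "F1 b c = (\<integral>\<^sup>+a. h 1 (point3 a b c) \<partial>lborel)" for b c
  define F2 where "F2 a c = (\<integral>\<^sup>+b. h 2 (point3 a b c) \<partial>lborel)" for a c
  define F3 where "F3 a b = (\<integral>\<^sup>+c. h 3 (point3 a b c) \<partial>lborel)" for a b
  have [measurable]: "case_prod F1 \<in> borel_measurable (borel \<Otimes>\<^sub>M borel)" "case_prod F2 \<in> borel_measurable (borel \<Otimes>\<^sub>M borel)"
    "case_prod F3 \<in> borel_measurable (borel \<Otimes>\<^sub>M borel)"
    unfolding F1_def F2_def F3_def by measurable
  have line: "ennreal (u (point3 a b c) ^ 4) \<le> F1 b c" "ennreal (u (point3 a b c) ^ 4) \<le> F2 a c"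
    "ennreal (u (point3 a b c) ^ 4) \<le> F3 a b" for a b c
  proof -
    have line_i: "ennreal (u (x + t *\<^sub>R axis i 1) ^ 4) \<le> (\<integral>\<^sup>+s. h i (x + s *\<^sub>R axis i 1) \<partial>lborel)" for x i t
      unfolding h_def
    proof (rule power4_le_line_integral[where u = "\<lambda>s. u (x + s *\<^sub>R axis i 1)"])
      show "continuous_on UNIV (\<lambda>s. d i (x + s *\<^sub>R axis i 1))"
        by (rule continuous_on_compose2[OF cd]) (auto intro!: continuous_intros)
      show "(\<lambda>n. u (x + (t + real n) *\<^sub>R axis i 1)) \<longlonglongrightarrow> 0"
        using decay[of "x + t *\<^sub>R axis i 1" i] by (simp add: algebra_simps)
    qed (rule du)
    show "ennreal (u (point3 a b c) ^ 4) \<le> F1 b c"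
      using line_i[of "b *\<^sub>R axis 2 1 + c *\<^sub>R axis 3 1" a 1] by (simp add: F1_def point3_def ac_simps)
    show "ennreal (u (point3 a b c) ^ 4) \<le> F2 a c"
      using line_i[of "a *\<^sub>R axis 1 1 + c *\<^sub>R axis 3 1" b 2] by (simp add: F2_def point3_def ac_simps)
    show "ennreal (u (point3 a b c) ^ 4) \<le> F3 a b"
      using line_i[of "a *\<^sub>R axis 1 1 + b *\<^sub>R axis 2 1" c 3] by (simp add: F3_def point3_def ac_simps)
  qed
  have pt: "ennreal (u (point3 a b c) ^ 6) \<le> esqrt (F1 b c) * esqrt (F2 a c) * esqrt (F3 a b)" for a b c
  proof (rule ennreal_square_le_imp_le)
    let ?t = "u (point3 a b c)"
    have "(ennreal (?t ^ 6))\<^sup>2 = ennreal (?t ^ 4) * ennreal (?t ^ 4) * ennreal (?t ^ 4)"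
      by (simp add: ennreal_power flip: ennreal_mult power_mult power_add)
    also have "\<dots> \<le> F1 b c * F2 a c * F3 a b" by (intro mult_mono line) auto
    finally show "(ennreal (?t ^ 6))\<^sup>2 \<le> (esqrt (F1 b c) * esqrt (F2 a c) * esqrt (F3 a b))\<^sup>2"
      by (simp add: power_mult_distrib esqrt_square)
  qed
  have tot: "(\<integral>\<^sup>+b. \<integral>\<^sup>+c. F1 b c \<partial>lborel \<partial>lborel) = (\<integral>\<^sup>+x. h 1 x \<partial>lborel)"
    "(\<integral>\<^sup>+a. \<integral>\<^sup>+c. F2 a c \<partial>lborel \<partial>lborel) = (\<integral>\<^sup>+x. h 2 x \<partial>lborel)"
    "(\<integral>\<^sup>+a. \<integral>\<^sup>+b. F3 a b \<partial>lborel \<partial>lborel) = (\<integral>\<^sup>+x. h 3 x \<partial>lborel)"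
  proof -
    show "(\<integral>\<^sup>+a. \<integral>\<^sup>+b. F3 a b \<partial>lborel \<partial>lborel) = (\<integral>\<^sup>+x. h 3 x \<partial>lborel)"
      by (simp add: F3_def nn_integral_point3)
    have "(\<integral>\<^sup>+c. F2 a c \<partial>lborel) = (\<integral>\<^sup>+b. \<integral>\<^sup>+c. h 2 (point3 a b c) \<partial>lborel \<partial>lborel)" for a
      unfolding F2_def by (rule lborel_pair.Fubini') simp
    then show "(\<integral>\<^sup>+a. \<integral>\<^sup>+c. F2 a c \<partial>lborel \<partial>lborel) = (\<integral>\<^sup>+x. h 2 x \<partial>lborel)"
      by (simp add: nn_integral_point3)
    have "(\<integral>\<^sup>+c. F1 b c \<partial>lborel) = (\<integral>\<^sup>+a. \<integral>\<^sup>+c. h 1 (point3 a b c) \<partial>lborel \<partial>lborel)" for b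
      unfolding F1_def by (rule lborel_pair.Fubini') simp
    then have "(\<integral>\<^sup>+b. \<integral>\<^sup>+c. F1 b c \<partial>lborel \<partial>lborel)
        = (\<integral>\<^sup>+b. \<integral>\<^sup>+a. \<integral>\<^sup>+c. h 1 (point3 a b c) \<partial>lborel \<partial>lborel \<partial>lborel)" by simp
    also have "\<dots> = (\<integral>\<^sup>+a. \<integral>\<^sup>+b. \<integral>\<^sup>+c. h 1 (point3 a b c) \<partial>lborel \<partial>lborel \<partial>lborel)"
      by (rule lborel_pair.Fubini') simp
    finally show "(\<integral>\<^sup>+b. \<integral>\<^sup>+c. F1 b c \<partial>lborel \<partial>lborel) = (\<integral>\<^sup>+x. h 1 x \<partial>lborel)"
      by (simp add: nn_integral_point3)
  qed
  have "J\<^sup>2 \<le> (\<integral>\<^sup>+a. \<integral>\<^sup>+b. \<integral>\<^sup>+c. esqrt (F1 b c) * esqrt (F2 a c) * esqrt (F3 a b) \<partial>lborel \<partial>lborel \<partial>lborel)\<^sup>2"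
    unfolding J_def by (subst nn_integral_point3, simp) (intro power_mono nn_integral_mono pt, simp)
  also have "\<dots> \<le> (\<integral>\<^sup>+b. \<integral>\<^sup>+c. (esqrt (F1 b c))\<^sup>2 \<partial>lborel \<partial>lborel) * (\<integral>\<^sup>+a. \<integral>\<^sup>+c. (esqrt (F2 a c))\<^sup>2 \<partial>lborel \<partial>lborel)
      * (\<integral>\<^sup>+a. \<integral>\<^sup>+b. (esqrt (F3 a b))\<^sup>2 \<partial>lborel \<partial>lborel)"
    by (rule Loomis_Whitney) (simp_all add: borel_prod[symmetric])
  also have "\<dots> = (\<integral>\<^sup>+x. h 1 x \<partial>lborel) * (\<integral>\<^sup>+x. h 2 x \<partial>lborel) * (\<integral>\<^sup>+x. h 3 x \<partial>lborel)"
    by (simp add: esqrt_square tot)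
  finally have "(J\<^sup>2)\<^sup>2 \<le> ((\<integral>\<^sup>+x. h 1 x \<partial>lborel) * (\<integral>\<^sup>+x. h 2 x \<partial>lborel) * (\<integral>\<^sup>+x. h 3 x \<partial>lborel))\<^sup>2"
    by (intro power_mono) auto
  also have "\<dots> \<le> (16 * (J * D 1)) * (16 * (J * D 2)) * (16 * (J * D 3))"
    unfolding power_mult_distrib by (intro mult_mono h2) auto
  also have "\<dots> = (16 * 16 * 16) * (J * J * J * (D 1 * D 2 * D 3))" by (simp only: ac_simps)
  also have "\<dots> = (J * J * J) * (4096 * (D 1 * D 2 * D 3))"
  proof -
    have "(16 * 16 * 16 :: ennreal) = 4096" by simp
    then show ?thesis by (simp only: ac_simps)
  qed
  finally have le: "(J * J * J) * J \<le> (J * J * J) * (4096 * (D 1 * D 2 * D 3))"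
    by (simp add: power2_eq_square mult.assoc)
  have "J \<le> 4096 * (D 1 * D 2 * D 3)"
  proof (cases "J = 0")
    case False
    then show ?thesis
      using le fin unfolding J_def[symmetric]
      by (subst (asm) ennreal_mult_le_mult_iff) (auto simp: ennreal_mult_eq_top_iff)
  qed simp
  moreover have "(\<Prod>i\<in>UNIV. D i) = D 1 * D 2 * D 3" unfolding UNIV_3 by (simp add: mult.assoc)
  ultimately show ?thesis unfolding J_def D_def by simp
qed

text \<open>The mollifications of \<open>u\<close> are bounded by \<open>L^2\<close> norms, hence lie in \<open>L^6\<close>, and decay along lines by
  dominated convergence. Their derivatives are the mollifications of the weak derivatives, with no larger
  \<open>L^2\<close> norm. Fatou's lemma passes to the limit, first on balls and then on the whole space.\<close>

lemma Sobolev_weak: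
  fixes u :: "real^3 \<Rightarrow> real" and g :: "3 \<Rightarrow> real^3 \<Rightarrow> real"
  assumes u: "square_integrable u" and g: "\<And>i. square_integrable (g i)"
    and weak: "\<And>\<phi> i. \<phi> \<in> test_functions UNIV \<Longrightarrow>
      (LBINT x. u x * partial_deriv i \<phi> x) = - (LBINT x. g i x * \<phi> x)"
  shows "(\<integral>\<^sup>+x. ennreal (u x ^ 6) \<partial>lborel) \<le> 4096 * (\<Prod>i\<in>UNIV. \<integral>\<^sup>+x. ennreal ((g i x)\<^sup>2) \<partial>lborel)"
proof -
  have [measurable]: "u \<in> borel_measurable borel" "g i \<in> borel_measurable borel" for i
    using u g by (auto simp: square_integrable_def)
  have lu: "locally_integrable u" and lg: "locally_integrable (g i)" for i
    using u g square_integrable_locally_integrable by blast+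
  have u2: "integrable lborel (\<lambda>x. (u x)\<^sup>2)" using u by (simp add: square_integrable_def)
  define c where "c = (LBINT x. (u x)\<^sup>2)"
  have c: "(\<integral>\<^sup>+x. ennreal ((u x)\<^sup>2) \<partial>lborel) = ennreal c"
    unfolding c_def by (rule nn_integral_eq_integral[OF u2]) simp
  let ?u = "\<lambda>n. convolve (mollifier n) u"
  let ?K = "4096 * (\<Prod>i\<in>UNIV. \<integral>\<^sup>+x. ennreal ((g i x)\<^sup>2) \<partial>lborel)"
  have deriv: "convolve (partial_deriv i (mollifier n)) u = convolve (mollifier n) (g i)" for i n
  proof
    fix x
    let ?\<psi> = "\<lambda>y. mollifier n (x - y)"
    have "partial_deriv i ?\<psi> y = - partial_deriv i (mollifier n) (x - y)" for y
      using partial_deriv_affine[of "mollifier n" i "-1" x y] test_mollifier smooth_differentiable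
      by (auto simp: test_functions_UNIV_iff)
    then show "convolve (partial_deriv i (mollifier n)) u x = convolve (mollifier n) (g i) x"
      using weak[OF test_functions_reflect[OF test_mollifier[of n], of x], of i]
      by (simp add: convolve_def mult.commute)
  qed
  have square: "(convolve (mollifier n) u x)\<^sup>2 \<le> (LBINT y. mollifier n (x - y) * (u y)\<^sup>2)" for n x
  proof -
    have li: "locally_integrable (\<lambda>y. (u y)\<^sup>2)" by (rule integrable_locally_integrable[OF u2])
    have "(\<integral>\<^sup>+y. ennreal (mollifier n (x - y)) * ennreal ((u y)\<^sup>2) \<partial>lborel)
       = ennreal (LBINT y. mollifier n (x - y) * (u y)\<^sup>2)"
      using nn_integral_eq_integral[OF integrable_convolve[OF li test_mollifier, of n x]]
      by (simp add: mollifier_nonneg ennreal_mult)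
    then have "ennreal ((convolve (mollifier n) u x)\<^sup>2) \<le> ennreal (LBINT y. mollifier n (x - y) * (u y)\<^sup>2)"
      using convolve_mollifier_square[of u n x] by simp
    then show ?thesis
      by (subst (asm) ennreal_le_iff) (auto intro!: Bochner_Integration.integral_nonneg simp: mollifier_nonneg)
  qed
  have Sob: "(\<integral>\<^sup>+x. ennreal (?u n x ^ 6) \<partial>lborel) \<le> ?K" for n
  proof -
    obtain B R where B: "0 \<le> B" "0 \<le> R" "\<And>x. \<bar>mollifier n x\<bar> \<le> B" "\<And>x. norm x > R \<Longrightarrow> mollifier n x = 0"
      using test_function_bounds[OF test_mollifier] by metis
    have dom: "norm (mollifier n (x - y) * (u y)\<^sup>2) \<le> B * (u y)\<^sup>2" for x y
      using B(3) by (auto simp: abs_mult intro!: mult_right_mono)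
    have "(\<integral>\<^sup>+x. ennreal (?u n x ^ 6) \<partial>lborel)
      \<le> 4096 * (\<Prod>i\<in>UNIV. \<integral>\<^sup>+x. ennreal ((convolve (mollifier n) (g i) x)\<^sup>2) \<partial>lborel)"
    proof (rule Sobolev_C1)
      show "((\<lambda>s. ?u n (x + s *\<^sub>R axis i 1)) has_real_derivative convolve (mollifier n) (g i) (x + s *\<^sub>R axis i 1)) (at s)" for x i s
        using convolve_has_derivative[OF lu test_mollifier, of n x i s] unfolding deriv .
      show cu: "continuous_on UNIV (?u n)" by (rule continuous_convolve[OF lu test_mollifier])
      show "continuous_on UNIV (convolve (mollifier n) (g i))" for i by (rule continuous_convolve[OF lg test_mollifier])
      have [measurable]: "?u n \<in> borel_measurable borel" by (rule borel_measurable_continuous_onI[OF cu])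
      have bound: "(?u n x)\<^sup>2 \<le> B * c" for x
      proof -
        have "(LBINT y. mollifier n (x - y) * (u y)\<^sup>2) \<le> (LBINT y. B * (u y)\<^sup>2)"
          using dom[of x] u2 integrable_convolve[OF integrable_locally_integrable[OF u2] test_mollifier]
          by (intro integral_mono) (auto simp: abs_mult mollifier_nonneg)
        then show ?thesis using square[where n = n and x = x] unfolding c_def by simp
      qed
      have "?u n x ^ 6 \<le> (B * c)\<^sup>2 * (?u n x)\<^sup>2" for x
      proof -
        have "?u n x ^ 6 = ((?u n x)\<^sup>2)\<^sup>2 * (?u n x)\<^sup>2" by (simp flip: power_mult power_add)
        also have "\<dots> \<le> (B * c)\<^sup>2 * (?u n x)\<^sup>2"
          by (intro mult_right_mono power_mono bound) auto
        finally show ?thesis .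
      qed
      then have "(\<integral>\<^sup>+x. ennreal (?u n x ^ 6) \<partial>lborel) \<le> (\<integral>\<^sup>+x. ennreal ((B * c)\<^sup>2) * ennreal ((?u n x)\<^sup>2) \<partial>lborel)"
        by (intro nn_integral_mono) (simp flip: ennreal_mult)
      also have "\<dots> = ennreal ((B * c)\<^sup>2) * (\<integral>\<^sup>+x. ennreal ((?u n x)\<^sup>2) \<partial>lborel)" by (rule nn_integral_cmult) simp
      also have "\<dots> \<le> ennreal ((B * c)\<^sup>2) * ennreal c"
        using nn_integral_convolve_square[of u n] c by (intro mult_left_mono) auto
      also have "\<dots> < \<infinity>" by (simp add: ennreal_mult_less_top)
      finally show "(\<integral>\<^sup>+x. ennreal (?u n x ^ 6) \<partial>lborel) < \<infinity>" .
      show "(\<lambda>k::nat. ?u n (x + real k *\<^sub>R axis i 1)) \<longlonglongrightarrow> 0" for x i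
      proof -
        let ?x = "\<lambda>k::nat. x + real k *\<^sub>R axis i 1"
        have "(\<lambda>k. (LBINT y. mollifier n (?x k - y) * (u y)\<^sup>2)) \<longlonglongrightarrow> (\<integral>y. 0 \<partial>(lborel :: (real^3) measure))"
        proof (rule integral_dominated_convergence[where w = "\<lambda>y. B * (u y)\<^sup>2"])
          show "AE y in lborel. (\<lambda>k. mollifier n (?x k - y) * (u y)\<^sup>2) \<longlonglongrightarrow> 0"
          proof (rule AE_I2)
            fix y
            obtain N where N: "R + norm (x - y) < real N" using reals_Archimedean2 by blast
            have "mollifier n (?x k - y) = 0" if "k \<ge> N" for k
            proof (rule B(4))
              have "real k = norm ((?x k - y) - (x - y))" by simp
              also have "\<dots> \<le> norm (?x k - y) + norm (x - y)" by (rule norm_triangle_ineq4)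
              finally show "norm (?x k - y) > R" using N that by linarith
            qed
            then show "(\<lambda>k. mollifier n (?x k - y) * (u y)\<^sup>2) \<longlonglongrightarrow> 0"
              by (intro tendsto_eventually) (auto simp: eventually_sequentially)
          qed
          show "AE y in lborel. norm (mollifier n (?x k - y) * (u y)\<^sup>2) \<le> B * (u y)\<^sup>2" for k
            using dom by blast
        qed (use u2 in auto)
        then have lim: "(\<lambda>k. (LBINT y. mollifier n (?x k - y) * (u y)\<^sup>2)) \<longlonglongrightarrow> 0" by simp
        have "(\<lambda>k. (?u n (?x k))\<^sup>2) \<longlonglongrightarrow> 0"
          by (rule tendsto_sandwich[OF _ _ tendsto_const lim]) (use square in auto)
        then show ?thesis by (simp add: power_tendsto_0_iff)
      qed
    qed
    also have "\<dots> \<le> ?K"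
      unfolding UNIV_3 by (simp, intro mult_left_mono mult_mono nn_integral_convolve_square) auto
    finally show ?thesis .
  qed
  have ball: "(\<integral>\<^sup>+x. indicator (ball 0 R) x * ennreal (u x ^ 6) \<partial>lborel) \<le> ?K" for R
  proof -
    obtain r :: "nat \<Rightarrow> nat" where r: "AE x in lborel. norm x < R \<longrightarrow> (\<lambda>n. ?u (r n) x) \<longlonglongrightarrow> u x"
      by (rule convolve_mollifier_AE[OF lu, of R])
    have [measurable]: "?u n \<in> borel_measurable borel" for n
      by (rule borel_measurable_continuous_onI[OF continuous_convolve[OF lu test_mollifier]])
    have "(\<integral>\<^sup>+x. indicator (ball 0 R) x * ennreal (u x ^ 6) \<partial>lborel)
       \<le> (\<integral>\<^sup>+x. liminf (\<lambda>n. ennreal (?u (r n) x ^ 6)) \<partial>lborel)"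
    proof (rule nn_integral_mono_AE)
      show "AE x in lborel. indicator (ball 0 R) x * ennreal (u x ^ 6) \<le> liminf (\<lambda>n. ennreal (?u (r n) x ^ 6))"
        using r
      proof eventually_elim
        case (elim x)
        show ?case
        proof (cases "norm x < R")
          case True
          then have "(\<lambda>n. ennreal (?u (r n) x ^ 6)) \<longlonglongrightarrow> ennreal (u x ^ 6)"
            using elim by (intro tendsto_ennrealI tendsto_power) auto
          then show ?thesis using lim_imp_Liminf[OF sequentially_bot] True by (metis dual_order.refl indicator_simps(1) mem_ball_0 mult_1)
        qed simp
      qed
    qed
    also have "\<dots> \<le> liminf (\<lambda>n. \<integral>\<^sup>+x. ennreal (?u (r n) x ^ 6) \<partial>lborel)"
      by (rule nn_integral_liminf) measurable
    also have "\<dots> \<le> ?K"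
      by (rule Liminf_le) (use Sob in auto)
    finally show ?thesis .
  qed
  have "(\<integral>\<^sup>+x. ennreal (u x ^ 6) \<partial>lborel)
     = (\<integral>\<^sup>+x. liminf (\<lambda>k. indicator (ball 0 (real k)) x * ennreal (u x ^ 6)) \<partial>lborel)"
  proof (rule nn_integral_cong)
    fix x :: "real^3"
    obtain N where N: "norm x < real N" using reals_Archimedean2 by blast
    have "eventually (\<lambda>k. indicator (ball 0 (real k)) x * ennreal (u x ^ 6) = ennreal (u x ^ 6)) sequentially"
      unfolding eventually_sequentially using N by (auto intro!: exI[of _ N])
    then have "(\<lambda>k. indicator (ball 0 (real k)) x * ennreal (u x ^ 6)) \<longlonglongrightarrow> ennreal (u x ^ 6)"
      by (rule tendsto_eventually)
    then show "ennreal (u x ^ 6) = liminf (\<lambda>k. indicator (ball 0 (real k)) x * ennreal (u x ^ 6))"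
      using lim_imp_Liminf[OF sequentially_bot] by metis
  qed
  also have "\<dots> \<le> liminf (\<lambda>k. \<integral>\<^sup>+x. indicator (ball 0 (real k)) x * ennreal (u x ^ 6) \<partial>lborel)"
    by (intro nn_integral_liminf borel_measurable_times_ennreal borel_measurable_indicator) auto
  also have "\<dots> \<le> ?K" by (rule Liminf_le) (use ball in auto)
  finally show ?thesis .
qed

section \<open>The space H1\<close>

lemma locally_integrable_bounded_linear:
  fixes T :: "'b::euclidean_space \<Rightarrow> 'c::euclidean_space" and w :: "real^3 \<Rightarrow> 'b"
  assumes T: "bounded_linear T" and w: "locally_integrable w"
  shows "locally_integrable (\<lambda>x. T (w x))"
  unfolding locally_integrable_def
proof (intro conjI allI impI)
  have [measurable]: "T \<in> borel_measurable borel"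
    using T by (intro borel_measurable_continuous_onI linear_continuous_on)
  have [measurable]: "w \<in> borel_measurable lborel" using w by (simp add: locally_integrable_def)
  show "(\<lambda>x. T (w x)) \<in> borel_measurable lborel" by measurable
  fix K :: "(real^3) set" assume "compact K"
  then have "integrable lborel (\<lambda>x. indicator K x *\<^sub>R w x)"
    using w by (simp add: locally_integrable_def set_integrable_def)
  then have "integrable lborel (\<lambda>x. T (indicator K x *\<^sub>R w x))"
    by (rule integrable_bounded_linear[OF T])
  then show "set_integrable lborel K (\<lambda>x. T (w x))"
    by (simp add: set_integrable_def linear_scale[OF bounded_linear.linear[OF T]])
qed

lemma square_integrable_bounded_linear:
  fixes T :: "'b::euclidean_space \<Rightarrow> 'c::euclidean_space" and w :: "real^3 \<Rightarrow> 'b"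
  assumes T: "bounded_linear T" and w: "square_integrable w"
  shows "square_integrable (\<lambda>x. T (w x))"
  unfolding square_integrable_def
proof
  have [measurable]: "T \<in> borel_measurable borel"
    using T by (intro borel_measurable_continuous_onI linear_continuous_on)
  have [measurable]: "w \<in> borel_measurable lborel" using w by (simp add: square_integrable_def)
  show m: "(\<lambda>x. T (w x)) \<in> borel_measurable lborel" by measurable
  obtain K where K: "\<And>x. norm (T x) \<le> norm x * K" using bounded_linear.bounded[OF T] by blast
  show "integrable lborel (\<lambda>x. (norm (T (w x)))\<^sup>2)"
  proof (rule Bochner_Integration.integrable_bound)
    show "integrable lborel (\<lambda>x. (norm (w x))\<^sup>2 * K\<^sup>2)" using w by (simp add: square_integrable_def)
    show "AE x in lborel. norm ((norm (T (w x)))\<^sup>2) \<le> norm ((norm (w x))\<^sup>2 * K\<^sup>2)"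
      using K by (auto simp flip: power_mult_distrib intro!: power_mono)
  qed measurable
qed

lemma square_integrable_add:
  fixes v w :: "real^3 \<Rightarrow> 'b::euclidean_space"
  assumes "square_integrable v" "square_integrable w"
  shows "square_integrable (\<lambda>x. v x + w x)"
  unfolding square_integrable_def
proof
  have [measurable]: "v \<in> borel_measurable borel" "w \<in> borel_measurable borel"
    using assms by (auto simp: square_integrable_def)
  show "(\<lambda>x. v x + w x) \<in> borel_measurable lborel" by measurable
  show "integrable lborel (\<lambda>x. (norm (v x + w x))\<^sup>2)"
  proof (rule Bochner_Integration.integrable_bound)
    show "integrable lborel (\<lambda>x. 2 * (norm (v x))\<^sup>2 + 2 * (norm (w x))\<^sup>2)"
      using assms by (auto simp: square_integrable_def)
    have "(norm (a + b))\<^sup>2 \<le> 2 * (norm a)\<^sup>2 + 2 * (norm b)\<^sup>2" for a b :: 'b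
    proof -
      have "(norm (a + b))\<^sup>2 \<le> (norm a + norm b)\<^sup>2" by (intro power_mono norm_triangle_ineq) simp
      also have "\<dots> \<le> 2 * (norm a)\<^sup>2 + 2 * (norm b)\<^sup>2"
        using zero_le_power2[of "norm a - norm b"] by (simp add: power2_eq_square algebra_simps)
      finally show ?thesis .
    qed
    then show "AE x in lborel. norm ((norm (v x + w x))\<^sup>2) \<le> norm (2 * (norm (v x))\<^sup>2 + 2 * (norm (w x))\<^sup>2)" by simp
  qed measurable
qed

lemma bounded_linear_complex_nth: "bounded_linear (\<lambda>v::complex^3. v $ i)"
  by (rule bounded_linear_vec_nth)

lemma integrable_complex_test:
  fixes w :: "real^3 \<Rightarrow> complex"
  assumes "locally_integrable w" "\<phi> \<in> test_functions UNIV"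
  shows "integrable lborel (\<lambda>x. w x * of_real (\<phi> x))"
  using integrable_test_times[OF assms] by (simp add: scaleR_conv_of_real mult.commute)

text \<open>Applied to the real and the imaginary part, this reduces statements about complex functions to real ones.\<close>

lemma is_weak_gradient_functional:
  fixes T :: "complex \<Rightarrow> real"
  assumes T: "bounded_linear T" and f: "locally_integrable f" and g: "is_weak_gradient f g"
    and \<phi>: "\<phi> \<in> test_functions UNIV"
  shows "(LBINT x. T (f x) * partial_deriv i \<phi> x) = - (LBINT x. T (g x $ i) * \<phi> x)"
proof -
  have lin: "T (z * of_real r) = T z * r" for z r
    using linear_scale[OF bounded_linear.linear[OF T], of r z] by (simp add: scaleR_conv_of_real mult.commute)
  have lg: "locally_integrable (\<lambda>x. g x $ i)"
    using g locally_integrable_bounded_linear[OF bounded_linear_complex_nth] by (simp add: is_weak_gradient_def)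
  have "(LBINT x. T (f x * of_real (partial_deriv i \<phi> x))) = T (LBINT x. f x * of_real (partial_deriv i \<phi> x))"
    by (rule integral_bounded_linear[OF T integrable_complex_test[OF f test_functions_partial_deriv[OF \<phi>]]])
  moreover have "(LBINT x. T (g x $ i * of_real (\<phi> x))) = T (LBINT x. g x $ i * of_real (\<phi> x))"
    by (rule integral_bounded_linear[OF T integrable_complex_test[OF lg \<phi>]])
  ultimately show ?thesis
    using g \<phi> by (simp add: is_weak_gradient_def lin linear_neg[OF bounded_linear.linear[OF T]])
qed

lemma weak_gradient_unique:
  assumes g: "is_weak_gradient f g" and h: "is_weak_gradient f h"
  shows "AE x in lborel. g x = h x"
proof -
  have comp: "AE x in lborel. T (g x $ i - h x $ i) = 0" if T: "bounded_linear T" for T :: "complex \<Rightarrow> real" and i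
  proof -
    have lg: "locally_integrable (\<lambda>x. g x $ i)" and lh: "locally_integrable (\<lambda>x. h x $ i)"
      using g h locally_integrable_bounded_linear[OF bounded_linear_complex_nth] by (simp_all add: is_weak_gradient_def)
    then have "locally_integrable (\<lambda>x. g x $ i - h x $ i)"
      unfolding locally_integrable_def by (auto intro: set_integral_diff)
    then have l: "locally_integrable (\<lambda>x. T (g x $ i - h x $ i))"
      by (rule locally_integrable_bounded_linear[OF T])
    have "(LBINT x. \<phi> x * T (g x $ i - h x $ i)) = 0" if \<phi>: "\<phi> \<in> test_functions UNIV" for \<phi>
    proof -
      note ig = integrable_complex_test[OF lg \<phi>] and ih = integrable_complex_test[OF lh \<phi>]
      have "(LBINT x. g x $ i * of_real (\<phi> x) - h x $ i * of_real (\<phi> x)) = 0"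
        using g h \<phi> unfolding Bochner_Integration.integral_diff[OF ig ih]
        by (simp add: is_weak_gradient_def)
      then have "(LBINT x. T (g x $ i * of_real (\<phi> x) - h x $ i * of_real (\<phi> x))) = T 0"
        using integral_bounded_linear[OF T Bochner_Integration.integrable_diff[OF ig ih]] by simp
      moreover have "T (a * of_real r - b * of_real r) = r * T (a - b)" for a b r
        using linear_scale[OF bounded_linear.linear[OF T], of r "a - b"]
        by (simp add: scaleR_conv_of_real algebra_simps)
      ultimately show ?thesis by (simp add: linear_0[OF bounded_linear.linear[OF T]])
    qed
    from AE_eq_0_if_orthogonal_to_test_functions[OF l open_UNIV this] show ?thesis by simp
  qed
  have "AE x in lborel. \<forall>i\<in>UNIV. Re (g x $ i - h x $ i) = 0 \<and> Im (g x $ i - h x $ i) = 0"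
    using comp[OF bounded_linear_Re] comp[OF bounded_linear_Im]
    by (intro AE_finite_allI) (auto elim: AE_mp)
  then show ?thesis
    by eventually_elim (simp add: vec_eq_iff complex_eq_iff)
qed

text \<open>The gradient selected by the choice operator need not be the square integrable one that membership in
  the space provides, but the two agree almost everywhere.\<close>

lemma H1_weak_grad:
  assumes "f \<in> H1"
  shows "square_integrable f" "is_weak_gradient f (weak_grad f)" "square_integrable (weak_grad f)"
proof -
  obtain g where g: "is_weak_gradient f g" "square_integrable g" using assms by (auto simp: H1_def)
  show "square_integrable f" using assms by (simp add: H1_def)
  show w: "is_weak_gradient f (weak_grad f)" unfolding weak_grad_def by (rule someI[of "is_weak_gradient f", OF g(1)])
  have [measurable]: "weak_grad f \<in> borel_measurable lborel"
    using w by (simp add: is_weak_gradient_def locally_integrable_def)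
  have [measurable]: "g \<in> borel_measurable lborel" using g by (simp add: square_integrable_def)
  have "AE x in lborel. (norm (g x))\<^sup>2 = (norm (weak_grad f x))\<^sup>2"
    using weak_gradient_unique[OF g(1) w] by eventually_elim simp
  then have "integrable lborel (\<lambda>x. (norm (g x))\<^sup>2) = integrable lborel (\<lambda>x. (norm (weak_grad f x))\<^sup>2)"
    by (intro integrable_cong_AE) auto
  then show "square_integrable (weak_grad f)"
    using g by (simp add: square_integrable_def)
qed

text \<open>Every concrete candidate for the gradient may be used in place of the chosen one inside integrals.\<close>

lemma H1_I:
  assumes "square_integrable f" "is_weak_gradient f g" "square_integrable g"
  shows "f \<in> H1" "AE x in lborel. weak_grad f x = g x"
proof -
  show f: "f \<in> H1" using assms by (auto simp: H1_def)
  show "AE x in lborel. weak_grad f x = g x" by (rule weak_gradient_unique[OF H1_weak_grad(2)[OF f] assms(2)])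
qed

section \<open>The functionals and their behaviour under dilations\<close>

definition quartic :: "(real^3 \<Rightarrow> complex) \<Rightarrow> real" where
  "quartic f = (LBINT x. norm (f x) ^ 4)"

definition sextic :: "(real^3 \<Rightarrow> complex) \<Rightarrow> real" where
  "sextic f = (LBINT x. norm (f x) ^ 6)"

definition dirichlet :: "(real^3 \<Rightarrow> complex) \<Rightarrow> real" where
  "dirichlet f = (LBINT x. (norm (weak_grad f x))\<^sup>2)"

lemma borel_H1: "f \<in> H1 \<Longrightarrow> f \<in> borel_measurable borel"
  using H1_weak_grad(1) by (auto simp: square_integrable_def)

lemma borel_weak_grad: "f \<in> H1 \<Longrightarrow> weak_grad f \<in> borel_measurable borel"
  using H1_weak_grad(3) by (auto simp: square_integrable_def)

lemma norm_square_vec3: "(norm (v :: complex^3))\<^sup>2 = (\<Sum>i\<in>UNIV. (norm (v $ i))\<^sup>2)"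
  unfolding norm_vec_def L2_set_def by (simp add: sum_nonneg)

text \<open>The Sobolev inequality is applied to the real and the imaginary part separately; the factor \<open>8\<close> between
  the constants \<open>4096\<close> and \<open>32768\<close> comes from \<open>(x + y)^3 \<le> 4 (x^3 + y^3)\<close> and from adding the two parts.\<close>

lemma H1_sextic:
  assumes f: "f \<in> H1"
  shows "integrable lborel (\<lambda>x. norm (f x) ^ 6)" "sextic f \<le> 32768 * dirichlet f ^ 3"
proof -
  let ?G = "weak_grad f"
  note w = H1_weak_grad[OF f]
  have [measurable]: "f \<in> borel_measurable borel" by (rule borel_H1[OF f])
  have part: "(\<integral>\<^sup>+x. ennreal (T (f x) ^ 6) \<partial>lborel) \<le> 4096 * ennreal (dirichlet f) ^ 3"
    if T: "bounded_linear T" "\<And>z. \<bar>T z\<bar> \<le> norm z" for T :: "complex \<Rightarrow> real"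
  proof -
    have [measurable]: "T \<in> borel_measurable borel"
      using T by (intro borel_measurable_continuous_onI linear_continuous_on)
    have "(\<integral>\<^sup>+x. ennreal (T (f x) ^ 6) \<partial>lborel)
       \<le> 4096 * (\<Prod>i\<in>UNIV. \<integral>\<^sup>+x. ennreal ((T (?G x $ i))\<^sup>2) \<partial>lborel)"
    proof (rule Sobolev_weak[where u = "\<lambda>x. T (f x)" and g = "\<lambda>i x. T (?G x $ i)"])
      show "square_integrable (\<lambda>x. T (f x))" by (rule square_integrable_bounded_linear[OF T(1) w(1)])
      show "square_integrable (\<lambda>x. T (?G x $ i))" for i
        by (rule square_integrable_bounded_linear[OF T(1) square_integrable_bounded_linear[OF bounded_linear_complex_nth w(3)]])
    qed (rule is_weak_gradient_functional[OF T(1) square_integrable_locally_integrable[OF w(1)] w(2)])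
    also have "\<dots> \<le> 4096 * (\<Prod>i\<in>(UNIV :: 3 set). ennreal (dirichlet f))"
    proof -
      have "(\<integral>\<^sup>+x. ennreal ((T (?G x $ i))\<^sup>2) \<partial>lborel) \<le> ennreal (dirichlet f)" for i
      proof -
        have "(\<integral>\<^sup>+x. ennreal ((T (?G x $ i))\<^sup>2) \<partial>lborel) \<le> (\<integral>\<^sup>+x. ennreal ((norm (?G x))\<^sup>2) \<partial>lborel)"
        proof (intro nn_integral_mono ennreal_leI)
          fix x
          have "\<bar>T (?G x $ i)\<bar> \<le> norm (?G x)" using T(2) component_le_norm_cart order_trans
            by (metis Finite_Cartesian_Product.norm_nth_le)
          then show "(T (?G x $ i))\<^sup>2 \<le> (norm (?G x))\<^sup>2" by (metis abs_norm_cancel abs_le_square_iff)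
        qed
        also have "\<dots> = ennreal (dirichlet f)"
          unfolding dirichlet_def by (rule nn_integral_eq_integral) (use w(3) in \<open>auto simp: square_integrable_def\<close>)
        finally show ?thesis .
      qed
      then show ?thesis unfolding UNIV_3 by (simp, intro mult_left_mono mult_mono) auto
    qed
    also have "\<dots> = 4096 * ennreal (dirichlet f) ^ 3" by simp
    finally show ?thesis .
  qed
  have d0: "0 \<le> dirichlet f" unfolding dirichlet_def by simp
  have pw: "norm z ^ 6 \<le> 4 * (Re z ^ 6 + Im z ^ 6)" for z
  proof -
    have c: "(a + b) ^ 3 \<le> 4 * (a ^ 3 + b ^ 3)" if "a \<ge> 0" "b \<ge> 0" for a b :: real
    proof -
      have "0 \<le> (a + b) * (a - b)\<^sup>2" using that by simp
      then show ?thesis by (simp add: power2_eq_square power3_eq_cube algebra_simps)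
    qed
    have "norm z ^ 6 = ((norm z)\<^sup>2) ^ 3" by (simp flip: power_mult)
    also have "\<dots> = ((Re z)\<^sup>2 + (Im z)\<^sup>2) ^ 3" by (simp add: cmod_power2)
    also have "\<dots> \<le> 4 * (((Re z)\<^sup>2) ^ 3 + ((Im z)\<^sup>2) ^ 3)" by (rule c) auto
    finally show ?thesis by (simp flip: power_mult)
  qed
  have "(\<integral>\<^sup>+x. ennreal (norm (f x) ^ 6) \<partial>lborel)
     \<le> (\<integral>\<^sup>+x. ennreal 4 * (ennreal (Re (f x) ^ 6) + ennreal (Im (f x) ^ 6)) \<partial>lborel)"
  proof (intro nn_integral_mono)
    fix x
    have "ennreal (norm (f x) ^ 6) \<le> ennreal (4 * (Re (f x) ^ 6 + Im (f x) ^ 6))"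
      by (intro ennreal_leI pw)
    also have "\<dots> = ennreal 4 * (ennreal (Re (f x) ^ 6) + ennreal (Im (f x) ^ 6))"
      by (subst ennreal_mult) (simp_all add: ennreal_plus)
    finally show "ennreal (norm (f x) ^ 6) \<le> ennreal 4 * (ennreal (Re (f x) ^ 6) + ennreal (Im (f x) ^ 6))" .
  qed
  also have "\<dots> = ennreal 4 * ((\<integral>\<^sup>+x. ennreal (Re (f x) ^ 6) \<partial>lborel) + (\<integral>\<^sup>+x. ennreal (Im (f x) ^ 6) \<partial>lborel))"
    by (subst nn_integral_cmult) (auto simp: nn_integral_add)
  also have "\<dots> \<le> ennreal 4 * (4096 * ennreal (dirichlet f) ^ 3 + 4096 * ennreal (dirichlet f) ^ 3)"
    by (intro mult_left_mono add_mono part bounded_linear_Re bounded_linear_Im abs_Re_le_cmod abs_Im_le_cmod) auto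
  also have "\<dots> = ennreal (32768 * dirichlet f ^ 3)"
  proof -
    have "4096 * ennreal (dirichlet f) ^ 3 = ennreal (4096 * dirichlet f ^ 3)"
      using d0 by (simp add: ennreal_mult ennreal_power)
    moreover have "ennreal 4 * (ennreal X + ennreal X) = ennreal (4 * (X + X))" if "X \<ge> 0" for X
      using that by (metis add_nonneg_nonneg ennreal_mult ennreal_plus zero_le_numeral)
    from this[of "4096 * dirichlet f ^ 3"]
    have "ennreal 4 * (ennreal (4096 * dirichlet f ^ 3) + ennreal (4096 * dirichlet f ^ 3)) = ennreal (32768 * dirichlet f ^ 3)"
      using d0 by simp
    ultimately show ?thesis by metis
  qed
  finally have *: "(\<integral>\<^sup>+x. ennreal (norm (f x) ^ 6) \<partial>lborel) \<le> ennreal (32768 * dirichlet f ^ 3)" .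
  then show i: "integrable lborel (\<lambda>x. norm (f x) ^ 6)"
    by (auto simp: integrable_iff_bounded le_less_trans[OF _ ennreal_less_top])
  have "ennreal (sextic f) \<le> ennreal (32768 * dirichlet f ^ 3)"
    using * nn_integral_eq_integral[OF i] by (simp add: sextic_def)
  then show "sextic f \<le> 32768 * dirichlet f ^ 3" using d0 by (simp add: ennreal_le_iff)
qed

lemma H1_mass_integrable: "f \<in> H1 \<Longrightarrow> integrable lborel (\<lambda>x. (norm (f x))\<^sup>2)"
  using H1_weak_grad(1) by (simp add: square_integrable_def)

lemma H1_dirichlet_integrable: "f \<in> H1 \<Longrightarrow> integrable lborel (\<lambda>x. (norm (weak_grad f x))\<^sup>2)"
  using H1_weak_grad(3) by (simp add: square_integrable_def)

text \<open>Cauchy--Schwarz for \<open>|f|^4 = |f| * |f|^3\<close>.\<close>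

lemma H1_quartic:
  assumes f: "f \<in> H1"
  shows "integrable lborel (\<lambda>x. norm (f x) ^ 4)" "(quartic f)\<^sup>2 \<le> mass f * sextic f"
proof -
  have [measurable]: "f \<in> borel_measurable borel" by (rule borel_H1[OF f])
  note i2 = H1_mass_integrable[OF f] and i6 = H1_sextic(1)[OF f]
  show i4: "integrable lborel (\<lambda>x. norm (f x) ^ 4)"
  proof (rule Bochner_Integration.integrable_bound)
    show "integrable lborel (\<lambda>x. (norm (f x))\<^sup>2 + norm (f x) ^ 6)" using i2 i6 by simp
    have "t ^ 4 \<le> t\<^sup>2 + t ^ 6" for t :: real
    proof -
      have "0 \<le> t\<^sup>2 * ((t\<^sup>2 - 1 / 2)\<^sup>2 + 3 / 4)" by simp
      then show ?thesis by (simp add: power2_eq_square power4_eq_xxxx algebra_simps numeral_eq_Suc)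
    qed
    then show "AE x in lborel. norm (norm (f x) ^ 4) \<le> norm ((norm (f x))\<^sup>2 + norm (f x) ^ 6)" by simp
  qed measurable
  have "(\<integral>\<^sup>+x. ennreal (norm (f x)) * ennreal (norm (f x) ^ 3) \<partial>lborel)\<^sup>2
     \<le> (\<integral>\<^sup>+x. (ennreal (norm (f x)))\<^sup>2 \<partial>lborel) * (\<integral>\<^sup>+x. (ennreal (norm (f x) ^ 3))\<^sup>2 \<partial>lborel)"
    by (rule Cauchy_Schwarz_nn_integral) measurable
  note cs = this
  have "(\<integral>\<^sup>+x. ennreal (norm (f x) ^ 4) \<partial>lborel)\<^sup>2
     \<le> (\<integral>\<^sup>+x. ennreal ((norm (f x))\<^sup>2) \<partial>lborel) * (\<integral>\<^sup>+x. ennreal (norm (f x) ^ 6) \<partial>lborel)"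
  proof -
    have "ennreal t * ennreal (t ^ 3) = ennreal (t ^ 4)" "(ennreal t)\<^sup>2 = ennreal (t\<^sup>2)"
      "(ennreal (t ^ 3))\<^sup>2 = ennreal (t ^ 6)" if "t \<ge> 0" for t
      using that by (simp_all add: ennreal_power eval_nat_numeral flip: ennreal_mult power_mult)
    note pows = this[OF norm_ge_zero]
    show ?thesis using cs unfolding pows .
  qed
  then have "(ennreal (quartic f))\<^sup>2 \<le> ennreal (mass f) * ennreal (sextic f)"
    using nn_integral_eq_integral[OF i2] nn_integral_eq_integral[OF i4] nn_integral_eq_integral[OF i6]
    by (simp add: quartic_def mass_def sextic_def)
  moreover have "0 \<le> quartic f" "0 \<le> mass f" "0 \<le> sextic f" by (simp_all add: quartic_def mass_def sextic_def)
  ultimately show "(quartic f)\<^sup>2 \<le> mass f * sextic f"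
    by (simp add: ennreal_power ennreal_le_iff flip: ennreal_mult)
qed

lemma functionals_nonneg: "0 \<le> quartic f" "0 \<le> mass f" "0 \<le> sextic f" "0 \<le> dirichlet f"
  by (simp_all add: quartic_def mass_def sextic_def dirichlet_def)

lemma functionals_pos:
  assumes f: "f \<in> H1" and m: "0 < mass f"
  shows "0 < quartic f" "0 < sextic f" "0 < dirichlet f"
proof -
  have nz: "\<not> (AE x in lborel. f x = 0)"
  proof
    assume "AE x in lborel. f x = 0"
    then have "AE x in lborel. (norm (f x))\<^sup>2 = 0" by eventually_elim simp
    then show False using m integral_eq_zero_AE by (fastforce simp: mass_def)
  qed
  have "quartic f \<noteq> 0" using nz integral_nonneg_eq_0_iff_AE[OF H1_quartic(1)[OF f]] by (auto simp: quartic_def)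
  then show "0 < quartic f" using functionals_nonneg(1)[of f] by simp
  have "sextic f \<noteq> 0" using nz integral_nonneg_eq_0_iff_AE[OF H1_sextic(1)[OF f]] by (auto simp: sextic_def)
  then show s: "0 < sextic f" using functionals_nonneg(3)[of f] by simp
  have "dirichlet f \<noteq> 0" using s H1_sextic(2)[OF f] by auto
  then show "0 < dirichlet f" using functionals_nonneg(4)[of f] by simp
qed

definition hardy_form :: "real \<Rightarrow> (real^3 \<Rightarrow> complex) \<Rightarrow> real" where
  "hardy_form b f = (LBINT x. (norm (weak_grad f x))\<^sup>2 + b / (norm x)\<^sup>2 * (norm (f x))\<^sup>2)"

definition potential_integrable :: "real \<Rightarrow> (real^3 \<Rightarrow> complex) \<Rightarrow> bool" where
  "potential_integrable b f \<longleftrightarrow> integrable lborel (\<lambda>x. b / (norm x)\<^sup>2 * (norm (f x))\<^sup>2)"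

text \<open>The absolute value appears because the square root of a negative number is a negative number. That the form is
  nonnegative has to be established wherever it is used.\<close>

lemma Hdot_norm_square: "(Hdot_norm b f)\<^sup>2 = \<bar>hardy_form b f\<bar>"
proof -
  have "(sqrt t)\<^sup>2 = \<bar>t\<bar>" for t :: real
    by (cases "t \<ge> 0") (simp_all, metis abs_of_neg not_le power2_minus real_sqrt_minus real_sqrt_pow2 less_imp_le neg_0_le_iff_le)
  then show ?thesis unfolding Hdot_norm_def hardy_form_def .
qed

lemma Lp_norm_power: "Lp_norm 4 f ^ 4 = quartic f" "Lp_norm 6 f ^ 6 = sextic f"
proof -
  have "(t powr (1 / real n)) ^ n = t" if "t \<ge> 0" "n > 0" for t :: real and n
    using that by (cases "t = 0") (simp_all add: powr_realpow[symmetric] powr_powr)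
  from this[of "quartic f" 4] this[of "sextic f" 6] show "Lp_norm 4 f ^ 4 = quartic f" "Lp_norm 6 f ^ 6 = sextic f"
    using functionals_nonneg[of f] by (simp_all add: Lp_norm_def quartic_def sextic_def)
qed

lemma virial_eq: "virial b f = \<bar>hardy_form b f\<bar> + sextic f - 3 / 4 * quartic f"
  by (simp add: virial_def Hdot_norm_square Lp_norm_power)

lemma hardy_form_split:
  assumes "f \<in> H1" "potential_integrable b f"
  shows "hardy_form b f = dirichlet f + (LBINT x. b / (norm x)\<^sup>2 * (norm (f x))\<^sup>2)"
  using assms H1_dirichlet_integrable[OF assms(1)]
  by (simp add: hardy_form_def dirichlet_def potential_integrable_def)

lemma hardy_form_0: "hardy_form 0 f = dirichlet f"
  by (simp add: hardy_form_def dirichlet_def)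

lemma energy_eq:
  assumes f: "f \<in> H1" "potential_integrable b f"
  shows "energy b f = hardy_form b f / 2 - quartic f / 4 + sextic f / 6"
proof -
  let ?h = "\<lambda>x. (norm (weak_grad f x))\<^sup>2 + b / (norm x)\<^sup>2 * (norm (f x))\<^sup>2"
  have i: "integrable lborel ?h"
    using assms H1_dirichlet_integrable[OF f(1)] by (simp add: potential_integrable_def)
  have "energy b f = (LBINT x. 1 / 2 * ?h x - 1 / 4 * norm (f x) ^ 4 + 1 / 6 * norm (f x) ^ 6)"
    unfolding energy_def by (intro Bochner_Integration.integral_cong) (auto simp: field_simps)
  also have "\<dots> = 1 / 2 * (LBINT x. ?h x) - 1 / 4 * quartic f + 1 / 6 * sextic f"
    using i H1_quartic(1)[OF f(1)] H1_sextic(1)[OF f(1)]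
    by (simp add: quartic_def sextic_def del: integral_mult_right_zero times_divide_eq_left times_divide_eq_right)
  finally show ?thesis by (simp add: hardy_form_def)
qed

text \<open>A non-integrable function has integral \<open>0\<close>. This happens to the form and to the energy at the same time,
  since each integrand is the sum of an integrable function and a nonzero multiple of the potential term.\<close>

lemma not_potential_integrable:
  assumes f: "f \<in> H1" "\<not> potential_integrable b f"
  shows "energy b f = 0" "hardy_form b f = 0"
proof -
  let ?p = "\<lambda>x. b / (norm x)\<^sup>2 * (norm (f x))\<^sup>2"
  have ni: "\<not> integrable lborel (\<lambda>x. h x + c * ?p x)" if h: "integrable lborel h" and "c \<noteq> 0" for h c
  proof
    assume "integrable lborel (\<lambda>x. h x + c * ?p x)"
    then have "integrable lborel (\<lambda>x. (1 / c) * ((h x + c * ?p x) - h x))"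
      using h by (intro integrable_mult_right Bochner_Integration.integrable_diff)
    then show False using f(2) \<open>c \<noteq> 0\<close> by (simp add: potential_integrable_def)
  qed
  show "hardy_form b f = 0"
    unfolding hardy_form_def using ni[OF H1_dirichlet_integrable[OF f(1)], of 1] by (simp add: not_integrable_integral_eq)
  have "integrable lborel (\<lambda>x. 1 / 2 * (norm (weak_grad f x))\<^sup>2 - 1 / 4 * norm (f x) ^ 4 + 1 / 6 * norm (f x) ^ 6)"
    using H1_dirichlet_integrable[OF f(1)] H1_quartic(1)[OF f(1)] H1_sextic(1)[OF f(1)] by simp
  from ni[OF this, of "1 / 2"]
  have "\<not> integrable lborel (\<lambda>x. 1 / 2 * (norm (weak_grad f x))\<^sup>2 + b / (2 * (norm x)\<^sup>2) * (norm (f x))\<^sup>2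
          - 1 / 4 * norm (f x) ^ 4 + 1 / 6 * norm (f x) ^ 6)"
    by (simp add: algebra_simps)
  then show "energy b f = 0" unfolding energy_def by (rule not_integrable_integral_eq)
qed

lemma potential_integrable_0: "potential_integrable 0 f"
  by (simp add: potential_integrable_def)

text \<open>The target type is left open so that a function and its gradient can be dilated alike.\<close>

definition dilate :: "real \<Rightarrow> real \<Rightarrow> (real^3 \<Rightarrow> 'b::real_vector) \<Rightarrow> real^3 \<Rightarrow> 'b" where
  "dilate \<alpha> \<mu> f x = \<alpha> *\<^sub>R f (\<mu> *\<^sub>R x)"

lemma square_integrable_dilate:
  fixes f :: "real^3 \<Rightarrow> 'b::euclidean_space"
  assumes f: "square_integrable f" and "\<mu> > 0"
  shows "square_integrable (dilate \<alpha> \<mu> f)"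
proof -
  have [measurable]: "f \<in> borel_measurable borel" using f by (simp add: square_integrable_def)
  have "integrable lborel (\<lambda>x. \<alpha>\<^sup>2 * (norm (f (\<mu> *\<^sub>R x)))\<^sup>2)"
    using integrable_affine3[of "\<lambda>x. (norm (f x))\<^sup>2" \<mu> 0] assms by (simp add: square_integrable_def)
  then show ?thesis by (simp add: square_integrable_def dilate_def[abs_def] power_mult_distrib)
qed

lemma H1_dilate:
  assumes f: "f \<in> H1" and \<mu>: "\<mu> > 0"
  shows "dilate \<alpha> \<mu> f \<in> H1" "AE x in lborel. weak_grad (dilate \<alpha> \<mu> f) x = dilate (\<alpha> * \<mu>) \<mu> (weak_grad f) x"
proof -
  note w = H1_weak_grad[OF f]
  have s: "square_integrable (dilate \<alpha> \<mu> f)" "square_integrable (dilate (\<alpha> * \<mu>) \<mu> (weak_grad f))"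
    by (rule square_integrable_dilate[OF w(1) \<mu>], rule square_integrable_dilate[OF w(3) \<mu>])
  have g: "is_weak_gradient (dilate \<alpha> \<mu> f) (dilate (\<alpha> * \<mu>) \<mu> (weak_grad f))"
    unfolding is_weak_gradient_def
  proof (intro conjI ballI allI)
    show "locally_integrable (dilate (\<alpha> * \<mu>) \<mu> (weak_grad f))" by (rule square_integrable_locally_integrable[OF s(2)])
    fix \<phi> i assume \<phi>: "\<phi> \<in> test_functions UNIV"
    let ?\<psi> = "\<lambda>y. \<phi> ((1 / \<mu>) *\<^sub>R y)"
    have t: "?\<psi> \<in> test_functions UNIV" using test_functions_affine[OF \<phi>, of "1 / \<mu>" 0] \<mu> by simp
    have d: "partial_deriv i ?\<psi> y = (1 / \<mu>) * partial_deriv i \<phi> ((1 / \<mu>) *\<^sub>R y)" for y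
      using partial_deriv_affine[of \<phi> i "1 / \<mu>" 0 y] \<phi> smooth_differentiable by (simp add: test_functions_UNIV_iff)
    have "(LBINT x. dilate \<alpha> \<mu> f x * of_real (partial_deriv i \<phi> x))
      = (LBINT x. (\<alpha> * \<mu>) *\<^sub>R (f (0 + \<mu> *\<^sub>R x) * of_real (partial_deriv i ?\<psi> (0 + \<mu> *\<^sub>R x))))"
      unfolding d using \<mu> by (simp add: dilate_def scaleR_conv_of_real[where 'a = complex] mult.assoc)
    also have "\<dots> = (\<alpha> * \<mu>) *\<^sub>R ((LBINT y. f y * of_real (partial_deriv i ?\<psi> y)) /\<^sub>R \<bar>\<mu>\<bar> ^ 3)"
      using \<mu> by (subst integral_scaleR_right, subst integral_affine3[of \<mu> "\<lambda>y. f y * of_real (partial_deriv i ?\<psi> y)"]) auto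
    also have "\<dots> = - ((\<alpha> * \<mu>) *\<^sub>R ((LBINT y. weak_grad f y $ i * of_real (?\<psi> y)) /\<^sub>R \<bar>\<mu>\<bar> ^ 3))"
      using w(2) t by (simp add: is_weak_gradient_def)
    also have "(\<alpha> * \<mu>) *\<^sub>R ((LBINT y. weak_grad f y $ i * of_real (?\<psi> y)) /\<^sub>R \<bar>\<mu>\<bar> ^ 3)
      = (LBINT x. (\<alpha> * \<mu>) *\<^sub>R (weak_grad f (0 + \<mu> *\<^sub>R x) $ i * of_real (?\<psi> (0 + \<mu> *\<^sub>R x))))"
      using \<mu> by (subst integral_scaleR_right, subst integral_affine3[of \<mu> "\<lambda>y. weak_grad f y $ i * of_real (?\<psi> y)"]) auto
    also have "\<dots> = (LBINT x. dilate (\<alpha> * \<mu>) \<mu> (weak_grad f) x $ i * of_real (\<phi> x))"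
      using \<mu> by (simp add: dilate_def)
    finally show "(LBINT x. dilate \<alpha> \<mu> f x * of_real (partial_deriv i \<phi> x))
      = - (LBINT x. dilate (\<alpha> * \<mu>) \<mu> (weak_grad f) x $ i * of_real (\<phi> x))" .
  qed
  show "dilate \<alpha> \<mu> f \<in> H1" "AE x in lborel. weak_grad (dilate \<alpha> \<mu> f) x = dilate (\<alpha> * \<mu>) \<mu> (weak_grad f) x"
    by (rule H1_I[OF s(1) g s(2)])+
qed

lemma integral_dilate:
  fixes F :: "real^3 \<Rightarrow> real"
  assumes "\<mu> > 0" shows "(LBINT x. c * F (\<mu> *\<^sub>R x)) = c / \<mu> ^ 3 * (LBINT x. F x)"
  using integral_affine3[of \<mu> F 0] assms by (simp add: field_simps)

lemma functionals_dilate: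
  assumes "\<mu> > 0"
  shows "mass (dilate \<alpha> \<mu> f) = \<alpha>\<^sup>2 / \<mu> ^ 3 * mass f" "quartic (dilate \<alpha> \<mu> f) = \<alpha> ^ 4 / \<mu> ^ 3 * quartic f"
    "sextic (dilate \<alpha> \<mu> f) = \<alpha> ^ 6 / \<mu> ^ 3 * sextic f"
  unfolding mass_def quartic_def sextic_def
  using integral_dilate[OF assms, of "\<alpha>\<^sup>2" "\<lambda>x. (norm (f x))\<^sup>2"]
    integral_dilate[OF assms, of "\<alpha> ^ 4" "\<lambda>x. norm (f x) ^ 4"] integral_dilate[OF assms, of "\<alpha> ^ 6" "\<lambda>x. norm (f x) ^ 6"]
  by (simp_all add: dilate_def power_mult_distrib flip: power_abs)

lemma hardy_form_dilate:
  assumes f: "f \<in> H1" and \<mu>: "\<mu> > 0"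
  shows "hardy_form b (dilate \<alpha> \<mu> f) = \<alpha>\<^sup>2 / \<mu> * hardy_form b f"
proof -
  have [measurable]: "f \<in> borel_measurable borel" "dilate \<alpha> \<mu> f \<in> borel_measurable borel"
    "weak_grad f \<in> borel_measurable borel" "weak_grad (dilate \<alpha> \<mu> f) \<in> borel_measurable borel"
    using f H1_dilate(1)[OF f \<mu>] by (auto intro: borel_H1 borel_weak_grad)
  let ?F = "\<lambda>x. (norm (weak_grad f x))\<^sup>2 + b / (norm x)\<^sup>2 * (norm (f x))\<^sup>2"
  have "hardy_form b (dilate \<alpha> \<mu> f) = (LBINT x. (\<alpha>\<^sup>2 * \<mu>\<^sup>2) * ?F (\<mu> *\<^sub>R x))"
    unfolding hardy_form_def
  proof (rule integral_cong_AE)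
    show "AE x in lborel. (norm (weak_grad (dilate \<alpha> \<mu> f) x))\<^sup>2 + b / (norm x)\<^sup>2 * (norm (dilate \<alpha> \<mu> f x))\<^sup>2
        = (\<alpha>\<^sup>2 * \<mu>\<^sup>2) * ?F (\<mu> *\<^sub>R x)"
      using H1_dilate(2)[OF f \<mu>, of \<alpha>]
      by eventually_elim (use \<mu> in \<open>simp add: dilate_def power_mult_distrib abs_mult field_simps\<close>)
  qed measurable
  also have "\<dots> = (\<alpha>\<^sup>2 * \<mu>\<^sup>2) / \<mu> ^ 3 * hardy_form b f"
    unfolding hardy_form_def by (rule integral_dilate[OF \<mu>])
  also have "\<dots> = \<alpha>\<^sup>2 / \<mu> * hardy_form b f" using \<mu> by (simp add: field_simps power2_eq_square power3_eq_cube)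
  finally show ?thesis .
qed

lemma potential_integrable_dilate:
  assumes "\<mu> > 0" "potential_integrable b f" shows "potential_integrable b (dilate \<alpha> \<mu> f)"
proof -
  let ?F = "\<lambda>x. b / (norm x)\<^sup>2 * (norm (f x))\<^sup>2"
  have "integrable lborel (\<lambda>x. (\<alpha>\<^sup>2 * \<mu>\<^sup>2) * ?F (0 + \<mu> *\<^sub>R x))"
    using assms by (intro integrable_mult_right integrable_affine3) (auto simp: potential_integrable_def)
  also have "(\<lambda>x. (\<alpha>\<^sup>2 * \<mu>\<^sup>2) * ?F (0 + \<mu> *\<^sub>R x)) = (\<lambda>x. b / (norm x)\<^sup>2 * (norm (dilate \<alpha> \<mu> f x))\<^sup>2)"
    using assms(1) by (auto simp: dilate_def power_mult_distrib field_simps fun_eq_iff)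
  finally show ?thesis by (simp add: potential_integrable_def)
qed

section \<open>Phase modulation\<close>

lemma smooth_trig_coordinate:
  "smooth (\<lambda>x. cos (t * x $ j))" "smooth (\<lambda>x. sin (t * x $ j))"
proof -
  let ?F = "{\<lambda>s. k * cos (t * s) + l * sin (t * s) |k l. True}"
  have d: "\<exists>p'\<in>?F. \<forall>s. (p has_real_derivative p' s) (at s)" if pF: "p \<in> ?F" for p
  proof -
    obtain k l where p: "p = (\<lambda>s. k * cos (t * s) + l * sin (t * s))" using pF by blast
    have "(p has_real_derivative (l * t) * cos (t * s) + (- k * t) * sin (t * s)) (at s)" for s
      unfolding p by (auto intro!: derivative_eq_intros)
    then show ?thesis
      by (intro bexI[of _ "\<lambda>s. (l * t) * cos (t * s) + (- k * t) * sin (t * s)"]) blast+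
  qed
  have z: "(\<lambda>s. 0) \<in> ?F" by (rule CollectI, intro exI[of _ 0]) simp
  have c: "(\<lambda>s. cos (t * s)) \<in> ?F" by (rule CollectI, intro exI[of _ 1] exI[of _ 0]) simp
  have s: "(\<lambda>s. sin (t * s)) \<in> ?F" by (rule CollectI, intro exI[of _ 0] exI[of _ 1]) simp
  show "smooth (\<lambda>x. cos (t * x $ j))" using smooth_coordinate[OF c d z] by simp
  show "smooth (\<lambda>x. sin (t * x $ j))" using smooth_coordinate[OF s d z] by simp
qed

text \<open>A modulation changes neither \<open>|f|\<close> nor any functional of it, but adds to \<open>|grad f|^2\<close> a quadratic
  polynomial in \<open>t\<close> with leading coefficient \<open>|f|^2\<close>.\<close>

definition phase :: "real \<Rightarrow> (real^3 \<Rightarrow> complex) \<Rightarrow> real^3 \<Rightarrow> complex" where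
  "phase t f x = cis (t * x $ 1) * f x"

definition phase_grad :: "real \<Rightarrow> (real^3 \<Rightarrow> complex) \<Rightarrow> (real^3 \<Rightarrow> complex^3) \<Rightarrow> real^3 \<Rightarrow> complex^3" where
  "phase_grad t f g x = (\<chi> j. cis (t * x $ 1) * (g x $ j + (if j = 1 then \<i> * of_real t * f x else 0)))"

lemma norm_phase: "norm (phase t f x) = norm (f x)"
  by (simp add: phase_def norm_mult)

lemma norm_phase_grad:
  "(norm (phase_grad t f g x))\<^sup>2 = (norm (g x))\<^sup>2
     + t * (2 * (Im (g x $ 1) * Re (f x) - Re (g x $ 1) * Im (f x))) + t\<^sup>2 * (norm (f x))\<^sup>2"
proof -
  have "norm (phase_grad t f g x $ j) = norm (g x $ j + (if j = 1 then \<i> * of_real t * f x else 0))" for j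
    by (simp add: phase_grad_def norm_mult)
  moreover have "(norm (w + \<i> * of_real t * z))\<^sup>2
      = (norm w)\<^sup>2 + t * (2 * (Im w * Re z - Re w * Im z)) + t\<^sup>2 * (norm z)\<^sup>2" for w z
    unfolding cmod_power2 by (simp add: power2_eq_square algebra_simps)
  ultimately show ?thesis unfolding norm_square_vec3 sum_3 by simp
qed

lemma borel_cis_coordinate [measurable]: "(\<lambda>x::real^3. cis (t * x $ j)) \<in> borel_measurable borel"
  by (intro borel_measurable_continuous_onI continuous_intros)

text \<open>The weak product rule is obtained by testing with \<open>cos (t x_1) \<phi>\<close> and \<open>sin (t x_1) \<phi>\<close>.\<close>

lemma H1_phase:
  assumes f: "f \<in> H1"
  shows "phase t f \<in> H1" "AE x in lborel. weak_grad (phase t f) x = phase_grad t f (weak_grad f) x"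
proof -
  note w = H1_weak_grad[OF f]
  have [measurable]: "f \<in> borel_measurable borel" "weak_grad f \<in> borel_measurable borel"
    by (rule borel_H1[OF f], rule borel_weak_grad[OF f])
  have lf: "locally_integrable f" by (rule square_integrable_locally_integrable[OF w(1)])
  have lg: "locally_integrable (\<lambda>x. weak_grad f x $ i)" for i
    using w(2) locally_integrable_bounded_linear[OF bounded_linear_complex_nth] by (simp add: is_weak_gradient_def)
  have s: "square_integrable (phase t f)"
    unfolding square_integrable_def norm_phase
    using w(1) by (simp add: square_integrable_def phase_def[abs_def])
  have m: "phase_grad t f (weak_grad f) \<in> borel_measurable borel"
  proof -
    have "(\<chi> j. c j) = (\<Sum>j\<in>UNIV. axis j (c j))" for c :: "3 \<Rightarrow> complex"
      by (simp add: vec_eq_iff sum_3 forall_3 axis_def)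
    then have "phase_grad t f (weak_grad f) = (\<lambda>x. \<Sum>j\<in>UNIV. axis j (cis (t * x $ 1) * (weak_grad f x $ j + (if j = 1 then \<i> * of_real t * f x else 0))))"
      by (simp add: phase_grad_def[abs_def])
    moreover have ax: "(\<lambda>z::complex. axis j z :: complex^3) \<in> borel_measurable borel" for j
    proof -
      have "linear (\<lambda>z::complex. axis j z :: complex^3)"
        by (intro linearI) (auto simp: vec_eq_iff axis_def)
      then show ?thesis
        by (intro borel_measurable_continuous_onI linear_continuous_on) (simp add: linear_conv_bounded_linear)
    qed
    moreover have cm: "(\<lambda>x. cis (t * x $ 1) * (weak_grad f x $ j + (if j = 1 then \<i> * of_real t * f x else 0))) \<in> borel_measurable borel" for j
    proof -
      have [measurable]: "(\<lambda>x. weak_grad f x $ j) \<in> borel_measurable borel"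
        using lg[of j] by (simp add: locally_integrable_def)
      show ?thesis by measurable
    qed
    ultimately show ?thesis using measurable_compose[OF cm ax] by simp
  qed
  have sg: "square_integrable (phase_grad t f (weak_grad f))"
    unfolding square_integrable_def
  proof
    show "phase_grad t f (weak_grad f) \<in> borel_measurable lborel" using m by simp
    show "integrable lborel (\<lambda>x. (norm (phase_grad t f (weak_grad f) x))\<^sup>2)"
    proof (rule Bochner_Integration.integrable_bound)
      show "integrable lborel (\<lambda>x. 2 * (norm (weak_grad f x))\<^sup>2 + 2 * t\<^sup>2 * (norm (f x))\<^sup>2)"
        using H1_mass_integrable[OF f] H1_dirichlet_integrable[OF f] by simp
      have "(norm (phase_grad t f (weak_grad f) x))\<^sup>2 \<le> 2 * (norm (weak_grad f x))\<^sup>2 + 2 * t\<^sup>2 * (norm (f x))\<^sup>2" for x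
      proof -
        let ?a = "Re (weak_grad f x $ 1)" and ?b = "Im (weak_grad f x $ 1)" and ?c = "Re (f x)" and ?d = "Im (f x)"
        have "t * (2 * (?b * ?c - ?a * ?d)) \<le> ?a\<^sup>2 + ?b\<^sup>2 + t\<^sup>2 * (?c\<^sup>2 + ?d\<^sup>2)"
          using zero_le_power2[of "?b - t * ?c"] zero_le_power2[of "?a + t * ?d"]
          by (simp add: power2_eq_square algebra_simps)
        also have "\<dots> \<le> (norm (weak_grad f x))\<^sup>2 + t\<^sup>2 * (norm (f x))\<^sup>2"
          unfolding norm_square_vec3 sum_3 by (simp add: cmod_power2)
        finally show ?thesis unfolding norm_phase_grad by simp
      qed
      then show "AE x in lborel. norm ((norm (phase_grad t f (weak_grad f) x))\<^sup>2)
          \<le> norm (2 * (norm (weak_grad f x))\<^sup>2 + 2 * t\<^sup>2 * (norm (f x))\<^sup>2)" by simp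
    qed (use m in measurable)
  qed
  have g: "is_weak_gradient (phase t f) (phase_grad t f (weak_grad f))"
    unfolding is_weak_gradient_def
  proof (intro conjI ballI allI)
    show "locally_integrable (phase_grad t f (weak_grad f))" by (rule square_integrable_locally_integrable[OF sg])
    fix \<phi> j assume \<phi>: "\<phi> \<in> test_functions UNIV"
    let ?A = "\<lambda>x. cos (t * x $ 1) * \<phi> x" and ?B = "\<lambda>x. sin (t * x $ 1) * \<phi> x"
    have A: "?A \<in> test_functions UNIV" and B: "?B \<in> test_functions UNIV"
      by (rule test_functions_mult[OF smooth_trig_coordinate(1) \<phi>], rule test_functions_mult[OF smooth_trig_coordinate(2) \<phi>])
    have dc: "\<forall>s. ((\<lambda>s. cos (t * s)) has_real_derivative - t * sin (t * s)) (at s)"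
      and ds: "\<forall>s. ((\<lambda>s. sin (t * s)) has_real_derivative t * cos (t * s)) (at s)"
      by (auto intro!: derivative_eq_intros)
    have sm: "smooth \<phi>" using \<phi> by (simp add: test_functions_UNIV_iff)
    have dA: "partial_deriv j ?A x = cos (t * x $ 1) * partial_deriv j \<phi> x - (if j = 1 then t * sin (t * x $ 1) * \<phi> x else 0)" for x
      by (subst partial_deriv_mult[OF smooth_differentiable[OF smooth_trig_coordinate(1)] smooth_differentiable[OF sm]])
         (simp add: partial_deriv_coordinate[OF dc])
    have dB: "partial_deriv j ?B x = sin (t * x $ 1) * partial_deriv j \<phi> x + (if j = 1 then t * cos (t * x $ 1) * \<phi> x else 0)" for x
      by (subst partial_deriv_mult[OF smooth_differentiable[OF smooth_trig_coordinate(2)] smooth_differentiable[OF sm]])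
         (simp add: partial_deriv_coordinate[OF ds])
    let ?k = "if j = 1 then \<i> * of_real t else 0 :: complex"
    note iA = integrable_complex_test[OF lf test_functions_partial_deriv[OF A], of j]
      and iB = integrable_complex_test[OF lf test_functions_partial_deriv[OF B], of j]
      and i0 = integrable_complex_test[OF lf A] integrable_complex_test[OF lf B]
      and ig = integrable_complex_test[OF lg A, of j] integrable_complex_test[OF lg B, of j]
    let ?r = "\<lambda>\<psi> x. complex_of_real (\<psi> x)"
    have "(LBINT x. phase t f x * of_real (partial_deriv j \<phi> x))
      = (LBINT x. (f x * ?r (partial_deriv j ?A) x + \<i> * (f x * ?r (partial_deriv j ?B) x))
          - ?k * (f x * ?r ?A x + \<i> * (f x * ?r ?B x)))"
      unfolding dA dB by (intro Bochner_Integration.integral_cong) (auto simp: phase_def cis.code complex_eq_iff algebra_simps)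
    also have "\<dots> = ((LBINT x. f x * ?r (partial_deriv j ?A) x) + \<i> * (LBINT x. f x * ?r (partial_deriv j ?B) x))
          - ?k * ((LBINT x. f x * ?r ?A x) + \<i> * (LBINT x. f x * ?r ?B x))"
      using iA iB i0 by (simp del: of_real_mult)
    also have "\<dots> = - ((LBINT x. weak_grad f x $ j * ?r ?A x) + \<i> * (LBINT x. weak_grad f x $ j * ?r ?B x)
          + ?k * ((LBINT x. f x * ?r ?A x) + \<i> * (LBINT x. f x * ?r ?B x)))"
      using w(2) A B by (simp add: is_weak_gradient_def del: of_real_mult)
    also have "\<dots> = - (LBINT x. (weak_grad f x $ j * ?r ?A x + \<i> * (weak_grad f x $ j * ?r ?B x))
          + ?k * (f x * ?r ?A x + \<i> * (f x * ?r ?B x)))"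
      using ig i0 by (simp del: of_real_mult)
    also have "\<dots> = - (LBINT x. phase_grad t f (weak_grad f) x $ j * of_real (\<phi> x))"
      by (intro arg_cong[where f = uminus] Bochner_Integration.integral_cong)
        (auto simp: phase_grad_def cis.code complex_eq_iff algebra_simps)
    finally show "(LBINT x. phase t f x * of_real (partial_deriv j \<phi> x))
      = - (LBINT x. phase_grad t f (weak_grad f) x $ j * of_real (\<phi> x))" .
  qed
  show "phase t f \<in> H1" "AE x in lborel. weak_grad (phase t f) x = phase_grad t f (weak_grad f) x"
    by (rule H1_I[OF s g sg])+
qed

lemma hardy_form_phase:
  assumes f: "f \<in> H1" "potential_integrable b f"
  obtains J where "\<And>t. hardy_form b (phase t f) = hardy_form b f + t * J + t\<^sup>2 * mass f"
proof -
  have [measurable]: "f \<in> borel_measurable borel" "weak_grad f \<in> borel_measurable borel"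
    by (rule borel_H1[OF f(1)], rule borel_weak_grad[OF f(1)])
  have [measurable]: "Re \<in> borel_measurable borel" "Im \<in> borel_measurable borel"
    by (intro borel_measurable_continuous_onI linear_continuous_on bounded_linear_Re bounded_linear_Im)+
  have [measurable]: "(\<lambda>x. weak_grad f x $ 1) \<in> borel_measurable borel"
    using square_integrable_bounded_linear[OF bounded_linear_complex_nth H1_weak_grad(3)[OF f(1)]]
    by (simp add: square_integrable_def)
  let ?j = "\<lambda>x. 2 * (Im (weak_grad f x $ 1) * Re (f x) - Re (weak_grad f x $ 1) * Im (f x))"
  let ?p = "\<lambda>x. b / (norm x)\<^sup>2 * (norm (f x))\<^sup>2"
  note i2 = H1_mass_integrable[OF f(1)] and ig = H1_dirichlet_integrable[OF f(1)]
  have ip: "integrable lborel ?p" using f(2) by (simp add: potential_integrable_def)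
  have ij: "integrable lborel ?j"
  proof (rule Bochner_Integration.integrable_bound)
    show "integrable lborel (\<lambda>x. (norm (weak_grad f x))\<^sup>2 + (norm (f x))\<^sup>2)" using i2 ig by simp
    have "\<bar>?j x\<bar> \<le> (norm (weak_grad f x))\<^sup>2 + (norm (f x))\<^sup>2" for x
    proof -
      let ?a = "Re (weak_grad f x $ 1)" and ?b = "Im (weak_grad f x $ 1)" and ?c = "Re (f x)" and ?d = "Im (f x)"
      have "\<bar>?j x\<bar> \<le> ?a\<^sup>2 + ?b\<^sup>2 + (?c\<^sup>2 + ?d\<^sup>2)"
        using zero_le_power2[of "?b - ?c"] zero_le_power2[of "?a + ?d"] zero_le_power2[of "?b + ?c"] zero_le_power2[of "?a - ?d"]
        by (simp add: power2_eq_square abs_le_iff algebra_simps)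
      also have "\<dots> \<le> (norm (weak_grad f x))\<^sup>2 + (norm (f x))\<^sup>2"
        unfolding norm_square_vec3 sum_3 by (simp add: cmod_power2)
      finally show ?thesis .
    qed
    then show "AE x in lborel. norm (?j x) \<le> norm ((norm (weak_grad f x))\<^sup>2 + (norm (f x))\<^sup>2)" by simp
  qed measurable
  have "hardy_form b (phase t f) = hardy_form b f + t * (LBINT x. ?j x) + t\<^sup>2 * mass f" for t
  proof -
    have [measurable]: "weak_grad (phase t f) \<in> borel_measurable borel"
      by (rule borel_weak_grad[OF H1_phase(1)[OF f(1)]])
    have "hardy_form b (phase t f) = (LBINT x. ((norm (weak_grad f x))\<^sup>2 + ?p x) + t * ?j x + t\<^sup>2 * (norm (f x))\<^sup>2)"
      unfolding hardy_form_def
    proof (rule integral_cong_AE)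
      show "AE x in lborel. (norm (weak_grad (phase t f) x))\<^sup>2 + b / (norm x)\<^sup>2 * (norm (phase t f x))\<^sup>2
          = ((norm (weak_grad f x))\<^sup>2 + ?p x) + t * ?j x + t\<^sup>2 * (norm (f x))\<^sup>2"
        using H1_phase(2)[OF f(1), of t] by eventually_elim (simp add: norm_phase norm_phase_grad)
    qed (simp_all add: norm_phase)
    also have "\<dots> = hardy_form b f + t * (LBINT x. ?j x) + t\<^sup>2 * mass f"
      unfolding hardy_form_def mass_def using ip ij i2 ig
      by (simp del: integral_mult_right_zero add: Bochner_Integration.integral_add integral_mult_right)
    finally show ?thesis .
  qed
  then show ?thesis by (rule that)
qed

section \<open>Comparison of the minimal energies\<close>

text \<open>The case of a vanishing quadratic form: the virial is zero at \<open>\<mu>^3 = 3 D / (4 B)\<close>.\<close>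

lemma virial_root_without_gradient:
  assumes "0 < B" "0 < (D::real)"
  obtains \<mu> where "0 < \<mu>" "B * \<mu> ^ 6 = 3 / 4 * D * \<mu> ^ 3" "B * \<mu> ^ 6 / 6 - D * \<mu> ^ 3 / 4 \<le> 0"
proof -
  define \<mu> where "\<mu> = root 3 (3 * D / (4 * B))"
  have c: "\<mu> ^ 3 = 3 * D / (4 * B)" and p: "\<mu> > 0" using assms by (auto simp: \<mu>_def)
  have "B * \<mu> ^ 6 = B * (\<mu> ^ 3) * \<mu> ^ 3" by (simp add: power_add[symmetric])
  also have "\<dots> = 3 / 4 * D * \<mu> ^ 3" unfolding c using assms by simp
  finally have e: "B * \<mu> ^ 6 = 3 / 4 * D * \<mu> ^ 3" .
  moreover have "0 \<le> D * \<mu> ^ 3" using assms p by simp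
  ultimately show ?thesis using that[OF p e] by simp
qed

text \<open>Here \<open>A\<close>, \<open>B\<close> and \<open>D\<close> stand for the quadratic, the sextic and the quartic functional, and \<open>\<mu>\<close> for
  the parameter of a mass-preserving dilation. The energy has the derivative \<open>\<mu> W \<mu>\<close> with
  \<open>W \<mu> = A + B \<mu>^4 - 3 / 4 * D \<mu>\<close>, and \<open>W\<close> is convex, so it stays nonpositive between \<open>1\<close>, where it is
  nonpositive, and a zero to the right.\<close>

lemma virial_root:
  fixes A B D :: real
  assumes A: "0 \<le> A" and B: "0 < B" and V: "A + B - 3 / 4 * D \<le> 0"
  obtains \<mu> where "1 \<le> \<mu>" "A * \<mu>\<^sup>2 + B * \<mu> ^ 6 = 3 / 4 * D * \<mu> ^ 3"
    "A * \<mu>\<^sup>2 / 2 + B * \<mu> ^ 6 / 6 - D * \<mu> ^ 3 / 4 \<le> A / 2 + B / 6 - D / 4"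
proof -
  let ?W = "\<lambda>\<mu>. A + B * \<mu> ^ 4 - 3 / 4 * D * \<mu>"
  \<comment> \<open>At \<open>\<Lambda>\<close> the sextic term alone dominates the quartic one.\<close>
  define \<Lambda> where "\<Lambda> = max 1 (3 * D / (4 * B))"
  have \<Lambda>: "\<Lambda> \<ge> 1" "B * \<Lambda> \<ge> 3 / 4 * D" using B by (auto simp: \<Lambda>_def field_simps max_def)
  have "B * \<Lambda> * \<Lambda> ^ 3 \<ge> B * \<Lambda> * \<Lambda>"
    using \<Lambda> B self_le_power[of \<Lambda> 3] by (intro mult_left_mono) auto
  moreover have "B * \<Lambda> * \<Lambda> \<ge> 3 / 4 * D * \<Lambda>" using \<Lambda> by (intro mult_right_mono) auto
  ultimately have "?W \<Lambda> \<ge> 0" using A by (simp add: power4_eq_xxxx power3_eq_cube mult.assoc)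
  moreover have "continuous_on {1..\<Lambda>} ?W" by (intro continuous_intros)
  moreover have "?W 1 \<le> 0" using V by simp
  ultimately obtain \<mu> where \<mu>: "1 \<le> \<mu>" "\<mu> \<le> \<Lambda>" "?W \<mu> = 0"
    using IVT'[of ?W 1 0 \<Lambda>] \<Lambda>(1) by blast
  have le0: "?W \<xi> \<le> 0" if "1 \<le> \<xi>" "\<xi> \<le> \<mu>" for \<xi>
  proof (cases "\<mu> = 1")
    case True
    then show ?thesis using that \<mu>(3) by simp
  next
    case False
    then have mu: "\<mu> > 1" using \<mu>(1) by simp
    have D: "3 / 4 * D = (A + B * \<mu> ^ 4) / \<mu>" using \<mu>(3) mu by (simp add: field_simps)
    have "(\<mu> - 1) * (A / \<mu> - B * (1 + \<mu> + \<mu>\<^sup>2)) = A + B - 3 / 4 * D"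
      unfolding D using mu by (simp add: field_simps power2_eq_square power4_eq_xxxx)
    then have "A / \<mu> - B * (1 + \<mu> + \<mu>\<^sup>2) \<le> 0" using V mu by (smt (verit) mult_pos_pos)
    moreover have "B * (1 + \<mu> + \<mu>\<^sup>2) \<le> B * (\<xi> * (\<xi>\<^sup>2 + \<xi> * \<mu> + \<mu>\<^sup>2))"
    proof (intro mult_left_mono)
      have "1 \<le> \<xi>\<^sup>2" "\<mu> \<le> \<xi> * \<mu>" using that mu by auto
      then have "1 + \<mu> + \<mu>\<^sup>2 \<le> \<xi>\<^sup>2 + \<xi> * \<mu> + \<mu>\<^sup>2" by simp
      also have "\<dots> \<le> \<xi> * (\<xi>\<^sup>2 + \<xi> * \<mu> + \<mu>\<^sup>2)"
        using that mu mult_right_mono[of 1 \<xi> "\<xi>\<^sup>2 + \<xi> * \<mu> + \<mu>\<^sup>2"] by simp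
      finally show "1 + \<mu> + \<mu>\<^sup>2 \<le> \<xi> * (\<xi>\<^sup>2 + \<xi> * \<mu> + \<mu>\<^sup>2)" .
    qed (use B in auto)
    ultimately have "A / \<mu> - B * (\<xi> * (\<xi>\<^sup>2 + \<xi> * \<mu> + \<mu>\<^sup>2)) \<le> 0" by linarith
    then have "(\<mu> - \<xi>) * (A / \<mu> - B * (\<xi> * (\<xi>\<^sup>2 + \<xi> * \<mu> + \<mu>\<^sup>2))) \<le> 0"
      using that by (simp add: mult_nonneg_nonpos)
    also have "(\<mu> - \<xi>) * (A / \<mu> - B * (\<xi> * (\<xi>\<^sup>2 + \<xi> * \<mu> + \<mu>\<^sup>2))) = ?W \<xi>"
      unfolding D using mu by (simp add: field_simps power2_eq_square power4_eq_xxxx)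
    finally show ?thesis .
  qed
  let ?E = "\<lambda>\<mu>. A * \<mu>\<^sup>2 / 2 + B * \<mu> ^ 6 / 6 - D * \<mu> ^ 3 / 4"
  have "?E \<mu> \<le> ?E 1"
  proof (rule DERIV_nonpos_imp_nonincreasing[OF \<mu>(1)])
    fix \<xi> assume \<xi>: "1 \<le> \<xi>" "\<xi> \<le> \<mu>"
    have "(?E has_real_derivative \<xi> * ?W \<xi>) (at \<xi>)"
      by (auto intro!: derivative_eq_intros simp: eval_nat_numeral algebra_simps)
    moreover have "\<xi> * ?W \<xi> \<le> 0" using le0[OF \<xi>] \<xi> by (simp add: mult_nonneg_nonpos)
    ultimately show "\<exists>y. (?E has_real_derivative y) (at \<xi>) \<and> y \<le> 0" by blast
  qed
  moreover have "A * \<mu>\<^sup>2 + B * \<mu> ^ 6 = 3 / 4 * D * \<mu> ^ 3"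
  proof -
    have "\<mu>\<^sup>2 * ?W \<mu> = 0" using \<mu>(3) by simp
    then show ?thesis by (simp add: eval_nat_numeral algebra_simps)
  qed
  ultimately show ?thesis using that[OF \<mu>(1)] by simp
qed

lemma min_energy_le:
  assumes "f \<in> H1" "virial (min a 0) f = 0"
  shows "min_energy a (mass f) \<le> ereal (energy (min a 0) f)"
  unfolding min_energy_def using assms by (intro INF_lower) simp

text \<open>The amplitude is \<open>\<mu> powr (3 / 2)\<close>.\<close>

definition mass_dilate :: "real \<Rightarrow> (real^3 \<Rightarrow> complex) \<Rightarrow> real^3 \<Rightarrow> complex" where
  "mass_dilate \<mu> = dilate (sqrt (\<mu> ^ 3)) \<mu>"

lemma mass_dilate:
  assumes f: "f \<in> H1" and \<mu>: "\<mu> > 0"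
  shows "mass_dilate \<mu> f \<in> H1" "mass (mass_dilate \<mu> f) = mass f" "quartic (mass_dilate \<mu> f) = \<mu> ^ 3 * quartic f"
    "sextic (mass_dilate \<mu> f) = \<mu> ^ 6 * sextic f" "hardy_form b (mass_dilate \<mu> f) = \<mu>\<^sup>2 * hardy_form b f"
    "potential_integrable b f \<Longrightarrow> potential_integrable b (mass_dilate \<mu> f)"
proof -
  have s: "(sqrt (\<mu> ^ 3))\<^sup>2 = \<mu> ^ 3" using \<mu> by simp
  have s4: "(sqrt (\<mu> ^ 3)) ^ 4 = \<mu> ^ 6"
    using arg_cong[OF s, of "\<lambda>z. z\<^sup>2"] by (simp flip: power_mult)
  have s6: "(sqrt (\<mu> ^ 3)) ^ 6 = \<mu> ^ 9"
    using arg_cong[OF s, of "\<lambda>z. z ^ 3"] by (simp flip: power_mult)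
  show "mass_dilate \<mu> f \<in> H1" unfolding mass_dilate_def by (rule H1_dilate(1)[OF f \<mu>])
  show "mass (mass_dilate \<mu> f) = mass f" "quartic (mass_dilate \<mu> f) = \<mu> ^ 3 * quartic f"
    "sextic (mass_dilate \<mu> f) = \<mu> ^ 6 * sextic f" "hardy_form b (mass_dilate \<mu> f) = \<mu>\<^sup>2 * hardy_form b f"
    unfolding mass_dilate_def functionals_dilate[OF \<mu>] hardy_form_dilate[OF f \<mu>] s s4 s6
    using \<mu> by (auto simp: field_simps eval_nat_numeral)
  show "potential_integrable b f \<Longrightarrow> potential_integrable b (mass_dilate \<mu> f)"
    unfolding mass_dilate_def by (rule potential_integrable_dilate[OF \<mu>])
qed

text \<open>Whether or not the potential energy of the dilated function is integrable, its energy is nonpositive: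
  in one case the form contributes nothing, in the other the energy is \<open>0\<close>.\<close>

lemma min_energy_nonpos_if_hardy_form_0:
  assumes f: "f \<in> H1" "0 < mass f" and h: "hardy_form (min a 0) f = 0"
  shows "min_energy a (mass f) \<le> 0"
proof -
  note pos = functionals_pos[OF f]
  obtain \<mu> where \<mu>: "0 < \<mu>" "sextic f * \<mu> ^ 6 = 3 / 4 * quartic f * \<mu> ^ 3"
    "sextic f * \<mu> ^ 6 / 6 - quartic f * \<mu> ^ 3 / 4 \<le> 0"
    using virial_root_without_gradient[OF pos(2) pos(1)] by metis
  note d = mass_dilate[OF f(1) \<mu>(1)]
  have "virial (min a 0) (mass_dilate \<mu> f) = 0"
    using \<mu>(2) unfolding virial_eq d h by (simp add: algebra_simps)
  then have "min_energy a (mass f) \<le> ereal (energy (min a 0) (mass_dilate \<mu> f))"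
    using min_energy_le[OF d(1)] d(2) by simp
  moreover have "energy (min a 0) (mass_dilate \<mu> f) \<le> 0"
  proof (cases "potential_integrable (min a 0) (mass_dilate \<mu> f)")
    case True
    then show ?thesis using \<mu>(3) unfolding energy_eq[OF d(1) True] d h by (simp add: algebra_simps)
  qed (simp add: not_potential_integrable[OF d(1)])
  ultimately show ?thesis by (metis ereal_less_eq(3) order_trans zero_ereal_def)
qed

text \<open>The form of \<open>phase t f\<close> is a quadratic polynomial in \<open>t\<close> with positive leading coefficient, the mass, and with
  negative value at \<open>t = 0\<close>. At a root of it the previous lemma applies.\<close>

lemma min_energy_nonpos_if_hardy_form_neg:
  assumes f: "f \<in> H1" "0 < mass f" "potential_integrable (min a 0) f" and h: "hardy_form (min a 0) f < 0"
  shows "min_energy a (mass f) \<le> 0"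
proof -
  obtain J where J: "\<And>t. hardy_form (min a 0) (phase t f) = hardy_form (min a 0) f + t * J + t\<^sup>2 * mass f"
    using hardy_form_phase[OF f(1,3)] by blast
  define \<Delta> where "\<Delta> = J\<^sup>2 - 4 * mass f * hardy_form (min a 0) f"
  have "mass f * hardy_form (min a 0) f \<le> 0" using f(2) h by (simp add: mult_nonneg_nonpos)
  then have \<Delta>: "\<Delta> \<ge> 0" unfolding \<Delta>_def using zero_le_power2[of J] by linarith
  \<comment> \<open>The larger root of the quadratic polynomial with discriminant \<open>\<Delta>\<close>.\<close>
  define t where "t = (sqrt \<Delta> - J) / (2 * mass f)"
  have "2 * mass f * t + J = sqrt \<Delta>" using f(2) by (simp add: t_def)
  then have "(2 * mass f * t + J)\<^sup>2 = \<Delta>" using \<Delta> by simp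
  then have "4 * mass f * (hardy_form (min a 0) f + t * J + t\<^sup>2 * mass f) = 0"
    unfolding \<Delta>_def by (simp add: power2_eq_square algebra_simps)
  then have "hardy_form (min a 0) (phase t f) = 0" using f(2) J by simp
  moreover have "mass (phase t f) = mass f" by (simp add: mass_def norm_phase)
  ultimately show ?thesis
    using min_energy_nonpos_if_hardy_form_0[OF H1_phase(1)[OF f(1)], of t a] f(2) by simp
qed

lemma min_energy_le_if_virial_nonpos:
  assumes f: "f \<in> H1" "0 < mass f" "potential_integrable (min a 0) f" and h: "0 \<le> hardy_form (min a 0) f"
    and V: "virial (min a 0) f \<le> 0"
  shows "min_energy a (mass f) \<le> ereal (energy (min a 0) f)"
proof -
  have V': "hardy_form (min a 0) f + sextic f - 3 / 4 * quartic f \<le> 0" using V h by (simp add: virial_eq)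
  obtain \<mu> where \<mu>: "1 \<le> \<mu>" "hardy_form (min a 0) f * \<mu>\<^sup>2 + sextic f * \<mu> ^ 6 = 3 / 4 * quartic f * \<mu> ^ 3"
    "hardy_form (min a 0) f * \<mu>\<^sup>2 / 2 + sextic f * \<mu> ^ 6 / 6 - quartic f * \<mu> ^ 3 / 4
       \<le> hardy_form (min a 0) f / 2 + sextic f / 6 - quartic f / 4"
    using virial_root[OF h functionals_pos(2)[OF f(1,2)] V'] by metis
  have \<mu>0: "\<mu> > 0" using \<mu>(1) by simp
  note d = mass_dilate[OF f(1) \<mu>0]
  have "virial (min a 0) (mass_dilate \<mu> f) = 0"
    using \<mu>(2) h unfolding virial_eq d by (simp add: abs_mult algebra_simps)
  then have "min_energy a (mass f) \<le> ereal (energy (min a 0) (mass_dilate \<mu> f))"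
    using min_energy_le[OF d(1)] d(2) by simp
  also have "energy (min a 0) (mass_dilate \<mu> f) \<le> energy (min a 0) f"
    using \<mu>(3) unfolding energy_eq[OF f(1,3)] energy_eq[OF d(1) d(6)[OF f(3)]] d by (simp add: algebra_simps)
  finally show ?thesis by simp
qed

text \<open>Positivity of the minimal energy excludes the competitors for which the potential energy is not
  integrable or the form is negative. For all others, lowering the parameter from \<open>0\<close> to \<open>min a 0\<close> lowers
  both the virial and the energy.\<close>

lemma min_energy_le_min_energy_0:
  assumes m: "0 < m" and pos: "0 < min_energy a m"
  shows "min_energy a m \<le> min_energy 0 m"
  unfolding min_energy_def[of 0]
proof (rule INF_greatest)
  fix f assume "f \<in> {f \<in> H1. mass f = m \<and> virial (min 0 0) f = 0}"
  then have f: "f \<in> H1" "mass f = m" "virial 0 f = 0" by auto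
  let ?b = "min a 0"
  have fm: "0 < mass f" using f m by simp
  have p: "potential_integrable ?b f"
  proof (rule ccontr)
    assume "\<not> potential_integrable ?b f"
    then have "hardy_form ?b f = 0" using not_potential_integrable[OF f(1)] by blast
    then show False using min_energy_nonpos_if_hardy_form_0[OF f(1) fm] f(2) pos by (simp add: leD)
  qed
  have h: "0 \<le> hardy_form ?b f"
    using min_energy_nonpos_if_hardy_form_neg[OF f(1) fm p] f(2) pos by (meson leD not_le)
  have "(LBINT x. ?b / (norm x)\<^sup>2 * (norm (f x))\<^sup>2) \<le> 0"
  proof -
    have "0 \<le> (LBINT x. - (?b / (norm x)\<^sup>2 * (norm (f x))\<^sup>2))"
      by (intro Bochner_Integration.integral_nonneg) (simp add: mult_nonpos_nonneg divide_nonpos_nonneg)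
    then show ?thesis by simp
  qed
  then have le: "hardy_form ?b f \<le> hardy_form 0 f"
    unfolding hardy_form_split[OF f(1) p] hardy_form_0 by simp
  have "virial ?b f \<le> 0" using f(3) le h unfolding virial_eq by simp
  then have "min_energy a m \<le> ereal (energy ?b f)"
    using min_energy_le_if_virial_nonpos[OF f(1) fm p h] f(2) by simp
  also have "energy ?b f \<le> energy 0 f"
    using le unfolding energy_eq[OF f(1) p] energy_eq[OF f(1) potential_integrable_0] by simp
  finally show "min_energy a m \<le> ereal (energy (min 0 0) f)" by simp
qed

section \<open>The sharp interpolation inequality\<close>

text \<open>The fourth power clears all fractional exponents, so the sharp inequality becomes polynomial in the
  functionals and can be differentiated without excluding zeros.\<close>

lemma GNH_bound_power4:
  assumes "f \<in> H1"
  shows "0 \<le> GNH_bound 0 f" "GNH_bound 0 f ^ 4 = (mass f)\<^sup>2 * dirichlet f ^ 3 * sextic f"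
proof -
  note nn = functionals_nonneg[of f]
  have 2: "Lp_norm 2 f = mass f powr (1 / 2)" by (simp add: Lp_norm_def mass_def)
  have 6: "Lp_norm 6 f = sextic f powr (1 / 6)" by (simp add: Lp_norm_def sextic_def)
  have H: "Hdot_norm 0 f = dirichlet f powr (1 / 2)"
    using nn(4) by (simp add: Hdot_norm_def dirichlet_def powr_half_sqrt)
  have p: "(t powr r) ^ 4 = t powr (4 * r)" if "0 \<le> t" for t r :: real
    using that by (cases "t = 0") (simp_all add: powr_powr mult.commute flip: powr_realpow)
  have n: "t powr (real n) = t ^ n" if "0 \<le> t" "n > 0" for t :: real and n
    using that by (cases "t = 0") (simp_all add: powr_realpow)
  show "0 \<le> GNH_bound 0 f" by (simp add: GNH_bound_def 2 6 H)
  show "GNH_bound 0 f ^ 4 = (mass f)\<^sup>2 * dirichlet f ^ 3 * sextic f"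
    using n[of "mass f" 2] n[of "dirichlet f" 3] n[of "sextic f" 1] nn
    by (simp add: GNH_bound_def 2 6 H power_mult_distrib p powr_powr)
qed

text \<open>The set of admissible constants is nonempty by the Sobolev inequality: interpolation bounds the square of the
  quartic functional by mass times sextic functional, and in the square of that bound one of the two
  sextic factors is traded for the gradient.\<close>

lemma sharp_const_0:
  shows "0 \<le> sharp_const 0" and "f \<in> H1 \<Longrightarrow> quartic f \<le> sharp_const 0 * GNH_bound 0 f"
proof -
  let ?S = "{C. 0 \<le> C \<and> (\<forall>f\<in>H1. Lp_norm 4 f ^ 4 \<le> C * GNH_bound 0 f)}"
  have "32768 \<in> ?S"
  proof (intro CollectI conjI ballI)
    fix f assume f: "f \<in> H1"
    note nn = functionals_nonneg[of f]
    have "quartic f ^ 4 = ((quartic f)\<^sup>2)\<^sup>2" by (simp flip: power_mult)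
    also have "\<dots> \<le> (mass f * sextic f)\<^sup>2" by (intro power_mono H1_quartic(2)[OF f]) simp
    also have "\<dots> = (mass f)\<^sup>2 * sextic f * sextic f" by (simp add: power2_eq_square)
    also have "\<dots> \<le> (mass f)\<^sup>2 * sextic f * (32768 * dirichlet f ^ 3)"
      using nn by (intro mult_left_mono H1_sextic(2)[OF f]) simp
    also have "\<dots> = 32768 * GNH_bound 0 f ^ 4" unfolding GNH_bound_power4(2)[OF f] by simp
    also have "\<dots> \<le> (32768 * GNH_bound 0 f) ^ 4" by (simp add: power_mult_distrib)
    finally have "quartic f \<le> 32768 * GNH_bound 0 f"
      using power_mono_iff[of "quartic f" "32768 * GNH_bound 0 f" 4] GNH_bound_power4(1)[OF f] nn(1) by simp
    then show "Lp_norm 4 f ^ 4 \<le> 32768 * GNH_bound 0 f" unfolding Lp_norm_power .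
  qed simp
  then have ne: "?S \<noteq> {}" by blast
  show "0 \<le> sharp_const 0" unfolding sharp_const_def by (rule cInf_greatest[OF ne]) simp
  show "quartic f \<le> sharp_const 0 * GNH_bound 0 f" if f: "f \<in> H1"
  proof (cases "GNH_bound 0 f = 0")
    case True
    then show ?thesis using \<open>32768 \<in> ?S\<close> f by (auto simp: Lp_norm_power)
  next
    case False
    then have pos: "0 < GNH_bound 0 f" using GNH_bound_power4(1)[OF f] by simp
    have "quartic f / GNH_bound 0 f \<le> sharp_const 0"
      unfolding sharp_const_def using f pos by (intro cInf_greatest[OF ne]) (auto simp: field_simps Lp_norm_power)
    then show ?thesis using pos by (simp add: field_simps)
  qed
qed

lemma sharp_inequality_power4:
  assumes f: "f \<in> H1"
  shows "quartic f ^ 4 \<le> sharp_const 0 ^ 4 * ((mass f)\<^sup>2 * dirichlet f ^ 3 * sextic f)"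
proof -
  have "quartic f ^ 4 \<le> (sharp_const 0 * GNH_bound 0 f) ^ 4"
    using functionals_nonneg(1) sharp_const_0(2)[OF f] by (intro power_mono) auto
  then show ?thesis by (simp add: power_mult_distrib GNH_bound_power4[OF f])
qed

section \<open>The Euler--Lagrange equation of an optimizer\<close>

lemma H1_add_test:
  assumes f: "f \<in> H1" and \<phi>: "\<phi> \<in> test_functions UNIV"
  shows "(\<lambda>x. f x + of_real (\<epsilon> * \<phi> x)) \<in> H1"
    "AE x in lborel. weak_grad (\<lambda>x. f x + of_real (\<epsilon> * \<phi> x)) x
        = weak_grad f x + (\<chi> i. of_real (\<epsilon> * partial_deriv i \<phi> x))"
proof -
  note w = H1_weak_grad[OF f]
  let ?\<psi> = "\<lambda>x. complex_of_real (\<epsilon> * \<phi> x)" and ?h = "\<lambda>x. (\<chi> i. of_real (\<epsilon> * partial_deriv i \<phi> x)) :: complex^3"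
  have sq: "square_integrable \<psi>" if \<psi>: "\<psi> \<in> test_functions UNIV" for \<psi>
  proof -
    have "(\<lambda>x. \<psi> x * \<psi> x) \<in> test_functions UNIV"
      using test_functions_mult[of \<psi> \<psi> UNIV] \<psi> by (simp add: test_functions_UNIV_iff)
    from integrable_test[OF this] show ?thesis
      using test_function_borel[OF \<psi>] by (simp add: square_integrable_def power2_eq_square)
  qed
  have s\<psi>: "square_integrable ?\<psi>"
    by (rule square_integrable_bounded_linear[OF bounded_linear_compose[OF bounded_linear_of_real bounded_linear_mult_right] sq[OF \<phi>]])
  have h: "?h = (\<lambda>x. \<Sum>i\<in>UNIV. axis i (complex_of_real (\<epsilon> * partial_deriv i \<phi> x)))"
    by (simp add: fun_eq_iff vec_eq_iff sum_3 forall_3 axis_def)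
  have bl: "bounded_linear (\<lambda>r. axis i (complex_of_real (\<epsilon> * r)) :: complex^3)" for i
    unfolding linear_conv_bounded_linear[symmetric]
    by (intro linearI) (auto simp: vec_eq_iff axis_def algebra_simps scaleR_conv_of_real[where 'a = complex])
  have "square_integrable (\<lambda>x. axis i (complex_of_real (\<epsilon> * partial_deriv i \<phi> x)) :: complex^3)" for i
    by (rule square_integrable_bounded_linear[OF bl sq[OF test_functions_partial_deriv[OF \<phi>]]])
  then have sh: "square_integrable ?h"
    unfolding h sum_3 by (intro square_integrable_add)
  note s = square_integrable_add[OF w(1) s\<psi>] and sg = square_integrable_add[OF w(3) sh]
  have lf: "locally_integrable f" by (rule square_integrable_locally_integrable[OF w(1)])
  have lg: "locally_integrable (\<lambda>x. weak_grad f x $ i)" for i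
    using w(2) locally_integrable_bounded_linear[OF bounded_linear_complex_nth] by (simp add: is_weak_gradient_def)
  have lp: "locally_integrable ?\<psi>" by (rule square_integrable_locally_integrable[OF s\<psi>])
  have lh: "locally_integrable (\<lambda>x. ?h x $ i)" for i
    by (rule locally_integrable_bounded_linear[OF bounded_linear_complex_nth square_integrable_locally_integrable[OF sh]])
  have sm: "smooth \<phi>" using \<phi> by (simp add: test_functions_UNIV_iff)
  have g: "is_weak_gradient (\<lambda>x. f x + ?\<psi> x) (\<lambda>x. weak_grad f x + ?h x)"
    unfolding is_weak_gradient_def
  proof (intro conjI ballI allI)
    show "locally_integrable (\<lambda>x. weak_grad f x + ?h x)" by (rule square_integrable_locally_integrable[OF sg])
    fix \<eta> i assume \<eta>: "\<eta> \<in> test_functions UNIV"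
    note d\<eta> = test_functions_partial_deriv[OF \<eta>, of i]
    have ibp: "(LBINT x. ?\<psi> x * of_real (partial_deriv i \<eta> x)) = - (LBINT x. ?h x $ i * of_real (\<eta> x))"
    proof -
      have "(LBINT x. ?\<psi> x * of_real (partial_deriv i \<eta> x)) = (LBINT x. complex_of_real (\<epsilon> * (\<phi> x * partial_deriv i \<eta> x)))"
        by (simp add: mult.assoc)
      also have "\<dots> = complex_of_real (\<epsilon> * (LBINT x. \<phi> x * partial_deriv i \<eta> x))"
        by (simp only: integral_complex_of_real integral_mult_right_zero)
      also have "\<dots> = - complex_of_real (\<epsilon> * (LBINT x. partial_deriv i \<phi> x * \<eta> x))"
        by (simp add: integration_by_parts[OF sm \<eta>])
      also have "complex_of_real (\<epsilon> * (LBINT x. partial_deriv i \<phi> x * \<eta> x)) = (LBINT x. complex_of_real (\<epsilon> * (partial_deriv i \<phi> x * \<eta> x)))"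
        by (simp only: integral_complex_of_real integral_mult_right_zero)
      also have "\<dots> = (LBINT x. ?h x $ i * of_real (\<eta> x))" by (simp add: mult.assoc)
      finally show ?thesis .
    qed
    have "(LBINT x. (f x + ?\<psi> x) * of_real (partial_deriv i \<eta> x))
      = (LBINT x. f x * of_real (partial_deriv i \<eta> x)) + (LBINT x. ?\<psi> x * of_real (partial_deriv i \<eta> x))"
      unfolding distrib_right by (intro Bochner_Integration.integral_add integrable_complex_test[OF lf d\<eta>] integrable_complex_test[OF lp d\<eta>])
    also have "\<dots> = - ((LBINT x. weak_grad f x $ i * of_real (\<eta> x)) + (LBINT x. ?h x $ i * of_real (\<eta> x)))"
      unfolding ibp using w(2) \<eta> by (simp add: is_weak_gradient_def)
    also have "(LBINT x. weak_grad f x $ i * of_real (\<eta> x)) + (LBINT x. ?h x $ i * of_real (\<eta> x))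
       = (LBINT x. (weak_grad f x + ?h x) $ i * of_real (\<eta> x))"
      unfolding vector_add_component distrib_right
      by (intro Bochner_Integration.integral_add[symmetric] integrable_complex_test[OF lg \<eta>] integrable_complex_test[OF lh \<eta>])
    finally show "(LBINT x. (f x + ?\<psi> x) * of_real (partial_deriv i \<eta> x))
       = - (LBINT x. (weak_grad f x + ?h x) $ i * of_real (\<eta> x))" .
  qed
  show "(\<lambda>x. f x + ?\<psi> x) \<in> H1" "AE x in lborel. weak_grad (\<lambda>x. f x + ?\<psi> x) x = weak_grad f x + ?h x"
    by (rule H1_I[OF s g sg])+
qed

lemma H1_power_locally_integrable:
  assumes f: "f \<in> H1" and T: "bounded_linear T" "\<And>z. \<bar>T z\<bar> \<le> norm z" and k: "k \<le> 6"
  shows "locally_integrable (\<lambda>x. T (f x) ^ k :: real)"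
  unfolding locally_integrable_def
proof (intro conjI allI impI)
  have [measurable]: "f \<in> borel_measurable borel" by (rule borel_H1[OF f])
  have [measurable]: "T \<in> borel_measurable borel"
    using T by (intro borel_measurable_continuous_onI linear_continuous_on)
  show "(\<lambda>x. T (f x) ^ k) \<in> borel_measurable lborel" by measurable
  fix K :: "(real^3) set" assume K: "compact K"
  have [measurable]: "K \<in> sets borel" using K by (simp add: borel_compact)
  show "set_integrable lborel K (\<lambda>x. T (f x) ^ k)"
    unfolding set_integrable_def
  proof (rule Bochner_Integration.integrable_bound)
    show "integrable lborel (\<lambda>x. indicator K x + norm (f x) ^ 6)"
      using H1_sextic(1)[OF f] emeasure_bounded_finite[OF compact_imp_bounded[OF K]] by simp
    have "\<bar>T z\<bar> ^ k \<le> 1 + norm z ^ 6" for z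
    proof (cases "\<bar>T z\<bar> \<le> 1")
      case True
      then have "\<bar>T z\<bar> ^ k \<le> 1" by (simp add: power_le_one)
      then show ?thesis by (smt (verit) norm_ge_zero zero_le_power)
    next
      case False
      then have "\<bar>T z\<bar> ^ k \<le> \<bar>T z\<bar> ^ 6" using k by (intro power_increasing) auto
      also have "\<dots> \<le> norm z ^ 6" using T(2) by (intro power_mono) auto
      finally show ?thesis by simp
    qed
    then show "AE x in lborel. norm (indicator K x *\<^sub>R T (f x) ^ k) \<le> norm (indicator K x + norm (f x) ^ 6)"
      by (auto simp: indicator_def power_abs)
  qed measurable
qed

text \<open>By the binomial theorem the integral is a polynomial in \<open>\<epsilon>\<close>, and only its linear term contributes.\<close>

lemma perturbed_power_derivative:
  fixes q \<phi> :: "real^3 \<Rightarrow> real"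
  assumes i: "\<And>k. k \<le> n \<Longrightarrow> integrable lborel (\<lambda>x. q x ^ k * \<phi> x ^ (n - k))" and n: "0 < n"
  shows "((\<lambda>\<epsilon>. (LBINT x. (q x + \<epsilon> * \<phi> x) ^ n)) has_real_derivative
           real n * (LBINT x. q x ^ (n - 1) * \<phi> x)) (at 0)"
proof -
  define c where "c k = (LBINT x. q x ^ k * \<phi> x ^ (n - k))" for k
  have eq: "(LBINT x. (q x + \<epsilon> * \<phi> x) ^ n) = (\<Sum>k\<le>n. real (n choose k) * c k * \<epsilon> ^ (n - k))" for \<epsilon>
  proof -
    have "(LBINT x. (q x + \<epsilon> * \<phi> x) ^ n)
       = (LBINT x. (\<Sum>k\<le>n. real (n choose k) * \<epsilon> ^ (n - k) * (q x ^ k * \<phi> x ^ (n - k))))"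
      by (intro Bochner_Integration.integral_cong) (simp_all add: binomial_ring power_mult_distrib ac_simps)
    also have "\<dots> = (\<Sum>k\<le>n. (LBINT x. real (n choose k) * \<epsilon> ^ (n - k) * (q x ^ k * \<phi> x ^ (n - k))))"
      using i by (intro Bochner_Integration.integral_sum integrable_mult_right) auto
    also have "\<dots> = (\<Sum>k\<le>n. real (n choose k) * \<epsilon> ^ (n - k) * c k)"
      unfolding c_def by (simp only: integral_mult_right_zero)
    finally show ?thesis by (simp add: ac_simps)
  qed
  have "((\<lambda>\<epsilon>. \<Sum>k\<le>n. real (n choose k) * c k * \<epsilon> ^ (n - k)) has_real_derivative
     (\<Sum>k\<le>n. real (n choose k) * c k * (real (n - k) * 0 ^ (n - k - 1)))) (at 0)"
    by (intro DERIV_sum) (auto intro!: derivative_eq_intros)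
  also have "(\<Sum>k\<le>n. real (n choose k) * c k * (real (n - k) * 0 ^ (n - k - 1)))
     = (\<Sum>k\<in>{n - 1}. real (n choose k) * c k * (real (n - k) * 0 ^ (n - k - 1)))"
    using n by (intro sum.mono_neutral_right) auto
  also have "\<dots> = real n * (LBINT x. q x ^ (n - 1) * \<phi> x)"
    using n binomial_symmetric[of "n - 1" n] by (simp add: c_def)
  finally show ?thesis unfolding eq .
qed

text \<open>By the sharp inequality the difference of the fourth powers of its two sides is a nonnegative
  polynomial along \<open>Q + \<epsilon> \<phi>\<close>, and it vanishes at \<open>\<epsilon> = 0\<close> because \<open>Q\<close> attains equality. Its derivative there
  is the asserted identity, after division by \<open>quartic Q ^ 4\<close> and use of the normalization.\<close>

lemma Euler_Lagrange:
  assumes Q: "Q \<in> H1" "0 < mass Q" and real: "\<And>x. Q x = of_real (q x)"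
    and opt: "quartic Q ^ 4 = sharp_const 0 ^ 4 * ((mass Q)\<^sup>2 * dirichlet Q ^ 3 * sextic Q)"
    and bal: "sextic Q = dirichlet Q" and \<phi>: "\<phi> \<in> test_functions UNIV"
  shows "(LBINT x. (\<Sum>i\<in>UNIV. Re (weak_grad Q x $ i) * partial_deriv i \<phi> x)) + (LBINT x. q x ^ 5 * \<phi> x)
     = 8 * dirichlet Q / (3 * quartic Q) * (LBINT x. q x ^ 3 * \<phi> x)
       - 2 * dirichlet Q / (3 * mass Q) * (LBINT x. q x * \<phi> x)"
proof -
  note pos = functionals_pos[OF Q]
  define M L h where "M = mass Q" and "L = quartic Q" and "h = dirichlet Q"
  define G where "G = (LBINT x. (\<Sum>i\<in>UNIV. Re (weak_grad Q x $ i) * partial_deriv i \<phi> x))"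
  define X Y Z where "X = (LBINT x. q x * \<phi> x)" and "Y = (LBINT x. q x ^ 5 * \<phi> x)"
    and "Z = (LBINT x. q x ^ 3 * \<phi> x)"
  let ?F = "\<lambda>\<epsilon> x. Q x + of_real (\<epsilon> * \<phi> x)"
  have norm_even: "norm (?F \<epsilon> x) ^ n = (q x + \<epsilon> * \<phi> x) ^ n" if "even n" for \<epsilon> x n
  proof -
    have "norm (?F \<epsilon> x) = \<bar>q x + \<epsilon> * \<phi> x\<bar>" unfolding real by (simp only: norm_of_real flip: of_real_add)
    then show ?thesis using that by (simp add: power_even_abs)
  qed
  have lk: "locally_integrable (\<lambda>x. q x ^ k)" if "k \<le> 6" for k
    using H1_power_locally_integrable[OF Q(1) bounded_linear_Re abs_Re_le_cmod that] by (simp add: real)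
  have ik: "integrable lborel (\<lambda>x. q x ^ k * \<phi> x ^ (n - k))" if n: "n \<in> {2, 4, 6}" and k: "k \<le> n" for n k
  proof (cases "k = n")
    case True
    have "integrable lborel (\<lambda>x. norm (Q x) ^ n)"
      using n H1_mass_integrable[OF Q(1)] H1_quartic(1)[OF Q(1)] H1_sextic(1)[OF Q(1)] by auto
    moreover have "even n" using n by auto
    then have "norm (Q x) ^ n = q x ^ n" for x by (simp add: real power_even_abs)
    ultimately show ?thesis using True by simp
  next
    case False
    have sm: "smooth \<phi>" using \<phi> by (simp add: test_functions_UNIV_iff)
    have "(\<lambda>x. \<phi> x ^ Suc j) \<in> test_functions UNIV" for j
      by (induction j) (use \<phi> test_functions_mult[OF sm] in auto)
    moreover have "Suc (n - k - 1) = n - k" using False k by simp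
    ultimately have "(\<lambda>x. \<phi> x ^ (n - k)) \<in> test_functions UNIV" by metis
    from integrable_test_times[OF lk this, of k] show ?thesis using n k by (auto simp: mult.commute)
  qed
  have ne: "(norm (?F \<epsilon> x))\<^sup>2 = (q x + \<epsilon> * \<phi> x)\<^sup>2" "norm (?F \<epsilon> x) ^ 4 = (q x + \<epsilon> * \<phi> x) ^ 4"
    "norm (?F \<epsilon> x) ^ 6 = (q x + \<epsilon> * \<phi> x) ^ 6" for \<epsilon> x
    by (rule norm_even, simp)+
  have "((\<lambda>\<epsilon>. mass (?F \<epsilon>)) has_real_derivative 2 * X) (at 0)"
    using perturbed_power_derivative[of 2 q \<phi>] ik[of 2] unfolding mass_def ne X_def by simp
  moreover have "((\<lambda>\<epsilon>. quartic (?F \<epsilon>)) has_real_derivative 4 * Z) (at 0)"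
    using perturbed_power_derivative[of 4 q \<phi>] ik[of 4] unfolding quartic_def ne Z_def by simp
  moreover have "((\<lambda>\<epsilon>. sextic (?F \<epsilon>)) has_real_derivative 6 * Y) (at 0)"
    using perturbed_power_derivative[of 6 q \<phi>] ik[of 6] unfolding sextic_def ne Y_def by simp
  moreover have "((\<lambda>\<epsilon>. dirichlet (?F \<epsilon>)) has_real_derivative 2 * G) (at 0)"
  proof -
    define R where "R = (LBINT x. (\<Sum>i\<in>UNIV. (partial_deriv i \<phi> x)\<^sup>2))"
    have lg: "locally_integrable (\<lambda>x. Re (weak_grad Q x $ i))" for i
      by (intro locally_integrable_bounded_linear[OF bounded_linear_Re] locally_integrable_bounded_linear[OF bounded_linear_complex_nth]
          square_integrable_locally_integrable H1_weak_grad(3) Q(1))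
    have iG: "integrable lborel (\<lambda>x. \<Sum>i\<in>UNIV. Re (weak_grad Q x $ i) * partial_deriv i \<phi> x)"
      using integrable_test_times[OF lg test_functions_partial_deriv[OF \<phi>]] by (intro Bochner_Integration.integrable_sum) (simp add: mult.commute)
    have iR: "integrable lborel (\<lambda>x. \<Sum>i\<in>UNIV. (partial_deriv i \<phi> x)\<^sup>2)"
    proof (intro Bochner_Integration.integrable_sum)
      fix i
      have "smooth (partial_deriv i \<phi>)" using \<phi> by (simp add: test_functions_UNIV_iff smooth_partial_deriv)
      from integrable_test[OF test_functions_mult[OF this test_functions_partial_deriv[OF \<phi>]]]
      show "integrable lborel (\<lambda>x. (partial_deriv i \<phi> x)\<^sup>2)" by (simp add: power2_eq_square)
    qed
    have "dirichlet (?F \<epsilon>) = h + \<epsilon> * (2 * G) + \<epsilon>\<^sup>2 * R" for \<epsilon>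
    proof -
      have F: "?F \<epsilon> \<in> H1" by (rule H1_add_test(1)[OF Q(1) \<phi>])
      have [measurable]: "weak_grad Q \<in> borel_measurable borel" "weak_grad (?F \<epsilon>) \<in> borel_measurable borel"
        by (rule borel_weak_grad[OF Q(1)], rule borel_weak_grad[OF F])
      have "dirichlet (?F \<epsilon>) = (LBINT x. (norm (weak_grad Q x))\<^sup>2
          + \<epsilon> * (2 * (\<Sum>i\<in>UNIV. Re (weak_grad Q x $ i) * partial_deriv i \<phi> x)) + \<epsilon>\<^sup>2 * (\<Sum>i\<in>UNIV. (partial_deriv i \<phi> x)\<^sup>2))"
        unfolding dirichlet_def
      proof (rule integral_cong_AE)
        show "(\<lambda>x. (norm (weak_grad (?F \<epsilon>) x))\<^sup>2) \<in> borel_measurable lborel" by measurable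
        show "AE x in lborel. (norm (weak_grad (?F \<epsilon>) x))\<^sup>2 = (norm (weak_grad Q x))\<^sup>2
          + \<epsilon> * (2 * (\<Sum>i\<in>UNIV. Re (weak_grad Q x $ i) * partial_deriv i \<phi> x)) + \<epsilon>\<^sup>2 * (\<Sum>i\<in>UNIV. (partial_deriv i \<phi> x)\<^sup>2)"
          using H1_add_test(2)[OF Q(1) \<phi>, of \<epsilon>]
        proof eventually_elim
          case (elim x)
          have e: "(norm (z + of_real (\<epsilon> * r)))\<^sup>2 = (norm z)\<^sup>2 + \<epsilon> * (2 * (Re z * r)) + \<epsilon>\<^sup>2 * r\<^sup>2" for z :: complex and r
            unfolding cmod_power2 by (simp add: power2_eq_square algebra_simps)
          then show ?case unfolding elim norm_square_vec3 sum_3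
            by (simp only: vector_add_component vec_lambda_beta e) (simp add: algebra_simps)
        qed
      qed (use iG iR in auto)
      also have "\<dots> = h + \<epsilon> * (2 * G) + \<epsilon>\<^sup>2 * R"
        using iG iR H1_dirichlet_integrable[OF Q(1)] unfolding h_def G_def R_def dirichlet_def
        by (simp del: integral_mult_right_zero add: integral_mult_right)
      finally show ?thesis .
    qed
    then show ?thesis by (auto intro!: derivative_eq_intros)
  qed
  ultimately have D: "((\<lambda>\<epsilon>. sharp_const 0 ^ 4 * ((mass (?F \<epsilon>))\<^sup>2 * dirichlet (?F \<epsilon>) ^ 3 * sextic (?F \<epsilon>)) - quartic (?F \<epsilon>) ^ 4)
     has_real_derivative sharp_const 0 ^ 4 * (2 * M * (2 * X) * h ^ 3 * h
        + M\<^sup>2 * (3 * h\<^sup>2 * (2 * G)) * h + M\<^sup>2 * h ^ 3 * (6 * Y))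
        - 4 * L ^ 3 * (4 * Z)) (at 0)"
    using bal unfolding M_def h_def L_def
    by (auto intro!: derivative_eq_intros simp: algebra_simps)
  have stat: "sharp_const 0 ^ 4 * (2 * M * (2 * X) * h ^ 3 * h
        + M\<^sup>2 * (3 * h\<^sup>2 * (2 * G)) * h + M\<^sup>2 * h ^ 3 * (6 * Y))
        - 4 * L ^ 3 * (4 * Z) = 0"
  proof (rule DERIV_local_min[OF D zero_less_one], intro allI impI)
    fix \<epsilon> :: real
    show "sharp_const 0 ^ 4 * ((mass (?F 0))\<^sup>2 * dirichlet (?F 0) ^ 3 * sextic (?F 0)) - quartic (?F 0) ^ 4
      \<le> sharp_const 0 ^ 4 * ((mass (?F \<epsilon>))\<^sup>2 * dirichlet (?F \<epsilon>) ^ 3 * sextic (?F \<epsilon>)) - quartic (?F \<epsilon>) ^ 4"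
      using sharp_inequality_power4[OF H1_add_test(1)[OF Q(1) \<phi>], of \<epsilon>] opt by simp
  qed
  have eq: "sharp_const 0 ^ 4 * (M\<^sup>2 * h ^ 4) = L ^ 4"
    using opt unfolding bal M_def h_def L_def by (simp add: eval_nat_numeral mult.assoc)
  have p: "M > 0" "L > 0" "h > 0" using Q(2) pos by (simp_all add: M_def L_def h_def)
  have "M\<^sup>2 * h ^ 4 * (4 * X / M + 6 * G / h + 6 * Y / h)
      = 2 * M * (2 * X) * h ^ 3 * h + M\<^sup>2 * (3 * h\<^sup>2 * (2 * G)) * h + M\<^sup>2 * h ^ 3 * (6 * Y)"
    using p by (simp add: field_simps eval_nat_numeral)
  then have "L ^ 4 * (4 * X / M + 6 * G / h + 6 * Y / h)
     = 16 * L ^ 3 * Z"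
    using stat unfolding eq[symmetric] mult.assoc[of "sharp_const 0 ^ 4"] by simp
  then have "L * (4 * X / M + 6 * G / h + 6 * Y / h)
     = 16 * Z"
    using p by (simp add: eval_nat_numeral)
  then show ?thesis using p unfolding G_def[symmetric] X_def[symmetric] Y_def[symmetric] Z_def[symmetric] M_def[symmetric] L_def[symmetric] h_def[symmetric]
    by (simp add: field_simps)
qed

section \<open>An optimizer has vanishing virial\<close>

lemma partial_deriv_coordinate_product:
  fixes a b c :: "real \<Rightarrow> real"
  assumes "\<forall>t. (a has_real_derivative a' t) (at t)" "\<forall>t. (b has_real_derivative b' t) (at t)"
    "\<forall>t. (c has_real_derivative c' t) (at t)"
  shows "partial_deriv i (\<lambda>x. a (x $ 1) * b (x $ 2) * c (x $ 3))
    = (\<lambda>x. (if i = 1 then a' (x $ 1) else a (x $ 1)) * (if i = 2 then b' (x $ 2) else b (x $ 2))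
          * (if i = 3 then c' (x $ 3) else c (x $ 3)))"
proof
  fix x :: "real^3"
  note d = has_derivative_coordinate[OF assms(1), of 1] has_derivative_coordinate[OF assms(2), of 2]
    has_derivative_coordinate[OF assms(3), of 3]
  have "((\<lambda>x. a (x $ 1) * b (x $ 2) * c (x $ 3)) has_derivative
     (\<lambda>h. a (x $ 1) * b (x $ 2) * (c' (x $ 3) * h $ 3)
        + (a (x $ 1) * (b' (x $ 2) * h $ 2) + a' (x $ 1) * h $ 1 * b (x $ 2)) * c (x $ 3))) (at x)"
    by (intro has_derivative_mult d)
  from partial_deriv_eqI[OF this, of i]
  show "partial_deriv i (\<lambda>x. a (x $ 1) * b (x $ 2) * c (x $ 3)) x
    = (if i = 1 then a' (x $ 1) else a (x $ 1)) * (if i = 2 then b' (x $ 2) else b (x $ 2))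
          * (if i = 3 then c' (x $ 3) else c (x $ 3))"
    using exhaust_3[of i] by (auto simp: axis_def)
qed

lemma bump_second_partial_deriv: "- 9 * bump x \<le> partial_deriv i (partial_deriv i bump) x"
proof -
  obtain p1 p2 where p: "\<forall>t. (bump1 has_real_derivative p1 t) (at t)" "\<forall>t. (p1 has_real_derivative p2 t) (at t)"
    "\<And>t. p2 t \<ge> - 9 * bump1 t"
    using bump1_second_derivative by metis
  let ?f = "\<lambda>j. if i = j then p1 else bump1"
  let ?f' = "\<lambda>j. if i = j then p2 else p1"
  have d1: "\<forall>t. (?f j has_real_derivative ?f' j t) (at t)" for j using p by simp
  have "partial_deriv i bump = (\<lambda>x. ?f 1 (x $ 1) * ?f 2 (x $ 2) * ?f 3 (x $ 3))"
    using partial_deriv_coordinate_product[OF p(1) p(1) p(1), of i] unfolding bump_def[abs_def] by auto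
  then have "partial_deriv i (partial_deriv i bump) x
     = (if i = 1 then ?f' 1 (x $ 1) else ?f 1 (x $ 1)) * (if i = 2 then ?f' 2 (x $ 2) else ?f 2 (x $ 2))
         * (if i = 3 then ?f' 3 (x $ 3) else ?f 3 (x $ 3))"
    using partial_deriv_coordinate_product[OF d1[of 1] d1[of 2] d1[of 3], of i] by simp
  also have "\<dots> = (if i = 1 then p2 else bump1) (x $ 1) * (if i = 2 then p2 else bump1) (x $ 2) * (if i = 3 then p2 else bump1) (x $ 3)"
    by simp
  also have "\<dots> \<ge> - 9 * bump x"
  proof -
    have "- 9 * bump1 s * r \<le> p2 s * r" if "0 \<le> r" for s r using p(3) that by (rule mult_right_mono)
    from this[of "bump1 (x $ 2) * bump1 (x $ 3)" "x $ 1"] this[of "bump1 (x $ 1) * bump1 (x $ 3)" "x $ 2"]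
      this[of "bump1 (x $ 1) * bump1 (x $ 2)" "x $ 3"]
    show ?thesis using exhaust_3[of i] unfolding bump_def by (auto simp: bump1_nonneg ac_simps)
  qed
  finally show ?thesis .
qed

text \<open>For large \<open>R\<close> the dilated bump \<open>\<phi> x = bump (x / R)\<close> satisfies
  \<open>\<Delta> \<phi> + \<kappa> \<phi> \<ge> \<kappa> / 2 * \<phi>\<close>, because \<open>\<Delta> \<phi> \<ge> - 27 / R^2 * \<phi>\<close>. Testing the equation with \<open>\<phi>\<close>
  forces \<open>q\<close> to vanish on the cube of half-width \<open>R\<close>.\<close>

lemma no_nonneg_eigenfunction:
  fixes q :: "real^3 \<Rightarrow> real"
  assumes q: "locally_integrable q" "\<And>x. 0 \<le> q x" and "0 < \<kappa>"
    and eig: "\<And>\<phi>. \<phi> \<in> test_functions UNIV \<Longrightarrow>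
      (LBINT x. q x * ((\<Sum>i\<in>UNIV. partial_deriv i (partial_deriv i \<phi>) x) + \<kappa> * \<phi> x)) = 0"
  shows "AE x in lborel. q x = 0"
proof -
  \<comment> \<open>The bump satisfies \<open>\<Delta> bump \<ge> - 27 bump\<close>, and \<open>R \<ge> 1\<close>, \<open>R > 54 / \<kappa>\<close> give \<open>27 / R^2 \<le> \<kappa> / 2\<close>.\<close>
  obtain N :: nat where N: "54 / \<kappa> < real N" using reals_Archimedean2 by blast
  have "AE x in lborel. norm x < real n \<longrightarrow> q x = 0" if n: "n \<ge> N" "n \<ge> 1" for n :: nat
  proof -
    define R where "R = real n"
    have R: "R \<ge> 1" "54 / \<kappa> < R" using n N by (auto simp: R_def)
    have R2: "27 / R\<^sup>2 \<le> \<kappa> / 2"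
    proof -
      have "54 < R * \<kappa>" using R \<open>0 < \<kappa>\<close> by (simp add: field_simps)
      also have "\<dots> \<le> R\<^sup>2 * \<kappa>" using R \<open>0 < \<kappa>\<close> by (intro mult_right_mono) (auto simp: power2_eq_square)
      finally show ?thesis using R by (simp add: field_simps)
    qed
    \<comment> \<open>The summand \<open>0\<close> keeps the dilation in the affine form of the chain rule.\<close>
    let ?\<phi> = "\<lambda>x. bump ((1 / R) *\<^sub>R x + 0)"
    have \<phi>: "?\<phi> \<in> test_functions UNIV" using R by (intro test_functions_affine test_bump) auto
    have d1: "partial_deriv i ?\<phi> = (\<lambda>x. (1 / R) * partial_deriv i bump ((1 / R) *\<^sub>R x + 0))" for i
      using partial_deriv_affine[OF smooth_differentiable[OF smooth_bump]] by blast
    have d2: "partial_deriv i (partial_deriv i ?\<phi>) x = (1 / R)\<^sup>2 * partial_deriv i (partial_deriv i bump) ((1 / R) *\<^sub>R x + 0)" for i x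
    proof -
      note s = smooth_partial_deriv[OF smooth_bump, of i]
      show ?thesis
        unfolding d1 partial_deriv_mult[OF differentiable_const smooth_differentiable[OF smooth_affine[OF s]]]
          partial_deriv_const partial_deriv_affine[OF smooth_differentiable[OF s]]
        by (simp add: power2_eq_square)
    qed
    let ?\<Delta> = "\<lambda>x. (\<Sum>i\<in>UNIV. partial_deriv i (partial_deriv i ?\<phi>) x) + \<kappa> * ?\<phi> x"
    have lower: "\<kappa> / 2 * ?\<phi> x \<le> ?\<Delta> x" for x
    proof -
      let ?y = "(1 / R) *\<^sub>R x + 0"
      have "(1 / R)\<^sup>2 * (- 27 * bump ?y) \<le> (1 / R)\<^sup>2 * (\<Sum>i\<in>UNIV. partial_deriv i (partial_deriv i bump) ?y)"
        using bump_second_partial_deriv[of ?y 1] bump_second_partial_deriv[of ?y 2] bump_second_partial_deriv[of ?y 3]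
        by (intro mult_left_mono) (auto simp: sum_3)
      then have "- (27 / R\<^sup>2 * ?\<phi> x) \<le> (\<Sum>i\<in>UNIV. partial_deriv i (partial_deriv i ?\<phi>) x)"
        unfolding d2 sum_distrib_left by (simp add: power_divide)
      moreover have "27 / R\<^sup>2 * ?\<phi> x \<le> \<kappa> / 2 * ?\<phi> x" by (rule mult_right_mono[OF R2 bump_nonneg])
      ultimately show ?thesis by (simp add: field_simps)
    qed
    have i\<phi>: "integrable lborel (\<lambda>x. q x * ?\<phi> x)"
      using integrable_test_times[OF q(1) \<phi>] by (simp add: mult.commute)
    have "integrable lborel (\<lambda>x. q x * partial_deriv i (partial_deriv i ?\<phi>) x)" for i
      using integrable_test_times[OF q(1) test_functions_partial_deriv[OF test_functions_partial_deriv[OF \<phi>]]]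
      by (simp add: mult.commute)
    then have i\<Delta>: "integrable lborel (\<lambda>x. q x * ?\<Delta> x)"
      using i\<phi> unfolding distrib_left sum_distrib_left mult.left_commute[of "q _" \<kappa>]
      by (intro Bochner_Integration.integrable_add Bochner_Integration.integrable_sum integrable_mult_right) auto
    have "(LBINT x. \<kappa> / 2 * (q x * ?\<phi> x)) \<le> (LBINT x. q x * ?\<Delta> x)"
    proof (rule integral_mono[OF integrable_mult_right[OF i\<phi>] i\<Delta>])
      fix x show "\<kappa> / 2 * (q x * ?\<phi> x) \<le> q x * ?\<Delta> x"
        using mult_left_mono[OF lower q(2), of x x] by (simp only: ac_simps)
    qed
    then have "\<kappa> / 2 * (LBINT x. q x * ?\<phi> x) \<le> 0" unfolding eig[OF \<phi>] by simp
    then have "(LBINT x. q x * ?\<phi> x) \<le> 0" using \<open>0 < \<kappa>\<close> by (simp add: mult_le_0_iff)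
    moreover have nn: "0 \<le> q x * ?\<phi> x" for x using q(2) bump_nonneg by simp
    ultimately have "(LBINT x. q x * ?\<phi> x) = 0"
      using Bochner_Integration.integral_nonneg[of lborel "\<lambda>x. q x * ?\<phi> x"] by (intro antisym) auto
    then have "AE x in lborel. q x * ?\<phi> x = 0"
      using integral_nonneg_eq_0_iff_AE[OF i\<phi>] nn by simp
    then show ?thesis
    proof eventually_elim
      case (elim x)
      show ?case
      proof
        assume "norm x < real n"
        then have "\<bar>x $ i\<bar> < R" for i using component_le_norm_cart[of x i] unfolding R_def by linarith
        then have "bump ((1 / R) *\<^sub>R x + 0) \<noteq> 0" using R(1) by (simp add: bump_nonzero_iff abs_mult)
        then show "q x = 0" using elim by simp
      qed
    qed
  qed
  then have "AE x in lborel. \<forall>n::nat. n \<ge> N \<and> n \<ge> 1 \<longrightarrow> norm x < real n \<longrightarrow> q x = 0"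
    by (subst AE_all_countable) auto
  then show ?thesis
  proof eventually_elim
    case (elim x)
    obtain k :: nat where "norm x < real k" using reals_Archimedean2 by blast
    then show ?case using elim[rule_format, of "N + 1 + k"] by simp
  qed
qed

text \<open>The quartic identity says that the virial vanishes. It is not a normalization but a consequence of the two
  equations for \<open>Q\<close>. If their cubic coefficients differed, then \<open>q^3 = s q\<close> almost everywhere, hence
  \<open>q^5 = s^2 q\<close>, and all functionals become multiples of the mass: the quartic one is \<open>s M\<close>, the sextic one
  and the Dirichlet integral are \<open>s^2 M\<close>. The coefficients of the Euler--Lagrange equation are then
  \<open>k = 8 s / 3\<close> and \<open>l = 2 s^2 / 3\<close>, and its right-hand side minus \<open>q^5\<close> is \<open>(8 / 3 - 2 / 3 - 1) s^2 q = s^2 q\<close>.\<close>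

lemma optimizer_properties:
  assumes opt: "normalized_optimizer 0 Q"
  shows "Q \<in> H1" "0 < mass Q" "sextic Q = dirichlet Q" "quartic Q = 8 / 3 * dirichlet Q"
proof -
  show Q: "Q \<in> H1" using opt by (simp add: normalized_optimizer_def)
  show M: "0 < mass Q" using opt functionals_nonneg(2)[of Q] by (simp add: normalized_optimizer_def)
  show bal: "sextic Q = dirichlet Q"
    using opt functionals_nonneg(4)[of Q] by (simp add: normalized_optimizer_def Lp_norm_power Hdot_norm_square hardy_form_0)
  obtain \<omega> where \<omega>: "solves_elliptic 0 \<omega> Q" using opt unfolding normalized_optimizer_def by blast
  define q where "q x = Re (Q x)" for x
  have "\<forall>x. Q x \<in> \<real>\<^sub>\<ge>\<^sub>0" using opt unfolding normalized_optimizer_def by blast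
  then have real: "Q x = of_real (q x)" and q0: "0 \<le> q x" for x
    by (simp_all add: q_def complex_nonneg_Reals_iff complex_eq_iff)
  have opt4: "quartic Q ^ 4 = sharp_const 0 ^ 4 * ((mass Q)\<^sup>2 * dirichlet Q ^ 3 * sextic Q)"
    using opt by (simp add: normalized_optimizer_def Lp_norm_power power_mult_distrib GNH_bound_power4(2)[OF Q])
  note pos = functionals_pos[OF Q M]
  define k l where "k = 8 * dirichlet Q / (3 * quartic Q)" and "l = 2 * dirichlet Q / (3 * mass Q)"
  define G where "G \<phi> = (LBINT x. (\<Sum>i\<in>UNIV. Re (weak_grad Q x $ i) * partial_deriv i \<phi> x))" for \<phi>
  have EL: "G \<phi> + (LBINT x. q x ^ 5 * \<phi> x) = k * (LBINT x. q x ^ 3 * \<phi> x) - l * (LBINT x. q x * \<phi> x)"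
    if "\<phi> \<in> test_functions UNIV" for \<phi>
    unfolding G_def k_def l_def by (rule Euler_Lagrange[OF Q M real opt4 bal that])
  have lk: "locally_integrable (\<lambda>x. q x ^ j)" if "j \<le> 6" for j
    using H1_power_locally_integrable[OF Q bounded_linear_Re abs_Re_le_cmod that] by (simp add: q_def)
  have ik: "integrable lborel (\<lambda>x. q x ^ j * \<phi> x)" if "j \<le> 6" "\<phi> \<in> test_functions UNIV" for j \<phi>
    using integrable_test_times[OF lk[OF that(1)] that(2)] by (simp add: mult.commute)
  have lq: "locally_integrable q" using lk[of 1] by simp
  have iG: "integrable lborel (\<lambda>x. weak_grad Q x $ i * of_real (partial_deriv i \<phi> x))"
    if "\<phi> \<in> test_functions UNIV" for i \<phi>
    by (intro integrable_complex_test test_functions_partial_deriv that locally_integrable_bounded_linear[OF bounded_linear_complex_nth]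
        square_integrable_locally_integrable H1_weak_grad(3) Q)
  have ell: "G \<phi> + (LBINT x. q x ^ 5 * \<phi> x) = (LBINT x. q x ^ 3 * \<phi> x) - \<omega> * (LBINT x. q x * \<phi> x)"
    if \<phi>0: "\<phi> \<in> test_functions (- {0})" for \<phi>
  proof -
    have \<phi>: "\<phi> \<in> test_functions UNIV" by (rule test_functions_mono[OF \<phi>0])
    let ?A = "\<lambda>x. \<Sum>i\<in>UNIV. weak_grad Q x $ i * of_real (partial_deriv i \<phi> x)"
    let ?B = "\<lambda>x. q x ^ 5 * \<phi> x - q x ^ 3 * \<phi> x + \<omega> * (q x * \<phi> x)"
    have iA: "integrable lborel ?A" using iG[OF \<phi>] by (intro Bochner_Integration.integrable_sum)
    have iB: "integrable lborel ?B" using ik[OF _ \<phi>, of 5] ik[OF _ \<phi>, of 3] ik[OF _ \<phi>, of 1] by auto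
    have "0 = (LBINT x. ?A x + of_real (?B x))"
      using \<omega>[unfolded solves_elliptic_def, rule_format, OF \<phi>0] unfolding real
      by (simp add: algebra_simps)
    also have "\<dots> = (LBINT x. ?A x) + (LBINT x. complex_of_real (?B x))"
      using iA iB by (intro Bochner_Integration.integral_add) (auto simp del: of_real_add of_real_diff)
    finally have "0 = Re (LBINT x. ?A x) + (LBINT x. ?B x)"
      unfolding integral_complex_of_real by (simp add: complex_eq_iff)
    also have "Re (LBINT x. ?A x) = G \<phi>"
      unfolding G_def by (subst integral_Re[symmetric, OF iA]) simp
    also have "(LBINT x. ?B x) = (LBINT x. q x ^ 5 * \<phi> x) - (LBINT x. q x ^ 3 * \<phi> x) + \<omega> * (LBINT x. q x * \<phi> x)"
      using ik[OF _ \<phi>, of 5] ik[OF _ \<phi>, of 3] ik[OF _ \<phi>, of 1] by simp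
    finally show ?thesis by simp
  qed
  have "AE x in lborel. x \<in> - {0} \<longrightarrow> (k - 1) * q x ^ 3 - (l - \<omega>) * q x = 0"
  proof (rule AE_eq_0_if_orthogonal_to_test_functions)
    show "locally_integrable (\<lambda>x. (k - 1) * q x ^ 3 - (l - \<omega>) * q x)"
      using lk[of 3] lk[of 1] unfolding locally_integrable_def by (auto intro!: set_integral_diff)
    fix \<phi> assume \<phi>0: "\<phi> \<in> test_functions (- {0})"
    have \<phi>: "\<phi> \<in> test_functions UNIV" by (rule test_functions_mono[OF \<phi>0])
    have "(LBINT x. \<phi> x * ((k - 1) * q x ^ 3 - (l - \<omega>) * q x))
       = (LBINT x. (k - 1) * (q x ^ 3 * \<phi> x) - (l - \<omega>) * (q x * \<phi> x))"
      by (simp add: algebra_simps)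
    also have "\<dots> = (k - 1) * (LBINT x. q x ^ 3 * \<phi> x) - (l - \<omega>) * (LBINT x. q x * \<phi> x)"
      using ik[OF _ \<phi>, of 3] ik[OF _ \<phi>, of 1] by simp
    also have "\<dots> = 0" using EL[OF \<phi>] ell[OF \<phi>0] by (simp add: algebra_simps)
    finally show "(LBINT x. \<phi> x * ((k - 1) * q x ^ 3 - (l - \<omega>) * q x)) = 0" .
  qed (simp add: open_Compl)
  moreover have "AE x in lborel. x \<noteq> (0 :: real^3)" by (rule AE_lborel_singleton)
  ultimately have two: "AE x in lborel. (k - 1) * q x ^ 3 = (l - \<omega>) * q x" by eventually_elim simp
  have nz: "\<not> (AE x in lborel. q x = 0)"
  proof
    assume "AE x in lborel. q x = 0"
    then have "AE x in lborel. (norm (Q x))\<^sup>2 = 0" by eventually_elim (simp add: real)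
    then have "mass Q = 0" unfolding mass_def by (rule integral_eq_zero_AE)
    then show False using M by simp
  qed
  have "k = 1"
  proof (rule ccontr)
    assume k1: "k \<noteq> 1"
    define s where "s = (l - \<omega>) / (k - 1)"
    have cube: "AE x in lborel. q x ^ 3 = s * q x"
      using two by eventually_elim (use k1 in \<open>simp add: s_def field_simps\<close>)
    have "s > 0"
    proof (rule ccontr)
      assume "\<not> s > 0"
      have "AE x in lborel. q x = 0"
        using cube
      proof eventually_elim
        case (elim x)
        show ?case
        proof (rule ccontr)
          assume "q x \<noteq> 0"
          then have "q x ^ 3 > 0" "s * q x \<le> 0" using q0[of x] \<open>\<not> s > 0\<close> by (auto simp: mult_nonpos_nonneg)
          then show False using elim by simp
        qed
      qed
      then show False using nz by simp
    qed
    have [measurable]: "q \<in> borel_measurable borel" using lq by (simp add: locally_integrable_def)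
    have nQ: "norm (Q x) = q x" for x using q0 by (simp add: real)
    have L: "quartic Q = s * mass Q"
    proof -
      have "quartic Q = (LBINT x. s * (q x)\<^sup>2)"
        unfolding quartic_def nQ
        by (rule integral_cong_AE) (use cube in \<open>auto elim!: AE_mp simp: eval_nat_numeral\<close>)
      then show ?thesis by (simp add: mass_def nQ)
    qed
    have h: "dirichlet Q = s\<^sup>2 * mass Q"
    proof -
      have "sextic Q = (LBINT x. s\<^sup>2 * (q x)\<^sup>2)"
        unfolding sextic_def nQ
      proof (rule integral_cong_AE)
        show "AE x in lborel. q x ^ 6 = s\<^sup>2 * (q x)\<^sup>2"
          using cube
        proof eventually_elim
          case (elim x)
          have "q x ^ 6 = (q x ^ 3)\<^sup>2" by (simp flip: power_mult)
          then show ?case by (simp add: elim power_mult_distrib)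
        qed
      qed measurable
      then show ?thesis by (simp add: mass_def nQ bal)
    qed
    have kl: "k = 8 * s / 3" "l = 2 * s\<^sup>2 / 3"
      using M \<open>s > 0\<close> unfolding k_def l_def L h by (auto simp: field_simps power2_eq_square)
    have "AE x in lborel. q x = 0"
    proof (rule no_nonneg_eigenfunction[OF lq q0])
      show "0 < s\<^sup>2" using \<open>s > 0\<close> by simp
      fix \<phi> assume \<phi>: "\<phi> \<in> test_functions UNIV"
      have i2: "integrable lborel (\<lambda>x. q x * partial_deriv i (partial_deriv i \<phi>) x)" for i
        using ik[OF _ test_functions_partial_deriv[OF test_functions_partial_deriv[OF \<phi>]], of 1] by simp
      have g: "(LBINT x. q x * partial_deriv i (partial_deriv i \<phi>) x) = - (LBINT x. Re (weak_grad Q x $ i) * partial_deriv i \<phi> x)" for i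
        unfolding q_def
        by (rule is_weak_gradient_functional[OF bounded_linear_Re square_integrable_locally_integrable[OF H1_weak_grad(1)[OF Q]]
              H1_weak_grad(2)[OF Q] test_functions_partial_deriv[OF \<phi>]])
      have iRe: "integrable lborel (\<lambda>x. Re (weak_grad Q x $ i) * partial_deriv i \<phi> x)" for i
        using integrable_Re[OF iG[OF \<phi>, of i]] by simp
      have c3: "(LBINT x. q x ^ 3 * \<phi> x) = s * (LBINT x. q x * \<phi> x)"
      proof -
        have "(LBINT x. q x ^ 3 * \<phi> x) = (LBINT x. s * (q x * \<phi> x))"
          using test_function_borel[OF \<phi>]
          by (intro integral_cong_AE) (use cube in \<open>auto elim!: AE_mp\<close>)
        then show ?thesis by simp
      qed
      have c5: "(LBINT x. q x ^ 5 * \<phi> x) = s\<^sup>2 * (LBINT x. q x * \<phi> x)"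
      proof -
        have "(LBINT x. q x ^ 5 * \<phi> x) = (LBINT x. s\<^sup>2 * (q x * \<phi> x))"
        proof (rule integral_cong_AE)
          show "AE x in lborel. q x ^ 5 * \<phi> x = s\<^sup>2 * (q x * \<phi> x)"
            using cube
          proof eventually_elim
            case (elim x)
            have "q x ^ 5 = q x ^ 3 * (q x)\<^sup>2" by (simp flip: power_add)
            also have "\<dots> = s * q x ^ 3" unfolding elim by (simp add: power2_eq_square elim[symmetric] eval_nat_numeral)
            finally show ?case unfolding elim by (simp add: power2_eq_square)
          qed
        qed (use test_function_borel[OF \<phi>] in auto)
        then show ?thesis by simp
      qed
      have "(LBINT x. q x * ((\<Sum>i\<in>UNIV. partial_deriv i (partial_deriv i \<phi>) x) + s\<^sup>2 * \<phi> x))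
         = (LBINT x. (\<Sum>i\<in>UNIV. q x * partial_deriv i (partial_deriv i \<phi>) x) + s\<^sup>2 * (q x * \<phi> x))"
        by (simp add: distrib_left sum_distrib_left mult.left_commute)
      also have "\<dots> = (\<Sum>i\<in>UNIV. (LBINT x. q x * partial_deriv i (partial_deriv i \<phi>) x)) + s\<^sup>2 * (LBINT x. q x * \<phi> x)"
        using i2 ik[OF _ \<phi>, of 1] by simp
      also have "(\<Sum>i\<in>UNIV. (LBINT x. q x * partial_deriv i (partial_deriv i \<phi>) x)) = - G \<phi>"
        unfolding g G_def using iRe by (simp add: sum_negf)
      \<comment> \<open>With \<open>q^3 = s q\<close> and \<open>q^5 = s^2 q\<close> the Euler--Lagrange equation reads \<open>G \<phi> = s^2 \<integral> q \<phi>\<close>.\<close>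
      also have "- G \<phi> + s\<^sup>2 * (LBINT x. q x * \<phi> x) = 0"
        using EL[OF \<phi>] unfolding c3 c5 kl by (simp add: field_simps power2_eq_square)
      finally show "(LBINT x. q x * ((\<Sum>i\<in>UNIV. partial_deriv i (partial_deriv i \<phi>) x) + s\<^sup>2 * \<phi> x)) = 0" .
    qed
    then show False using nz by simp
  qed
  then show "quartic Q = 8 / 3 * dirichlet Q" using pos unfolding k_def by (simp add: field_simps)
qed

text \<open>Stretch \<open>Q\<close> by the factor \<open>s \<ge> 1\<close> that raises its mass to \<open>m\<close>. The gradient term grows like \<open>s\<close> but the
  other terms like \<open>s^3\<close>, so virial and energy, which are \<open>h (s - s^3)\<close> and half of it for
  \<open>h = dirichlet Q\<close>, are nonpositive.\<close>

lemma min_energy_0_nonpos: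
  assumes opt: "normalized_optimizer 0 Q" and m: "mass Q \<le> m"
  shows "min_energy 0 m \<le> 0"
proof -
  note Q = optimizer_properties[OF opt]
  define s where "s = root 3 (m / mass Q)"
  have s3: "s ^ 3 = m / mass Q" and s1: "s \<ge> 1" using m Q(2) by (auto simp: s_def)
  have s0: "1 / s > 0" using s1 by simp
  let ?F = "dilate 1 (1 / s) Q"
  have F: "?F \<in> H1" by (rule H1_dilate(1)[OF Q(1) s0])
  have fn: "mass ?F = m" "quartic ?F = s ^ 3 * (8 / 3 * dirichlet Q)" "sextic ?F = s ^ 3 * dirichlet Q"
    "hardy_form 0 ?F = s * dirichlet Q"
    using s1 Q s3 unfolding functionals_dilate[OF s0] hardy_form_dilate[OF Q(1) s0] hardy_form_0
    by (auto simp: field_simps)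
  have m0: "0 < mass ?F" using m Q(2) fn(1) by simp
  have h: "0 \<le> hardy_form (min 0 0) ?F" using fn(4) s1 functionals_nonneg(4)[of Q] by simp
  have "s \<le> s ^ 3" using s1 self_le_power[of s 3] by simp
  then have le: "s * dirichlet Q \<le> s ^ 3 * dirichlet Q" using functionals_nonneg(4) by (intro mult_right_mono)
  have "virial (min 0 0) ?F \<le> 0" using le h unfolding virial_eq fn by (simp add: fn mult.commute)
  then have "min_energy 0 m \<le> ereal (energy 0 ?F)"
    using min_energy_le_if_virial_nonpos[OF F m0 _ h] potential_integrable_0 fn(1) by simp
  also have "energy 0 ?F \<le> 0"
    using le unfolding energy_eq[OF F potential_integrable_0] fn by (simp add: mult.commute)
  finally show ?thesis by (simp add: zero_ereal_def)
qed

theorem corollary3p8: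
  fixes a :: real and Qa Q0 :: "real^3 \<Rightarrow> complex"
  assumes "a > - 1 / 4"
    and "normalized_optimizer (min a 0) Qa"
    and "normalized_optimizer 0 Q0"
  shows "K_region a Qa \<subseteq> K_region 0 Q0"
proof -
  have "m < mass Q0 \<and> ereal e < min_energy 0 m"
    if m: "0 < m" and e: "0 < e" "ereal e < min_energy a m" for m e
  proof -
    have "0 < min_energy a m" using e less_trans[of 0 "ereal e"] by simp
    then have "min_energy a m \<le> min_energy 0 m" by (rule min_energy_le_min_energy_0[OF m])
    then have lt: "ereal e < min_energy 0 m" using e(2) by (rule less_le_trans[rotated])
    have "m < mass Q0"
    proof (rule ccontr)
      assume "\<not> m < mass Q0"
      then have "min_energy 0 m \<le> 0" using min_energy_0_nonpos[OF assms(3)] by simp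
      then have "ereal e < 0" using lt by (rule less_le_trans[rotated])
      then show False using e(1) by simp
    qed
    with lt show ?thesis by simp
  qed
  then show ?thesis unfolding K_region_def by auto
qed

end
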